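(* Let $G=(V,E)$ be a minimally $d$-rigid graph with at least $d+1$ vertices and let $G'$ be obtained from $G$ by a $d$-dimensional spider-split. Then $c_d(G')\ge c_d(G)$.
   Context: A $d$-dimensional spider-split takes a graph $G$, a vertex $x$, and a partition of the neighbourhood of $x$ into sets $N_1$, $N_2$ and $\{w_1,\dots,w_d\}$; it outputs the graph obtained from $G-x$ by adding new vertices $x_1,x_2$, with $x_i$ joined to all of $N_i$ ($i=1,2$) and both $x_1,x_2$ joined to each of $w_1,\dots,w_d$ (no edge $x_1x_2$). On $\mathbb{C}^d$ use $\|x\|^2=\sum x_i^2$. A realisation is generic if its coordinates are algebraically independent over $\mathbb{Q}$; realisations are equivalent if all edge values $\|p(v)-p(w)\|^2$ agree, congruent if related by $x\mapsto Ax+b$ with $A^TA=AA^T=I$. $G$ is $d$-rigid if some generic framework is rigid, minimally $d$-rigid if moreover $G-e$ is not $d$-rigid for all edges $e$. For a $d$-rigid graph with $|V|\ge d+1$, $c_d(G)$ is the number of congruence classes of complex realisations equivalent to a generic realisation. *)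

theory Defs
  imports "HOL-Analysis.Analysis" "HOL-Library.Extended_Nat"
begin

definition graph :: "'a set \<Rightarrow> 'a set set \<Rightarrow> bool" where
  "graph V E \<longleftrightarrow> finite V \<and> (\<forall>e\<in>E. \<exists>u v. e = {u, v} \<and> u \<noteq> v \<and> u \<in> V \<and> v \<in> V)"

definition nbhd :: "'a set set \<Rightarrow> 'a \<Rightarrow> 'a set" where
  "nbhd E x = {y. {x, y} \<in> E}"

definition sqd :: "'k::comm_ring_1 ^ 'n \<Rightarrow> 'k ^ 'n \<Rightarrow> 'k" where
  "sqd a b = (\<Sum>i\<in>UNIV. (a $ i - b $ i) ^ 2)"

text \<open>Algebraic independence over Q of a finite family of complex numbers:
  no nonzero rational polynomial in the variables indexed by I vanishes.
  Monomials are exponent functions supported on I.\<close>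
definition alg_indep :: "'i set \<Rightarrow> ('i \<Rightarrow> complex) \<Rightarrow> bool" where
  "alg_indep I z \<longleftrightarrow>
     (\<forall>(M :: ('i \<Rightarrow> nat) set) (c :: ('i \<Rightarrow> nat) \<Rightarrow> rat).
        finite M \<and> (\<forall>m\<in>M. \<forall>i. i \<notin> I \<longrightarrow> m i = 0) \<and>
        (\<Sum>m\<in>M. of_rat (c m) * (\<Prod>i\<in>I. z i ^ m i)) = 0
        \<longrightarrow> (\<forall>m\<in>M. c m = 0))"

definition generic_c :: "'a set \<Rightarrow> ('a \<Rightarrow> complex ^ 'n::finite) \<Rightarrow> bool" where
  "generic_c V p \<longleftrightarrow> alg_indep (V \<times> UNIV) (\<lambda>(v, i). p v $ i)"

definition generic_r :: "'a set \<Rightarrow> ('a \<Rightarrow> real ^ 'n::finite) \<Rightarrow> bool" where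
  "generic_r V p \<longleftrightarrow> alg_indep (V \<times> UNIV) (\<lambda>(v, i). complex_of_real (p v $ i))"

definition equivalent :: "'a set set \<Rightarrow> ('a \<Rightarrow> 'k::comm_ring_1 ^ 'n::finite) \<Rightarrow> ('a \<Rightarrow> 'k ^ 'n) \<Rightarrow> bool" where
  "equivalent E p q \<longleftrightarrow> (\<forall>u v. {u, v} \<in> E \<longrightarrow> sqd (p u) (p v) = sqd (q u) (q v))"

definition congruent_on :: "'a set \<Rightarrow> ('a \<Rightarrow> 'k::comm_ring_1 ^ 'n::finite) \<Rightarrow> ('a \<Rightarrow> 'k ^ 'n) \<Rightarrow> bool" where
  "congruent_on V p q \<longleftrightarrow>
     (\<exists>(A :: 'k ^ 'n ^ 'n) b. orthogonal_matrix A \<and> (\<forall>v\<in>V. q v = A *v p v + b))"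

definition rigid_framework :: "'a set \<Rightarrow> 'a set set \<Rightarrow> ('a \<Rightarrow> real ^ 'n::finite) \<Rightarrow> bool" where
  "rigid_framework V E p \<longleftrightarrow>
     (\<exists>\<epsilon>>0. \<forall>q. (\<forall>v\<in>V. dist (q v) (p v) < \<epsilon>) \<and> equivalent E p q \<longrightarrow> congruent_on V p q)"

definition d_rigid :: "'a set \<Rightarrow> 'a set set \<Rightarrow> 'n::finite itself \<Rightarrow> bool" where
  "d_rigid V E _ \<longleftrightarrow> (\<exists>p :: 'a \<Rightarrow> real ^ 'n. generic_r V p \<and> rigid_framework V E p)"

definition min_d_rigid :: "'a set \<Rightarrow> 'a set set \<Rightarrow> 'n::finite itself \<Rightarrow> bool" where
  "min_d_rigid V E T \<longleftrightarrow> d_rigid V E T \<and> (\<forall>e\<in>E. \<not> d_rigid V (E - {e}) T)"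

definition num_classes :: "'a set \<Rightarrow> 'a set set \<Rightarrow> ('a \<Rightarrow> complex ^ 'n::finite) \<Rightarrow> enat" where
  "num_classes V E p =
     (let S = {{q'. equivalent E p q' \<and> congruent_on V q q'} | q. equivalent E p q}
      in if finite S then enat (card S) else \<infinity>)"

definition c_d :: "'a set \<Rightarrow> 'a set set \<Rightarrow> 'n::finite itself \<Rightarrow> enat" where
  "c_d V E _ = num_classes V E (SOME p :: 'a \<Rightarrow> complex ^ 'n. generic_c V p)"

definition spider_split :: "nat \<Rightarrow> 'a set \<Rightarrow> 'a set set \<Rightarrow> 'a \<Rightarrow> 'a set \<Rightarrow> 'a set \<Rightarrow> 'a set
    \<Rightarrow> 'a \<Rightarrow> 'a \<Rightarrow> 'a set \<Rightarrow> 'a set set \<Rightarrow> bool" where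
  "spider_split d V E x N1 N2 W x1 x2 V' E' \<longleftrightarrow>
     x \<in> V \<and> N1 \<inter> N2 = {} \<and> N1 \<inter> W = {} \<and> N2 \<inter> W = {} \<and> N1 \<union> N2 \<union> W = nbhd E x \<and>
     card W = d \<and> x1 \<noteq> x2 \<and> x1 \<notin> V - {x} \<and> x2 \<notin> V - {x} \<and>
     V' = (V - {x}) \<union> {x1, x2} \<and>
     E' = {e \<in> E. x \<notin> e} \<union> {{x1, y} | y. y \<in> N1} \<union> {{x2, y} | y. y \<in> N2}
          \<union> {{x1, w} | w. w \<in> W} \<union> {{x2, w} | w. w \<in> W}"

end

theory Submission
  imports Defs "HOL-Computational_Algebra.Fundamental_Theorem_Algebra"
begin

text \<open>Let \<open>p\<close> be generic for \<open>G\<close>. Minimal rigidity makes the edge lengths of \<open>p\<close> algebraically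
  independent, hence by the Jacobian criterion (prescribe a derivation on the edge lengths and extend
  it to the coordinates) every realisation \<open>q\<close> equivalent to \<open>p\<close> is a regular point of the edge
  length map. Rigidity makes the squared determinant of the vectors \<open>q w\<^sub>i - q x\<close> algebraic over the
  edge lengths, so it is nonzero at every such \<open>q\<close>. Placing \<open>x\<^sub>1\<close> and \<open>x\<^sub>2\<close> at \<open>q x\<close> therefore gives
  a regular point of the edge length map of \<open>G'\<close>, over the special point where \<open>x\<^sub>1\<close> and \<open>x\<^sub>2\<close>
  coincide at \<open>p x\<close>. By the inverse function theorem any finite family of pairwise incongruent \<open>q\<close>
  deforms to a family over a nearby generic realisation of \<open>G'\<close>; incongruence survives because it is
  witnessed by differing distances. Extending a field embedding moves the family from there to any
  other generic realisation of \<open>G'\<close>.\<close>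

text \<open>Rigidity concerns real frameworks near one generic point, while \<open>c_d\<close>
  counts complex realisations over an arbitrary generic point picked by \<open>SOME\<close>. The
  link is always a rational polynomial relation: what holds at one generic point is an identity,
  hence holds at all realisations, real or complex. This is how facts about the real
  \<open>p0\<close> reach the fibre over the complex \<open>p\<close>, whose members need not be
  generic themselves. The spoke determinant serves twice. It provides the velocity corrections at
  the two copies of \<open>x\<close>, and it makes squared distances decide congruence: the complex
  form has isotropic vectors, so equal distances do not imply congruence for configurations that
  fail to span. The coincident placement of the copies is not generic for \<open>G'\<close>; what is
  known to survive a perturbation are the regular points of its fibre. Fraction fields and
  transcendence bases are avoided: derivations and embeddings live on subalgebras of the complex
  numbers and are extended by one generator at a time, finitely often.\<close>

section \<open>Rational polynomial expressions and their formal derivatives\<close>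

text \<open>Syntax trees rather than a polynomial ring: one tree can be evaluated at real and at
  complex points, and evaluation, differentiation and the analytic estimates all go by structural
  induction. Different trees may denote the same polynomial.\<close>

datatype (pvars: 'i) pexp =
  PConst rat | PVar 'i | PAdd "'i pexp" "'i pexp" | PMul "'i pexp" "'i pexp"

primrec peval :: "('i \<Rightarrow> 'k::field_char_0) \<Rightarrow> 'i pexp \<Rightarrow> 'k" where
  "peval z (PConst c) = of_rat c"
| "peval z (PVar i) = z i"
| "peval z (PAdd a b) = peval z a + peval z b"
| "peval z (PMul a b) = peval z a * peval z b"

primrec pder :: "('i \<Rightarrow> 'k::field_char_0) \<Rightarrow> ('i \<Rightarrow> 'k) \<Rightarrow> 'i pexp \<Rightarrow> 'k" where
  "pder z v (PConst c) = 0"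
| "pder z v (PVar i) = v i"
| "pder z v (PAdd a b) = pder z v a + pder z v b"
| "pder z v (PMul a b) = pder z v a * peval z b + peval z a * pder z v b"

primrec psubst :: "('j \<Rightarrow> 'i pexp) \<Rightarrow> 'j pexp \<Rightarrow> 'i pexp" where
  "psubst g (PConst c) = PConst c"
| "psubst g (PVar j) = g j"
| "psubst g (PAdd a b) = PAdd (psubst g a) (psubst g b)"
| "psubst g (PMul a b) = PMul (psubst g a) (psubst g b)"

lemma peval_cong: "(\<And>i. i \<in> pvars e \<Longrightarrow> z i = w i) \<Longrightarrow> peval z e = peval w e"
  by (induction e) auto

lemma peval_psubst [simp]: "peval z (psubst g e) = peval (\<lambda>j. peval z (g j)) e"
  by (induction e) auto

lemma pvars_psubst [simp]: "pvars (psubst g e) = (\<Union>j\<in>pvars e. pvars (g j))"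
  by (induction e) auto

lemma of_rat_eq_of_real: "(of_rat c :: 'k::real_normed_field) = of_real (of_rat c)"
by (cases c) (simp add: of_rat_rat)

lemma peval_of_real: "peval (\<lambda>i. complex_of_real (z i)) e = complex_of_real (peval z e)"
  by (induction e) (auto intro: of_rat_eq_of_real)

text \<open>At a real point the derivative is a linear form with real coefficients, so the real part
  of a complex solution solves a linear system with real right-hand side.\<close>

lemma pder_Re: "pder z (\<lambda>i. Re (v i)) e = Re (pder (\<lambda>i. complex_of_real (z i)) v e)"
  by (induction e) (auto simp: peval_of_real)

lemma pder_0 [simp]: "pder z (\<lambda>i. 0) e = 0"
  by (induction e) auto

lemma pder_add: "pder z (\<lambda>i. v i + w i) e = pder z v e + pder z w e"
  by (induction e) (auto simp: algebra_simps)

lemma pder_scale: "pder z (\<lambda>i. c * v i) e = c * pder z v e"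
  by (induction e) (auto simp: algebra_simps)

lemma pder_sum: "pder z (\<lambda>i. \<Sum>j\<in>J. v j i) e = (\<Sum>j\<in>J. pder z (v j) e)"
  by (induction J rule: infinite_finite_induct) (auto simp: pder_add)

lemma peval_line_derivative:
  fixes z v :: "'i \<Rightarrow> 'k::real_normed_field"
  shows "((\<lambda>s. peval (\<lambda>i. z i + s * v i) e) has_field_derivative pder z v e) (at 0)"
  by (induction e) (auto intro!: derivative_eq_intros)

text \<open>\<open>pder\<close> is defined on trees, and the tree of a polynomial is not unique;
  uniqueness of the analytic derivative shows that only the function matters.\<close>

lemma pder_eq_of_peval:
  fixes z v :: "'i \<Rightarrow> 'k::real_normed_field"
  assumes "\<And>w::'i \<Rightarrow> 'k. peval w e = f w"
    and "((\<lambda>s. f (\<lambda>i. z i + s * v i)) has_field_derivative D) (at 0)"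
  shows "pder z v e = D"
  using DERIV_unique[OF peval_line_derivative[of z v e]] assms by simp

text \<open>Allows polynomiality to be shown by introduction rules, with the tree left
  implicit.\<close>

definition polyfun :: "'i set \<Rightarrow> (('i \<Rightarrow> complex) \<Rightarrow> complex) \<Rightarrow> bool" where
  "polyfun I f \<longleftrightarrow> (\<exists>e. pvars e \<subseteq> I \<and> (\<forall>z. peval z e = f z))"

lemma polyfunE:
  assumes "polyfun I f"
  obtains e where "pvars e \<subseteq> I" "\<And>z. peval z e = f z"
  using assms unfolding polyfun_def by auto

lemma polyfun_peval: "pvars e \<subseteq> I \<Longrightarrow> polyfun I (\<lambda>z. peval z e)"
  unfolding polyfun_def by auto

lemma polyfun_const: "c \<in> \<rat> \<Longrightarrow> polyfun I (\<lambda>z. c)"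
  unfolding polyfun_def using peval.simps(1) pexp.set(1) by (metis Rats_cases empty_subsetI)

lemma polyfun_var: "i \<in> I \<Longrightarrow> polyfun I (\<lambda>z. z i)"
  unfolding polyfun_def by (auto intro!: exI[of _ "PVar _"])

lemma polyfun_add: "polyfun I f \<Longrightarrow> polyfun I g \<Longrightarrow> polyfun I (\<lambda>z. f z + g z)"
  unfolding polyfun_def
  by (elim exE conjE, rule_tac x = "PAdd e ea" in exI) auto

lemma polyfun_mult: "polyfun I f \<Longrightarrow> polyfun I g \<Longrightarrow> polyfun I (\<lambda>z. f z * g z)"
  unfolding polyfun_def
  by (elim exE conjE, rule_tac x = "PMul e ea" in exI) auto

lemma polyfun_diff:
  assumes "polyfun I f" "polyfun I g"
  shows "polyfun I (\<lambda>z. f z - g z)"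
  using polyfun_add[OF assms(1) polyfun_mult[OF polyfun_const[of "-1"] assms(2)]] by simp

lemma polyfun_sum: "(\<And>j. j \<in> J \<Longrightarrow> polyfun I (f j)) \<Longrightarrow> polyfun I (\<lambda>z. \<Sum>j\<in>J. f j z)"
  by (induction J rule: infinite_finite_induct) (auto intro!: polyfun_const polyfun_add)

lemma polyfun_prod: "(\<And>j. j \<in> J \<Longrightarrow> polyfun I (f j)) \<Longrightarrow> polyfun I (\<lambda>z. \<Prod>j\<in>J. f j z)"
  by (induction J rule: infinite_finite_induct) (auto intro!: polyfun_const polyfun_mult)

lemma polyfun_power: "polyfun I f \<Longrightarrow> polyfun I (\<lambda>z. f z ^ k)"
  using polyfun_prod[of "{..<k}" I "\<lambda>_. f"] by simp

lemmas polyfun_intros = polyfun_peval polyfun_const polyfun_var polyfun_add polyfun_mult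
  polyfun_diff polyfun_sum polyfun_prod polyfun_power

section \<open>Subalgebras of the complex numbers and polynomials over them\<close>

definition subalg :: "complex set \<Rightarrow> bool" where
  "subalg R \<longleftrightarrow> \<rat> \<subseteq> R \<and> (\<forall>a\<in>R. \<forall>b\<in>R. a + b \<in> R \<and> a * b \<in> R)"

lemma subalgD:
  assumes "subalg R"
  shows "c \<in> \<rat> \<Longrightarrow> c \<in> R" "0 \<in> R" "1 \<in> R"
    "a \<in> R \<Longrightarrow> b \<in> R \<Longrightarrow> a + b \<in> R" "a \<in> R \<Longrightarrow> b \<in> R \<Longrightarrow> a * b \<in> R"
    "a \<in> R \<Longrightarrow> b \<in> R \<Longrightarrow> a - b \<in> R" "a \<in> R \<Longrightarrow> a ^ k \<in> R"
proof -
  show sub: "c \<in> \<rat> \<Longrightarrow> c \<in> R" for c using assms unfolding subalg_def by auto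
  show "0 \<in> R" "1 \<in> R" using sub by auto
  show add: "a \<in> R \<Longrightarrow> b \<in> R \<Longrightarrow> a + b \<in> R" for a b using assms unfolding subalg_def by auto
  show mul: "a \<in> R \<Longrightarrow> b \<in> R \<Longrightarrow> a * b \<in> R" for a b using assms unfolding subalg_def by auto
  show "a \<in> R \<Longrightarrow> b \<in> R \<Longrightarrow> a - b \<in> R"
    using add[of a "-1 * b"] mul[of "-1" b] sub[of "-1"] by simp
  show "a \<in> R \<Longrightarrow> a ^ k \<in> R"
    by (induction k) (auto simp: mul sub)
qed

lemma subalg_sum: "subalg R \<Longrightarrow> (\<And>j. j \<in> J \<Longrightarrow> f j \<in> R) \<Longrightarrow> sum f J \<in> R"
  by (induction J rule: infinite_finite_induct) (auto simp: subalgD)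

lemma peval_in_subalg: "subalg R \<Longrightarrow> z ` pvars e \<subseteq> R \<Longrightarrow> peval z e \<in> R"
  by (induction e) (auto simp: subalgD image_Un)

text \<open>The ring generated over the rationals by the numbers \<open>z i\<close> with
  \<open>i\<close> in \<open>I\<close>.\<close>

definition pring :: "'i set \<Rightarrow> ('i \<Rightarrow> complex) \<Rightarrow> complex set" where
  "pring I z = {peval z e | e. pvars e \<subseteq> I}"

lemma subalg_pring: "subalg (pring I z)"
  unfolding subalg_def
proof (intro conjI subsetI ballI)
  show "c \<in> pring I z" if "c \<in> \<rat>" for c
    using that polyfun_const[of c I] unfolding pring_def polyfun_def by (auto; metis)
  fix a b assume "a \<in> pring I z" "b \<in> pring I z"
  then obtain e f where "a = peval z e" "pvars e \<subseteq> I" "b = peval z f" "pvars f \<subseteq> I"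
    unfolding pring_def by auto
  then have "a + b = peval z (PAdd e f) \<and> pvars (PAdd e f) \<subseteq> I"
    "a * b = peval z (PMul e f) \<and> pvars (PMul e f) \<subseteq> I" by auto
  then show "a + b \<in> pring I z" "a * b \<in> pring I z"
    unfolding pring_def by blast+
qed

lemma pring_var: "i \<in> I \<Longrightarrow> z i \<in> pring I z"
  unfolding pring_def by (auto intro!: exI[of _ "PVar _"])

lemma pring_subset: "subalg R \<Longrightarrow> z ` I \<subseteq> R \<Longrightarrow> pring I z \<subseteq> R"
  unfolding pring_def by (auto intro!: peval_in_subalg)

definition polys :: "complex set \<Rightarrow> complex poly set" where
  "polys R = {P. \<forall>i. coeff P i \<in> R}"

lemma polys_coeff: "P \<in> polys R \<Longrightarrow> coeff P i \<in> R"
  unfolding polys_def by auto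

lemma polys_intros:
  assumes "subalg R"
  shows "0 \<in> polys R" "P \<in> polys R \<Longrightarrow> Q \<in> polys R \<Longrightarrow> P + Q \<in> polys R"
    "P \<in> polys R \<Longrightarrow> Q \<in> polys R \<Longrightarrow> P - Q \<in> polys R"
    "P \<in> polys R \<Longrightarrow> Q \<in> polys R \<Longrightarrow> P * Q \<in> polys R"
    "c \<in> R \<Longrightarrow> P \<in> polys R \<Longrightarrow> smult c P \<in> polys R"
    "c \<in> R \<Longrightarrow> monom c k \<in> polys R" "c \<in> R \<Longrightarrow> [:c:] \<in> polys R"
    "c \<in> R \<Longrightarrow> P \<in> polys R \<Longrightarrow> pCons c P \<in> polys R"
    "P \<in> polys R \<Longrightarrow> pderiv P \<in> polys R"
proof -
  note R = subalgD[OF assms]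
  show "0 \<in> polys R" using R(2) unfolding polys_def by simp
  show "P \<in> polys R \<Longrightarrow> Q \<in> polys R \<Longrightarrow> P + Q \<in> polys R" using R(4) unfolding polys_def by simp
  show "P \<in> polys R \<Longrightarrow> Q \<in> polys R \<Longrightarrow> P - Q \<in> polys R" using R(6) unfolding polys_def by simp
  show "P \<in> polys R \<Longrightarrow> Q \<in> polys R \<Longrightarrow> P * Q \<in> polys R"
    unfolding polys_def by (auto simp: coeff_mult intro!: subalg_sum[OF assms] R(5))
  show "c \<in> R \<Longrightarrow> P \<in> polys R \<Longrightarrow> smult c P \<in> polys R" using R(5) unfolding polys_def by simp
  show "c \<in> R \<Longrightarrow> monom c k \<in> polys R" using R(2) unfolding polys_def by simp
  show "c \<in> R \<Longrightarrow> P \<in> polys R \<Longrightarrow> pCons c P \<in> polys R" for P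
    unfolding polys_def by (simp add: coeff_pCons split: nat.split)
  then show "c \<in> R \<Longrightarrow> [:c:] \<in> polys R" using R(2) unfolding polys_def by simp
  show "P \<in> polys R \<Longrightarrow> pderiv P \<in> polys R"
    unfolding polys_def by (auto simp: coeff_pderiv intro!: R(5) R(1)[of "1 + of_nat _"])
qed

definition adjoin :: "complex set \<Rightarrow> complex \<Rightarrow> complex set" where
  "adjoin R a = (\<lambda>P. poly P a) ` polys R"

lemma adjoinI: "P \<in> polys R \<Longrightarrow> poly P a \<in> adjoin R a"
  unfolding adjoin_def by (rule imageI)

lemma adjoin_mem:
  assumes "subalg R"
  shows "a \<in> adjoin R a"
  using adjoinI[OF polys_intros(6)[OF assms subalgD(3)[OF assms], of 1], of a]
  by (simp add: poly_monom)

lemma adjoin_superset: "subalg R \<Longrightarrow> R \<subseteq> adjoin R a"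
  using adjoinI[OF polys_intros(7)] by fastforce

lemma subalg_adjoin:
  assumes R: "subalg R"
  shows "subalg (adjoin R a)"
  unfolding subalg_def
proof (intro conjI ballI)
  show "\<rat> \<subseteq> adjoin R a"
    using adjoin_superset[OF R] subalgD(1)[OF R] by blast
  fix u v assume "u \<in> adjoin R a" "v \<in> adjoin R a"
  then obtain P Q where PQ: "P \<in> polys R" "Q \<in> polys R" "u = poly P a" "v = poly Q a"
    unfolding adjoin_def by blast
  show "u + v \<in> adjoin R a" "u * v \<in> adjoin R a"
    using adjoinI[OF polys_intros(2)[OF R PQ(1,2)], of a]
      adjoinI[OF polys_intros(4)[OF R PQ(1,2)], of a] PQ(3,4) by simp_all
qed

lemma adjoin_subset: "subalg S \<Longrightarrow> R \<subseteq> S \<Longrightarrow> a \<in> S \<Longrightarrow> adjoin R a \<subseteq> S"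
  unfolding adjoin_def polys_def
  by (force simp: poly_altdef intro!: subalg_sum subalgD(5,7))

lemma pring_insert: "pring (insert i I) z = adjoin (pring I z) (z i)"
proof
  show "pring (insert i I) z \<subseteq> adjoin (pring I z) (z i)"
    using adjoin_superset[OF subalg_pring, of I z "z i"] adjoin_mem[OF subalg_pring, of "z i" I z]
      pring_var[of _ I z]
    by (intro pring_subset subalg_adjoin subalg_pring) auto
  show "adjoin (pring I z) (z i) \<subseteq> pring (insert i I) z"
    using pring_var[of i "insert i I" z]
    by (intro adjoin_subset subalg_pring) (auto simp: pring_def)
qed

lemma countable_polys: "countable R \<Longrightarrow> countable (polys R)"
proof -
  assume "countable R"
  then have "countable (Poly ` lists R)" by auto
  moreover have "polys R \<subseteq> Poly ` lists R"
  proof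
    fix P assume "P \<in> polys R"
    then have "coeffs P \<in> lists R" unfolding polys_def coeffs_def by auto
    then show "P \<in> Poly ` lists R" by (metis Poly_coeffs image_eqI)
  qed
  ultimately show ?thesis by (rule countable_subset[rotated])
qed

lemma countable_adjoin: "countable R \<Longrightarrow> countable (adjoin R a)"
  unfolding adjoin_def by (intro countable_image countable_polys)

lemma pring_empty: "pring {} z = \<rat>"
proof
  have "subalg \<rat>" by (auto simp: subalg_def)
  then show "pring {} z \<subseteq> \<rat>" by (intro pring_subset) auto
  show "\<rat> \<subseteq> pring {} z" using subalg_pring[of "{}" z] by (auto simp: subalg_def)
qed

lemma countable_pring: "finite I \<Longrightarrow> countable (pring I z)"
  by (induction I rule: finite_induct) (auto simp: pring_empty pring_insert countable_adjoin countable_rat)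

definition transcendental_over :: "complex set \<Rightarrow> complex \<Rightarrow> bool" where
  "transcendental_over R a \<longleftrightarrow> (\<forall>P\<in>polys R. poly P a = 0 \<longrightarrow> P = 0)"

text \<open>Nonzero polynomials over a countable \<open>R\<close> have only countably many roots
  altogether, whereas a ball is uncountable.\<close>

lemma exists_transcendental:
  assumes "countable R" "\<epsilon> > 0"
  shows "\<exists>a. cmod (a - b) < \<epsilon> \<and> transcendental_over R a"
proof -
  let ?A = "\<Union>P\<in>polys R - {0}. {a. poly P a = 0}"
  have "countable ?A"
    using countable_polys[OF assms(1)]
    by (intro countable_UN) (auto simp: poly_roots_finite countable_finite)
  then have "\<not> ball b \<epsilon> \<subseteq> ?A"
    using uncountable_ball[OF assms(2), of b] countable_subset by blast
  then show ?thesis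
    unfolding transcendental_over_def by (fastforce simp: dist_norm norm_minus_commute)
qed

text \<open>\<open>R\<close> is only a ring, so the leading coefficient of \<open>m\<close> cannot
  be inverted; a power of it is multiplied in instead.\<close>

lemma polys_pseudo_division:
  assumes R: "subalg R" and m: "m \<in> polys R" "m \<noteq> 0" and "P \<in> polys R"
  shows "\<exists>k Q S. Q \<in> polys R \<and> S \<in> polys R \<and> smult (lead_coeff m ^ k) P = m * Q + S \<and>
    (S = 0 \<or> degree S < degree m)"
  using assms(4)
proof (induction "degree P" arbitrary: P rule: less_induct)
  case less
  show ?case
  proof (cases "P = 0 \<or> degree P < degree m")
    case True
    then show ?thesis using less.prems polys_intros(1)[OF R]
      by (intro exI[of _ 0] exI[of _ "0::complex poly"] exI[of _ P]) auto
  next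
    case False
    define T where "T = monom (lead_coeff P) (degree P - degree m)"
    define P2 where "P2 = smult (lead_coeff m) P - m * T"
    have T: "T \<in> polys R" unfolding T_def using less.prems polys_coeff polys_intros(6)[OF R] by blast
    have P2: "P2 \<in> polys R" unfolding P2_def using R less.prems m T polys_coeff
      by (intro polys_intros) auto
    have lm: "lead_coeff m \<noteq> 0" using m by auto
    \<comment> \<open>Constants are treated apart: cancelling their leading term leaves degree
      \<open>0\<close> again, so the induction measure would not drop.\<close>
    show ?thesis
    proof (cases "degree P = 0")
      case True
      then have "degree m = 0" using False by auto
      then obtain a b where "P = [:a:]" "m = [:b:]" using True by (metis degree_eq_zeroE)
      then show ?thesis using less.prems polys_intros(1)[OF R]
        by (intro exI[of _ 1] exI[of _ P] exI[of _ "0::complex poly"]) auto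
    next
      case pos: False
      have "degree P2 < degree P"
      proof -
        have "degree (m * T) \<le> degree P"
          using degree_mult_le[of m T] degree_monom_le[of "lead_coeff P" "degree P - degree m"] False
          unfolding T_def by (auto simp: not_less)
        then have "degree P2 \<le> degree P" unfolding P2_def
          by (intro degree_diff_le) (auto intro: order_trans[OF degree_smult_le])
        moreover have "coeff (m * T) (degree P) = lead_coeff m * lead_coeff P"
          using False unfolding T_def by (simp add: mult.commute[of m] coeff_monom_mult not_less)
        then have "coeff P2 (degree P) = 0" unfolding P2_def by simp
        ultimately show ?thesis using pos by (metis degree_0 leading_coeff_0_iff le_neq_implies_less)
      qed
      then obtain k Q S where IH: "Q \<in> polys R" "S \<in> polys R"
        "smult (lead_coeff m ^ k) P2 = m * Q + S" "S = 0 \<or> degree S < degree m"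
        using less.hyps[OF _ P2] by blast
      have "smult (lead_coeff m ^ Suc k) P = smult (lead_coeff m ^ k) (P2 + m * T)"
        unfolding P2_def by (simp add: mult.commute)
      also have "\<dots> = m * (Q + smult (lead_coeff m ^ k) T) + S"
        using IH(3) by (simp add: smult_add_right algebra_simps)
      finally show ?thesis
        using IH T R m polys_coeff subalgD(7)[OF R]
        by (intro exI[of _ "Suc k"] exI[of _ "Q + smult (lead_coeff m ^ k) T"] exI[of _ S])
          (auto intro!: polys_intros)
    qed
  qed
qed

text \<open>\<open>m\<close> stands in for the minimal polynomial over the fraction field. If
  \<open>P\<close> kills \<open>a\<close>, so does its pseudo-remainder modulo \<open>m\<close>,
  which has smaller degree and is therefore zero; this gives divisibility up to the scalar
  \<open>c\<close>.\<close>

lemma minimal_annihilator: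
  assumes R: "subalg R" and a: "\<not> transcendental_over R a"
  obtains m where "m \<in> polys R" "m \<noteq> 0" "poly m a = 0" "degree m > 0"
    "\<And>P. P \<in> polys R \<Longrightarrow> poly P a = 0 \<Longrightarrow> P \<noteq> 0 \<Longrightarrow> degree m \<le> degree P"
    "\<And>P. P \<in> polys R \<Longrightarrow> poly P a = 0 \<Longrightarrow>
      \<exists>c Q. c \<in> R \<and> c \<noteq> 0 \<and> Q \<in> polys R \<and> smult c P = m * Q"
proof -
  let ?A = "\<lambda>P. P \<in> polys R \<and> poly P a = 0 \<and> P \<noteq> 0"
  have ex: "\<exists>P. ?A P" using a unfolding transcendental_over_def by auto
  define m where "m = (ARG_MIN degree P. ?A P)"
  have m: "?A m" unfolding m_def using arg_min_natI[of ?A] ex by blast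
  have min: "?A P \<Longrightarrow> degree m \<le> degree P" for P
    unfolding m_def using arg_min_nat_le[of ?A] by blast
  have pos: "degree m > 0"
    using m by (metis bot_nat_0.not_eq_extremum degree_eq_zeroE mpoly_base_conv(2) pCons_0_0)
  have div: "\<exists>c Q. c \<in> R \<and> c \<noteq> 0 \<and> Q \<in> polys R \<and> smult c P = m * Q"
    if P: "P \<in> polys R" "poly P a = 0" for P
  proof -
    obtain k Q S where d: "Q \<in> polys R" "S \<in> polys R"
      "smult (lead_coeff m ^ k) P = m * Q + S" "S = 0 \<or> degree S < degree m"
      using polys_pseudo_division[OF R _ _ P(1)] m by blast
    have "poly S a = 0" using arg_cong[OF d(3), of "\<lambda>p. poly p a"] P m by simp
    then have "S = 0" using d min[of S] by fastforce
    then show ?thesis using d m polys_coeff[of m R] subalgD(7)[OF R]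
      by (intro exI[of _ "lead_coeff m ^ k"] exI[of _ Q]) auto
  qed
  show ?thesis using that[of m] m min pos div by blast
qed

section \<open>Derivations and embeddings of subalgebras of the complex numbers\<close>

definition derivation_on :: "complex set \<Rightarrow> (complex \<Rightarrow> complex) \<Rightarrow> bool" where
  "derivation_on R D \<longleftrightarrow> (\<forall>c\<in>\<rat>. D c = 0) \<and>
     (\<forall>a\<in>R. \<forall>b\<in>R. D (a + b) = D a + D b \<and> D (a * b) = D a * b + a * D b)"

lemma derivation_onD:
  assumes "derivation_on R D"
  shows "c \<in> \<rat> \<Longrightarrow> D c = 0" "D 0 = 0"
    "a \<in> R \<Longrightarrow> b \<in> R \<Longrightarrow> D (a + b) = D a + D b"
    "a \<in> R \<Longrightarrow> b \<in> R \<Longrightarrow> D (a * b) = D a * b + a * D b"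
  using assms unfolding derivation_on_def by auto

lemma derivation_on_sum:
  assumes "subalg R" "derivation_on R D"
  shows "(\<And>j. j \<in> J \<Longrightarrow> f j \<in> R) \<Longrightarrow> D (sum f J) = (\<Sum>j\<in>J. D (f j))"
  by (induction J rule: infinite_finite_induct)
    (auto simp: derivation_onD[OF assms(2)] subalg_sum[OF assms(1)])

lemma derivation_on_peval:
  assumes "subalg R" "derivation_on R D"
  shows "z ` pvars e \<subseteq> R \<Longrightarrow> D (peval z e) = pder z (\<lambda>i. D (z i)) e"
  by (induction e)
    (auto simp: derivation_onD[OF assms(2)] peval_in_subalg[OF assms(1)] image_Un)

text \<open>The value forced on \<open>P(a)\<close> by an extension of \<open>D\<close> that sends \<open>a\<close> to \<open>c\<close>.\<close>
definition derive_at :: "(complex \<Rightarrow> complex) \<Rightarrow> complex \<Rightarrow> complex \<Rightarrow> complex poly \<Rightarrow> complex" where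
  "derive_at D a c P = poly (map_poly D P) a + poly (pderiv P) a * c"

context
  fixes R D assumes R: "subalg R" and D: "derivation_on R D"
begin

lemma derive_at_const: "derive_at D a c [:r:] = D r"
  using derivation_onD(2)[OF D] unfolding derive_at_def
  by (cases "r = 0") (auto simp: map_poly_pCons pderiv_pCons)

lemma derive_at_add:
  assumes "P \<in> polys R" "Q \<in> polys R"
  shows "derive_at D a c (P + Q) = derive_at D a c P + derive_at D a c Q"
proof -
  have "map_poly D (P + Q) = map_poly D P + map_poly D Q"
    using assms polys_coeff derivation_onD[OF D]
    by (intro poly_eqI) (auto simp: coeff_map_poly)
  then show ?thesis unfolding derive_at_def by (simp add: pderiv_add algebra_simps)
qed

lemma derive_at_mult:
  assumes P: "P \<in> polys R" and Q: "Q \<in> polys R"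
  shows "derive_at D a c (P * Q) = derive_at D a c P * poly Q a + poly P a * derive_at D a c Q"
proof -
  have "map_poly D (P * Q) = map_poly D P * Q + P * map_poly D Q"
  proof (rule poly_eqI)
    fix n
    have "coeff (map_poly D (P * Q)) n = D (\<Sum>i\<le>n. coeff P i * coeff Q (n - i))"
      by (simp add: coeff_map_poly derivation_onD[OF D] coeff_mult)
    also have "\<dots> = (\<Sum>i\<le>n. D (coeff P i * coeff Q (n - i)))"
      using polys_coeff[OF P] polys_coeff[OF Q]
      by (intro derivation_on_sum[OF R D]) (auto intro: subalgD(5)[OF R])
    also have "\<dots> = coeff (map_poly D P * Q + P * map_poly D Q) n"
      using polys_coeff[OF P] polys_coeff[OF Q]
      by (simp add: coeff_map_poly derivation_onD[OF D] coeff_mult sum.distrib)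
    finally show "coeff (map_poly D (P * Q)) n = coeff (map_poly D P * Q + P * map_poly D Q) n" .
  qed
  then show ?thesis unfolding derive_at_def by (simp add: pderiv_mult algebra_simps)
qed

text \<open>For transcendental \<open>a\<close> every \<open>c\<close> works. For algebraic
  \<open>a\<close> the value \<open>c\<close> is forced by \<open>m\<close>, and the equation for it
  is solvable: in characteristic zero \<open>pderiv m\<close> is nonzero of smaller degree, so it
  cannot vanish at \<open>a\<close>.\<close>

lemma derive_at_vanishes: "\<exists>c. \<forall>P\<in>polys R. poly P a = 0 \<longrightarrow> derive_at D a c P = 0"
proof (cases "transcendental_over R a")
  case True
  then show ?thesis
    using derive_at_const[of a _ 0] derivation_onD(2)[OF D] unfolding transcendental_over_def by fastforce
next
  case False
  obtain m where m: "m \<in> polys R" "m \<noteq> 0" "poly m a = 0" "degree m > 0"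
    and min: "\<And>P. P \<in> polys R \<Longrightarrow> poly P a = 0 \<Longrightarrow> P \<noteq> 0 \<Longrightarrow> degree m \<le> degree P"
    and dvd: "\<And>P. P \<in> polys R \<Longrightarrow> poly P a = 0 \<Longrightarrow>
      \<exists>c Q. c \<in> R \<and> c \<noteq> 0 \<and> Q \<in> polys R \<and> smult c P = m * Q"
    using minimal_annihilator[OF R False] by metis
  have "poly (pderiv m) a \<noteq> 0"
    using min[of "pderiv m"] polys_intros(9)[OF R m(1)] m(4) pderiv_eq_0_iff[of m]
    by (auto simp: degree_pderiv)
  then have "\<exists>c. derive_at D a c m = 0"
    unfolding derive_at_def
    by (intro exI[of _ "- poly (map_poly D m) a / poly (pderiv m) a"]) simp
  then obtain c where c: "derive_at D a c m = 0" by blast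
  show ?thesis
  proof (intro exI[of _ c] ballI impI)
    fix P assume P: "P \<in> polys R" "poly P a = 0"
    obtain r Q where Q: "r \<in> R" "r \<noteq> 0" "Q \<in> polys R" "[:r:] * P = m * Q"
      using dvd[OF P] by auto
    \<comment> \<open>The term with \<open>D r\<close> drops out because \<open>P\<close> vanishes
      at \<open>a\<close>.\<close>
    have "derive_at D a c ([:r:] * P) = r * derive_at D a c P"
      using derive_at_mult[OF polys_intros(7)[OF R Q(1)] P(1)] P(2) by simp
    moreover have "derive_at D a c (m * Q) = 0"
      using derive_at_mult[OF m(1) Q(3)] c m(3) by simp
    ultimately show "derive_at D a c P = 0" using Q by simp
  qed
qed

text \<open>Two polynomials with the same value at \<open>a\<close> differ by one that vanishes
  there, and \<open>derive_at\<close> is zero on it; hence the choice of representative by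
  \<open>SOME\<close> is harmless.\<close>

lemma derivation_adjoin:
  "\<exists>D'. derivation_on (adjoin R a) D' \<and> (\<forall>r\<in>R. D' r = D r)"
proof -
  obtain c where c: "\<And>P. P \<in> polys R \<Longrightarrow> poly P a = 0 \<Longrightarrow> derive_at D a c P = 0"
    using derive_at_vanishes by blast
  define D' where "D' x = derive_at D a c (SOME P. P \<in> polys R \<and> poly P a = x)" for x
  have D': "D' (poly P a) = derive_at D a c P" if P: "P \<in> polys R" for P
  proof -
    define Q where "Q = (SOME Q. Q \<in> polys R \<and> poly Q a = poly P a)"
    have Q: "Q \<in> polys R" "poly Q a = poly P a"
      using someI[of "\<lambda>Q. Q \<in> polys R \<and> poly Q a = poly P a" P] P unfolding Q_def by auto
    have "derive_at D a c ((P - Q) + Q) = derive_at D a c (P - Q) + derive_at D a c Q"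
      using P Q by (intro derive_at_add polys_intros(3)[OF R])
    moreover have "derive_at D a c (P - Q) = 0"
      using P Q by (intro c polys_intros(3)[OF R]) auto
    ultimately show ?thesis unfolding D'_def Q_def[symmetric] by simp
  qed
  have res: "D' r = D r" if "r \<in> R" for r
    using D'[OF polys_intros(7)[OF R that]] derive_at_const by simp
  have "derivation_on (adjoin R a) D'"
    unfolding derivation_on_def
  proof (intro conjI ballI)
    show "D' r = 0" if "r \<in> \<rat>" for r
      using res[of r] subalgD(1)[OF R that] derivation_onD(1)[OF D that] by simp
    fix u v assume "u \<in> adjoin R a" "v \<in> adjoin R a"
    then obtain P Q where PQ: "P \<in> polys R" "Q \<in> polys R" "u = poly P a" "v = poly Q a"
      unfolding adjoin_def by blast
    show "D' (u + v) = D' u + D' v"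
      using D'[OF polys_intros(2)[OF R PQ(1,2)]] D' PQ derive_at_add by simp
    show "D' (u * v) = D' u * v + u * D' v"
      using D'[OF polys_intros(4)[OF R PQ(1,2)]] D' PQ derive_at_mult by simp
  qed
  then show ?thesis using res by blast
qed

end

lemma derivation_extend:
  assumes "finite A" "subalg R" "derivation_on R D"
  shows "\<exists>S D'. subalg S \<and> R \<subseteq> S \<and> A \<subseteq> S \<and> derivation_on S D' \<and> (\<forall>r\<in>R. D' r = D r)"
  using assms(1)
proof (induction A rule: finite_induct)
  case empty
  then show ?case using assms by blast
next
  case (insert a A)
  then obtain S D' where S: "subalg S" "R \<subseteq> S" "A \<subseteq> S" "derivation_on S D'" "\<forall>r\<in>R. D' r = D r"
    by blast
  obtain D'' where D'': "derivation_on (adjoin S a) D''" "\<forall>r\<in>S. D'' r = D' r"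
    using derivation_adjoin[OF S(1,4)] by blast
  show ?case
    using S D'' subalg_adjoin[OF S(1), of a] adjoin_superset[OF S(1), of a] adjoin_mem[OF S(1), of a]
    by (intro exI[of _ "adjoin S a"] exI[of _ D'']) auto
qed

section \<open>Extending embeddings\<close>

text \<open>On a field injectivity would be automatic; on a subalgebra the trivial kernel has to be
  demanded.\<close>

definition embedding_on :: "complex set \<Rightarrow> (complex \<Rightarrow> complex) \<Rightarrow> bool" where
  "embedding_on R \<phi> \<longleftrightarrow> (\<forall>c\<in>\<rat>. \<phi> c = c) \<and>
     (\<forall>a\<in>R. \<forall>b\<in>R. \<phi> (a + b) = \<phi> a + \<phi> b \<and> \<phi> (a * b) = \<phi> a * \<phi> b) \<and>
     (\<forall>a\<in>R. \<phi> a = 0 \<longrightarrow> a = 0)"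

lemma embedding_onD:
  assumes "embedding_on R \<phi>"
  shows "c \<in> \<rat> \<Longrightarrow> \<phi> c = c" "\<phi> 0 = 0" "\<phi> 1 = 1"
    "a \<in> R \<Longrightarrow> b \<in> R \<Longrightarrow> \<phi> (a + b) = \<phi> a + \<phi> b"
    "a \<in> R \<Longrightarrow> b \<in> R \<Longrightarrow> \<phi> (a * b) = \<phi> a * \<phi> b"
    "a \<in> R \<Longrightarrow> \<phi> a = 0 \<Longrightarrow> a = 0"
  using assms unfolding embedding_on_def by auto

lemma embedding_on_sum:
  assumes "subalg R" "embedding_on R \<phi>"
  shows "(\<And>j. j \<in> J \<Longrightarrow> f j \<in> R) \<Longrightarrow> \<phi> (sum f J) = (\<Sum>j\<in>J. \<phi> (f j))"
  by (induction J rule: infinite_finite_induct)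
    (auto simp: embedding_onD[OF assms(2)] subalg_sum[OF assms(1)])

lemma embedding_on_peval:
  assumes "subalg R" "embedding_on R \<phi>"
  shows "z ` pvars e \<subseteq> R \<Longrightarrow> \<phi> (peval z e) = peval (\<lambda>i. \<phi> (z i)) e"
  by (induction e)
    (auto simp: embedding_onD[OF assms(2)] peval_in_subalg[OF assms(1)] image_Un)

context
  fixes R \<phi> assumes R: "subalg R" and \<phi>: "embedding_on R \<phi>"
begin

lemma embed_poly_add:
  assumes "P \<in> polys R" "Q \<in> polys R"
  shows "map_poly \<phi> (P + Q) = map_poly \<phi> P + map_poly \<phi> Q"
  using assms polys_coeff embedding_onD[OF \<phi>]
  by (intro poly_eqI) (auto simp: coeff_map_poly)

lemma embed_poly_mult:
  assumes P: "P \<in> polys R" and Q: "Q \<in> polys R"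
  shows "map_poly \<phi> (P * Q) = map_poly \<phi> P * map_poly \<phi> Q"
proof (rule poly_eqI)
  fix n
  have "coeff (map_poly \<phi> (P * Q)) n = \<phi> (\<Sum>i\<le>n. coeff P i * coeff Q (n - i))"
    by (simp add: coeff_map_poly embedding_onD[OF \<phi>] coeff_mult)
  also have "\<dots> = (\<Sum>i\<le>n. \<phi> (coeff P i * coeff Q (n - i)))"
    using polys_coeff[OF P] polys_coeff[OF Q]
    by (intro embedding_on_sum[OF R \<phi>]) (auto intro: subalgD(5)[OF R])
  also have "\<dots> = coeff (map_poly \<phi> P * map_poly \<phi> Q) n"
    using polys_coeff[OF P] polys_coeff[OF Q]
    by (simp add: coeff_map_poly embedding_onD[OF \<phi>] coeff_mult)
  finally show "coeff (map_poly \<phi> (P * Q)) n = coeff (map_poly \<phi> P * map_poly \<phi> Q) n" .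
qed

lemma embed_poly_const: "map_poly \<phi> [:r:] = [:\<phi> r:]"
  by (cases "r = 0") (auto simp: map_poly_pCons embedding_onD[OF \<phi>])

lemma embed_poly_eq_0:
  assumes "P \<in> polys R" "map_poly \<phi> P = 0"
  shows "P = 0"
proof (rule poly_eqI)
  fix n
  have "\<phi> (coeff P n) = 0"
    using arg_cong[OF assms(2), of "\<lambda>p. coeff p n"] by (simp add: coeff_map_poly embedding_onD[OF \<phi>])
  then show "coeff P n = coeff 0 n" using embedding_onD(6)[OF \<phi>] polys_coeff[OF assms(1)] by simp
qed

text \<open>The image \<open>b\<close> of \<open>a\<close> must satisfy exactly the transported
  relations: one direction makes the extension well defined, the other makes it injective. A
  transcendental \<open>a\<close> goes to a number transcendental over the countable image of
  \<open>R\<close>, an algebraic one to a root of the transported minimal annihilator.\<close>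

lemma embed_root: "countable R \<Longrightarrow>
  \<exists>b. \<forall>P\<in>polys R. poly P a = 0 \<longleftrightarrow> poly (map_poly \<phi> P) b = 0"
proof (cases "transcendental_over R a")
  case True
  assume "countable R"
  then obtain b where b: "transcendental_over (\<phi> ` R) b"
    using exists_transcendental[of "\<phi> ` R" 1] by auto
  have "map_poly \<phi> P \<in> polys (\<phi> ` R)" if "P \<in> polys R" for P
    using that unfolding polys_def by (simp add: coeff_map_poly embedding_onD[OF \<phi>])
  then show ?thesis
    using True b embed_poly_eq_0 unfolding transcendental_over_def
    by (metis map_poly_0 poly_0)
next
  case False
  obtain m where m: "m \<in> polys R" "m \<noteq> 0" "poly m a = 0" "degree m > 0"
    and min: "\<And>P. P \<in> polys R \<Longrightarrow> poly P a = 0 \<Longrightarrow> P \<noteq> 0 \<Longrightarrow> degree m \<le> degree P"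
    and dvd: "\<And>P. P \<in> polys R \<Longrightarrow> poly P a = 0 \<Longrightarrow>
      \<exists>c Q. c \<in> R \<and> c \<noteq> 0 \<and> Q \<in> polys R \<and> smult c P = m * Q"
    using minimal_annihilator[OF R False] by metis
  have "\<phi> (lead_coeff m) \<noteq> 0"
    using m polys_coeff[OF m(1)] embedding_onD(6)[OF \<phi>] by fastforce
  then have "degree (map_poly \<phi> m) > 0"
    using m(4) le_degree[of "map_poly \<phi> m" "degree m"] by (simp add: coeff_map_poly embedding_onD[OF \<phi>])
  then obtain b where b: "poly (map_poly \<phi> m) b = 0"
    using fundamental_theorem_of_algebra constant_degree by (metis less_not_refl)
  define \<eta> where "\<eta> P = poly (map_poly \<phi> P) b" for P
  have \<eta>_add: "\<eta> (P + Q) = \<eta> P + \<eta> Q" and \<eta>_mult: "\<eta> (P * Q) = \<eta> P * \<eta> Q"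
    if "P \<in> polys R" "Q \<in> polys R" for P Q
    using that embed_poly_add embed_poly_mult unfolding \<eta>_def by auto
  have \<eta>_smult: "\<eta> (smult r P) = \<phi> r * \<eta> P" if "r \<in> R" "P \<in> polys R" for r P
    using \<eta>_mult[OF polys_intros(7)[OF R that(1)] that(2)] embed_poly_const unfolding \<eta>_def by simp
  have \<eta>m: "\<eta> m = 0" using b unfolding \<eta>_def .
  have 1: "\<eta> P = 0" if P: "P \<in> polys R" "poly P a = 0" for P
  proof -
    obtain r Q where Q: "r \<in> R" "r \<noteq> 0" "Q \<in> polys R" "smult r P = m * Q"
      using dvd[OF P] by blast
    then have "\<phi> r * \<eta> P = 0" using \<eta>_smult[OF Q(1) P(1)] \<eta>_mult[OF m(1) Q(3)] \<eta>m by simp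
    then show ?thesis using Q embedding_onD(6)[OF \<phi> Q(1)] by auto
  qed
  \<comment> \<open>Let \<open>B\<close> be a counterexample of least degree. Then \<open>B\<close>
    has smaller degree than \<open>m\<close> and divides it up to a scalar, and the cofactor
    \<open>Q\<close> kills \<open>a\<close>. Minimality of \<open>m\<close> gives \<open>Q\<close>
    the full degree, so \<open>B\<close> is a nonzero constant sent to zero, against injectivity of
    \<open>\<phi>\<close>.\<close>
  have 2: "poly P a = 0" if "P \<in> polys R" "\<eta> P = 0" for P
  proof (rule ccontr)
    assume "poly P a \<noteq> 0"
    let ?A = "\<lambda>P. P \<in> polys R \<and> \<eta> P = 0 \<and> poly P a \<noteq> 0"
    define B where "B = (ARG_MIN degree P. ?A P)"
    have B: "B \<in> polys R" "\<eta> B = 0" "poly B a \<noteq> 0"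
      using arg_min_natI[of ?A P degree] that \<open>poly P a \<noteq> 0\<close> unfolding B_def by auto
    have Bmin: "?A P \<Longrightarrow> degree B \<le> degree P" for P
      unfolding B_def using arg_min_nat_le[of ?A] by blast
    have B0: "B \<noteq> 0" using B by auto
    have degB: "degree B < degree m"
    proof -
      obtain k Q S where d: "Q \<in> polys R" "S \<in> polys R"
        "smult (lead_coeff m ^ k) B = m * Q + S" "S = 0 \<or> degree S < degree m"
        using polys_pseudo_division[OF R m(1,2) B(1)] by blast
      have "\<eta> S = 0"
        using arg_cong[OF d(3), of \<eta>] \<eta>_smult[OF subalgD(7)[OF R polys_coeff[OF m(1)]] B(1)]
          \<eta>_add[OF polys_intros(4)[OF R m(1) d(1)] d(2)] \<eta>_mult[OF m(1) d(1)] \<eta>m B(2) by simp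
      moreover have "poly S a \<noteq> 0"
        using arg_cong[OF d(3), of "\<lambda>p. poly p a"] m(2,3) B(3) by auto
      ultimately show ?thesis using Bmin[of S] d by fastforce
    qed
    obtain k Q S where d: "Q \<in> polys R" "S \<in> polys R"
      "smult (lead_coeff B ^ k) m = B * Q + S" "S = 0 \<or> degree S < degree B"
      using polys_pseudo_division[OF R B(1) B0 m(1)] by blast
    have "\<eta> S = 0"
      using arg_cong[OF d(3), of \<eta>] \<eta>_smult[OF subalgD(7)[OF R polys_coeff[OF B(1)]] m(1)]
        \<eta>_add[OF polys_intros(4)[OF R B(1) d(1)] d(2)] \<eta>_mult[OF B(1) d(1)] \<eta>m B(2) by simp
    then have "poly S a = 0" using Bmin[of S] d B0 by fastforce
    then have S0: "S = 0" using min[of S] d degB by fastforce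
    then have "poly Q a = 0" using arg_cong[OF d(3), of "\<lambda>p. poly p a"] m(3) B(3) by simp
    moreover have "Q \<noteq> 0" using d(3) S0 m(2) B0 by auto
    ultimately have "degree m \<le> degree Q" using min d by blast
    moreover have "degree m = degree B + degree Q"
      using arg_cong[OF d(3), of degree] S0 B0 \<open>Q \<noteq> 0\<close> by (simp add: degree_mult_eq)
    ultimately obtain r where r: "B = [:r:]" by (auto elim: degree_eq_zeroE)
    then have "r \<in> R" using polys_coeff[OF B(1), of 0] by simp
    moreover have "\<phi> r = 0" using B(2) r embed_poly_const unfolding \<eta>_def by simp
    ultimately show False using embedding_onD(6)[OF \<phi>] r B0 by auto
  qed
  show ?thesis using 1 2 unfolding \<eta>_def by blast
qed

lemma embedding_adjoin:
  assumes "countable R"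
  shows "\<exists>\<psi>. embedding_on (adjoin R a) \<psi> \<and> (\<forall>r\<in>R. \<psi> r = \<phi> r)"
proof -
  obtain b where b: "\<And>P. P \<in> polys R \<Longrightarrow> poly P a = 0 \<longleftrightarrow> poly (map_poly \<phi> P) b = 0"
    using embed_root[OF assms] by blast
  define \<eta> where "\<eta> P = poly (map_poly \<phi> P) b" for P
  have \<eta>_add: "\<eta> (P + Q) = \<eta> P + \<eta> Q" and \<eta>_mult: "\<eta> (P * Q) = \<eta> P * \<eta> Q"
    if "P \<in> polys R" "Q \<in> polys R" for P Q
    using that embed_poly_add embed_poly_mult unfolding \<eta>_def by auto
  define \<psi> where "\<psi> x = \<eta> (SOME P. P \<in> polys R \<and> poly P a = x)" for x
  have \<psi>: "\<psi> (poly P a) = \<eta> P" if P: "P \<in> polys R" for P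
  proof -
    define Q where "Q = (SOME Q. Q \<in> polys R \<and> poly Q a = poly P a)"
    have Q: "Q \<in> polys R" "poly Q a = poly P a"
      using someI[of "\<lambda>Q. Q \<in> polys R \<and> poly Q a = poly P a" P] P unfolding Q_def by auto
    have "\<eta> ((P - Q) + Q) = \<eta> (P - Q) + \<eta> Q"
      using P Q by (intro \<eta>_add polys_intros(3)[OF R])
    moreover have "\<eta> (P - Q) = 0"
      using b[OF polys_intros(3)[OF R P Q(1)]] Q(2) unfolding \<eta>_def by simp
    ultimately show ?thesis unfolding \<psi>_def Q_def[symmetric] by simp
  qed
  have res: "\<psi> r = \<phi> r" if "r \<in> R" for r
    using \<psi>[OF polys_intros(7)[OF R that]] embed_poly_const unfolding \<eta>_def by simp
  have "embedding_on (adjoin R a) \<psi>"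
    unfolding embedding_on_def
  proof (intro conjI ballI impI)
    show "\<psi> r = r" if "r \<in> \<rat>" for r
      using res[of r] subalgD(1)[OF R that] embedding_onD(1)[OF \<phi> that] by simp
    show "u = 0" if "u \<in> adjoin R a" "\<psi> u = 0" for u
      using that b \<psi> unfolding adjoin_def \<eta>_def by auto
    fix u v assume "u \<in> adjoin R a" "v \<in> adjoin R a"
    then obtain P Q where PQ: "P \<in> polys R" "Q \<in> polys R" "u = poly P a" "v = poly Q a"
      unfolding adjoin_def by blast
    show "\<psi> (u + v) = \<psi> u + \<psi> v"
      using \<psi>[OF polys_intros(2)[OF R PQ(1,2)]] \<psi> PQ \<eta>_add by simp
    show "\<psi> (u * v) = \<psi> u * \<psi> v"
      using \<psi>[OF polys_intros(4)[OF R PQ(1,2)]] \<psi> PQ \<eta>_mult by simp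
  qed
  then show ?thesis using res by blast
qed

end

lemma embedding_extend:
  assumes "finite A" "subalg R" "embedding_on R \<phi>" "countable R"
  shows "\<exists>S \<psi>. subalg S \<and> R \<subseteq> S \<and> A \<subseteq> S \<and> embedding_on S \<psi> \<and> (\<forall>r\<in>R. \<psi> r = \<phi> r) \<and> countable S"
  using assms(1)
proof (induction A rule: finite_induct)
  case empty
  then show ?case using assms by blast
next
  case (insert a A)
  then obtain S \<psi> where S: "subalg S" "R \<subseteq> S" "A \<subseteq> S" "embedding_on S \<psi>" "\<forall>r\<in>R. \<psi> r = \<phi> r"
    "countable S" by blast
  obtain \<psi>' where \<psi>': "embedding_on (adjoin S a) \<psi>'" "\<forall>r\<in>S. \<psi>' r = \<psi> r"
    using embedding_adjoin[OF S(1,4,6)] by blast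
  show ?case
    using S \<psi>' subalg_adjoin[OF S(1), of a] adjoin_superset[OF S(1), of a] adjoin_mem[OF S(1), of a]
      countable_adjoin[OF S(6), of a]
    by (intro exI[of _ "adjoin S a"] exI[of _ \<psi>']) auto
qed

text \<open>Vanishing identically as a function, rather than vanishing of all coefficients as in
  \<open>alg_indep\<close>, makes a normal form for polynomial expressions unnecessary.\<close>
definition indep :: "'i set \<Rightarrow> ('i \<Rightarrow> complex) \<Rightarrow> bool" where
  "indep I z \<longleftrightarrow> (\<forall>e. pvars e \<subseteq> I \<longrightarrow> peval z e = 0 \<longrightarrow> (\<forall>w::'i \<Rightarrow> complex. peval w e = 0))"

text \<open>The transfer principle: a relation observed at one generic point becomes available at
  every point, including members of a fibre that are not generic.\<close>

lemma indepD: "indep I z \<Longrightarrow> polyfun I f \<Longrightarrow> f z = 0 \<Longrightarrow> f w = 0"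
  unfolding indep_def polyfun_def by metis

lemma indep_eq:
  fixes z w :: "'i \<Rightarrow> complex"
  assumes "indep I z" "pvars e \<subseteq> I" "pvars e' \<subseteq> I" "peval z e = peval z e'"
  shows "peval w e = peval w e'"
proof -
  have "polyfun I (\<lambda>z. peval z e - peval z e')" using assms by (intro polyfun_intros)
  from indepD[OF assms(1) this, of w] assms(4) show ?thesis by simp
qed

text \<open>Independence makes \<open>pring J s\<close> a polynomial ring in the \<open>s j\<close>,
  so a derivation may take any values on them. The formal derivative along \<open>t\<close> is well
  defined because trees that agree at \<open>s\<close> agree as functions.\<close>

lemma indep_derivation:
  assumes "indep J s"
  shows "\<exists>D. derivation_on (pring J s) D \<and> (\<forall>j\<in>J. D (s j) = t j)"
proof -
  define D where "D x = pder s t (SOME e. pvars e \<subseteq> J \<and> peval s e = x)" for x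
  have D: "D (peval s e) = pder s t e" if e: "pvars e \<subseteq> J" for e
  proof -
    define e' where "e' = (SOME e'. pvars e' \<subseteq> J \<and> peval s e' = peval s e)"
    have e': "pvars e' \<subseteq> J" "peval s e' = peval s e"
      using someI[of "\<lambda>e'. pvars e' \<subseteq> J \<and> peval s e' = peval s e" e] e unfolding e'_def by auto
    have "peval w e' = peval w e" for w :: "_ \<Rightarrow> complex" by (rule indep_eq[OF assms e'(1) e e'(2)])
    from pder_eq_of_peval[OF this peval_line_derivative] show ?thesis
      unfolding D_def e'_def[symmetric] .
  qed
  have "derivation_on (pring J s) D" unfolding derivation_on_def
  proof (intro conjI ballI)
    show "D c = 0" if "c \<in> \<rat>" for c
      using that D[of "PConst _"] by (auto elim!: Rats_cases)
    fix a b assume "a \<in> pring J s" "b \<in> pring J s"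
    then obtain e f where "a = peval s e" "pvars e \<subseteq> J" "b = peval s f" "pvars f \<subseteq> J"
      unfolding pring_def by auto
    then show "D (a + b) = D a + D b" "D (a * b) = D a * b + a * D b"
      using D[of "PAdd e f"] D[of "PMul e f"] D by auto
  qed
  moreover have "D (s j) = t j" if "j \<in> J" for j using D[of "PVar j"] that by simp
  ultimately show ?thesis by blast
qed

text \<open>The Jacobian criterion: a derivation prescribed on the independent values \<open>g j (z)\<close>
  extends to the coordinates of \<open>z\<close>, and its values there are the required direction.\<close>
lemma indep_jacobian_surj:
  assumes "finite I" "\<And>j. j \<in> J \<Longrightarrow> pvars (g j) \<subseteq> I" "indep J (\<lambda>j. peval z (g j))"
  shows "\<exists>v. \<forall>j\<in>J. pder z v (g j) = t j"
proof -
  let ?s = "\<lambda>j. peval z (g j)"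
  obtain D where D: "derivation_on (pring J ?s) D" "\<forall>j\<in>J. D (?s j) = t j"
    using indep_derivation[OF assms(3)] by blast
  obtain S D' where S: "subalg S" "pring J ?s \<subseteq> S" "z ` I \<subseteq> S" "derivation_on S D'"
    "\<forall>r\<in>pring J ?s. D' r = D r"
    using derivation_extend[OF finite_imageI[OF assms(1)] subalg_pring D(1)] by metis
  have "pder z (\<lambda>i. D' (z i)) (g j) = t j" if j: "j \<in> J" for j
  proof -
    have "z ` pvars (g j) \<subseteq> S" using S(3) assms(2)[OF j] by blast
    then have "pder z (\<lambda>i. D' (z i)) (g j) = D' (?s j)"
      by (rule derivation_on_peval[OF S(1,4), symmetric])
    also have "\<dots> = t j" using S(5) D(2) j pring_var[OF j, of ?s] by auto
    finally show ?thesis .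
  qed
  then show ?thesis by blast
qed

text \<open>Independence of \<open>z\<close> makes the substitution of \<open>z'\<close> for
  \<open>z\<close> well defined, independence of \<open>z'\<close> makes it injective; the finitely
  many numbers in \<open>A\<close> are then adjoined.\<close>

lemma indep_embedding:
  assumes "finite I" "indep I z" "indep I z'" "finite A"
  shows "\<exists>S \<psi>. subalg S \<and> z ` I \<subseteq> S \<and> A \<subseteq> S \<and> embedding_on S \<psi> \<and> (\<forall>i\<in>I. \<psi> (z i) = z' i)"
proof -
  define \<phi> where "\<phi> x = peval z' (SOME e. pvars e \<subseteq> I \<and> peval z e = x)" for x
  have \<phi>: "\<phi> (peval z e) = peval z' e" if e: "pvars e \<subseteq> I" for e
  proof -
    define e' where "e' = (SOME e'. pvars e' \<subseteq> I \<and> peval z e' = peval z e)"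
    have e': "pvars e' \<subseteq> I" "peval z e' = peval z e"
      using someI[of "\<lambda>e'. pvars e' \<subseteq> I \<and> peval z e' = peval z e" e] e unfolding e'_def by auto
    show ?thesis
      unfolding \<phi>_def e'_def[symmetric] by (rule indep_eq[OF assms(2) e'(1) e e'(2)])
  qed
  have "embedding_on (pring I z) \<phi>" unfolding embedding_on_def
  proof (intro conjI ballI impI)
    show "\<phi> c = c" if "c \<in> \<rat>" for c
      using that \<phi>[of "PConst _"] by (auto elim!: Rats_cases)
    show "a = 0" if "a \<in> pring I z" "\<phi> a = 0" for a
      using that \<phi> assms(3) unfolding pring_def indep_def by auto
    fix a b assume "a \<in> pring I z" "b \<in> pring I z"
    then obtain e f where "a = peval z e" "pvars e \<subseteq> I" "b = peval z f" "pvars f \<subseteq> I"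
      unfolding pring_def by auto
    then show "\<phi> (a + b) = \<phi> a + \<phi> b" "\<phi> (a * b) = \<phi> a * \<phi> b"
      using \<phi>[of "PAdd e f"] \<phi>[of "PMul e f"] \<phi> by auto
  qed
  then obtain S \<psi> where S: "subalg S" "pring I z \<subseteq> S" "A \<subseteq> S" "embedding_on S \<psi>"
    "\<forall>r\<in>pring I z. \<psi> r = \<phi> r"
    using embedding_extend[OF assms(4) subalg_pring _ countable_pring[OF assms(1)]] by metis
  have "\<psi> (z i) = z' i \<and> z i \<in> S" if "i \<in> I" for i
    using S(2,5) pring_var[OF that, of z] \<phi>[of "PVar i"] that by auto
  then show ?thesis using S by blast
qed

section \<open>Local surjectivity of polynomial maps\<close>

lemma peval_tendsto:
  fixes b :: "'i \<Rightarrow> 'k::real_normed_field"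
  shows "(\<And>i. i \<in> pvars e \<Longrightarrow> ((\<lambda>n. a n i) \<longlongrightarrow> b i) F) \<Longrightarrow> ((\<lambda>n. peval (a n) e) \<longlongrightarrow> peval b e) F"
  by (induction e) (auto intro!: tendsto_intros)

text \<open>Explicit bounds are used because points are functions on an arbitrary index type of
  which only the coordinates in \<open>I\<close> are controlled.\<close>

lemma peval_continuous:
  fixes z :: "'i \<Rightarrow> 'k::real_normed_field"
  assumes "\<epsilon> > 0" "pvars e \<subseteq> I"
  shows "\<exists>\<delta>>0. \<forall>a. (\<forall>i\<in>I. norm (a i - z i) < \<delta>) \<longrightarrow> norm (peval a e - peval z e) < \<epsilon>"
  using assms
proof (induction e arbitrary: \<epsilon>)
  case (PConst c)
  then show ?case by (auto intro!: exI[of _ 1])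
next
  case (PVar i)
  then show ?case by auto
next
  case (PAdd x y)
  obtain d1 where d1: "d1 > 0" "\<forall>a. (\<forall>i\<in>I. norm (a i - z i) < d1) \<longrightarrow> norm (peval a x - peval z x) < \<epsilon>/2"
    using PAdd.IH(1)[of "\<epsilon>/2"] PAdd.prems by auto
  obtain d2 where d2: "d2 > 0" "\<forall>a. (\<forall>i\<in>I. norm (a i - z i) < d2) \<longrightarrow> norm (peval a y - peval z y) < \<epsilon>/2"
    using PAdd.IH(2)[of "\<epsilon>/2"] PAdd.prems by auto
  show ?case
  proof (intro exI[of _ "min d1 d2"] conjI allI impI)
    fix a assume "\<forall>i\<in>I. norm (a i - z i) < min d1 d2"
    then have "norm (peval a x - peval z x) < \<epsilon>/2" "norm (peval a y - peval z y) < \<epsilon>/2"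
      using d1 d2 by auto
    then show "norm (peval a (PAdd x y) - peval z (PAdd x y)) < \<epsilon>"
      using norm_triangle_ineq[of "peval a x - peval z x" "peval a y - peval z y"]
      by (simp add: algebra_simps)
  qed (use d1(1) d2(1) in auto)
next
  case (PMul x y)
  define L where "L = norm (peval z x) + norm (peval z y) + 1"
  have L: "L > 0" unfolding L_def by (simp add: add_nonneg_pos)
  \<comment> \<open>The bound \<open>1\<close> keeps the perturbed second factor below
    \<open>L\<close> in norm; the other bound makes the two error terms, each below
    \<open>\<eta> * L\<close>, add up to at most \<open>\<epsilon>\<close>.\<close>
  define \<eta> where "\<eta> = min 1 (\<epsilon> / (2 * L))"
  have \<eta>: "\<eta> > 0" using L PMul.prems unfolding \<eta>_def by auto
  have \<eta>1: "\<eta> \<le> 1" unfolding \<eta>_def by simp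
  obtain d1 where d1: "d1 > 0" "\<forall>a. (\<forall>i\<in>I. norm (a i - z i) < d1) \<longrightarrow> norm (peval a x - peval z x) < \<eta>"
    using PMul.IH(1)[of \<eta>] PMul.prems \<eta> by auto
  obtain d2 where d2: "d2 > 0" "\<forall>a. (\<forall>i\<in>I. norm (a i - z i) < d2) \<longrightarrow> norm (peval a y - peval z y) < \<eta>"
    using PMul.IH(2)[of \<eta>] PMul.prems \<eta> by auto
  show ?case
  proof (intro exI[of _ "min d1 d2"] conjI allI impI)
    fix a assume "\<forall>i\<in>I. norm (a i - z i) < min d1 d2"
    then have b: "norm (peval a x - peval z x) < \<eta>" "norm (peval a y - peval z y) < \<eta>"
      using d1 d2 by auto
    have "norm (peval a y) \<le> norm (peval z y) + \<eta>"
      using norm_triangle_ineq[of "peval a y - peval z y" "peval z y"] b by simp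
    also have "\<dots> \<le> L" using \<eta>1 norm_ge_zero[of "peval z x"] norm_ge_zero[of "peval z y"] unfolding L_def by linarith
    finally have y: "norm (peval a y) \<le> L" .
    have x: "norm (peval z x) \<le> L" unfolding L_def by simp
    have "peval a (PMul x y) - peval z (PMul x y) =
        (peval a x - peval z x) * peval a y + peval z x * (peval a y - peval z y)"
      by (simp add: algebra_simps)
    also have "norm \<dots> \<le> norm (peval a x - peval z x) * norm (peval a y)
        + norm (peval z x) * norm (peval a y - peval z y)"
      by (metis norm_mult norm_triangle_ineq)
    also have "\<dots> \<le> norm (peval a x - peval z x) * L + L * norm (peval a y - peval z y)"
      using x y L by (intro add_mono mult_mono) auto
    also have "\<dots> < \<eta> * L + L * \<eta>"
      using b L by (intro add_strict_mono) auto
    also have "\<dots> \<le> \<epsilon>" using L unfolding \<eta>_def by (auto simp: min_def field_simps)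
    finally show "norm (peval a (PMul x y) - peval z (PMul x y)) < \<epsilon>" .
  qed (use d1(1) d2(1) in auto)
qed

lemma pder_bound:
  fixes z :: "'i \<Rightarrow> 'k::real_normed_field"
  assumes "finite I" "pvars e \<subseteq> I"
  shows "\<exists>C>0. \<forall>v. norm (pder z v e) \<le> C * (\<Sum>i\<in>I. norm (v i))"
  using assms(2)
proof (induction e)
  case (PConst c)
  then show ?case by (auto intro!: exI[of _ 1] sum_nonneg)
next
  case (PVar i)
  then show ?case using assms(1) by (auto intro!: exI[of _ 1] member_le_sum[of i I "\<lambda>i. norm (_ i)"])
next
  case (PAdd x y)
  then obtain C D where CD: "C > 0" "D > 0"
    "\<And>v. norm (pder z v x) \<le> C * (\<Sum>i\<in>I. norm (v i))" "\<And>v. norm (pder z v y) \<le> D * (\<Sum>i\<in>I. norm (v i))"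
    by auto
  have "norm (pder z v (PAdd x y)) \<le> (C + D) * (\<Sum>i\<in>I. norm (v i))" for v
    using norm_triangle_ineq[of "pder z v x" "pder z v y"] CD(3,4)[of v]
    by (simp add: algebra_simps)
  then show ?case using CD by (intro exI[of _ "C + D"]) auto
next
  case (PMul x y)
  then obtain C D where CD: "C > 0" "D > 0"
    "\<And>v. norm (pder z v x) \<le> C * (\<Sum>i\<in>I. norm (v i))" "\<And>v. norm (pder z v y) \<le> D * (\<Sum>i\<in>I. norm (v i))"
    by auto
  \<comment> \<open>The summand \<open>1\<close> keeps the constant positive even when both factors
    vanish at \<open>z\<close>.\<close>
  let ?C = "1 + C * norm (peval z y) + D * norm (peval z x)"
  have "norm (pder z v (PMul x y)) \<le> ?C * (\<Sum>i\<in>I. norm (v i))" for v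
  proof -
    have "norm (pder z v (PMul x y)) \<le> norm (pder z v x) * norm (peval z y) + norm (peval z x) * norm (pder z v y)"
      using norm_triangle_ineq[of "pder z v x * peval z y" "peval z x * pder z v y"] by (simp add: norm_mult)
    also have "\<dots> \<le> (C * (\<Sum>i\<in>I. norm (v i))) * norm (peval z y) + norm (peval z x) * (D * (\<Sum>i\<in>I. norm (v i)))"
      using CD(1,2) by (intro add_mono mult_mono CD(3,4) mult_nonneg_nonneg sum_nonneg) auto
    also have "\<dots> \<le> ?C * (\<Sum>i\<in>I. norm (v i))"
      by (simp add: algebra_simps sum_nonneg)
    finally show ?thesis .
  qed
  moreover have "?C > 0" using CD by (simp add: add_pos_nonneg)
  ultimately show ?case by blast
qed

text \<open>Strict differentiability, with both points moving: the error is compared with the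
  distance of \<open>a\<close> and \<open>b\<close>, which is what makes an iteration with frozen
  derivative a contraction.\<close>

lemma peval_strict_derivative:
  fixes z :: "'i \<Rightarrow> 'k::real_normed_field"
  assumes "finite I" "pvars e \<subseteq> I" "\<epsilon> > 0"
  shows "\<exists>\<delta>>0. \<forall>a b. (\<forall>i\<in>I. norm (a i - z i) < \<delta> \<and> norm (b i - z i) < \<delta>) \<longrightarrow>
    norm (peval a e - peval b e - pder z (\<lambda>i. a i - b i) e) \<le> \<epsilon> * (\<Sum>i\<in>I. norm (a i - b i))"
  using assms(2,3)
proof (induction e arbitrary: \<epsilon>)
  case (PConst c)
  then show ?case by (auto intro!: exI[of _ 1] mult_nonneg_nonneg sum_nonneg)
next
  case (PVar i)
  then show ?case by (auto intro!: exI[of _ 1] mult_nonneg_nonneg sum_nonneg)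
next
  case (PAdd x y)
  let ?N = "\<lambda>a b. \<Sum>i\<in>I. norm (a i - b i :: 'k)"
  obtain d1 where d1: "d1 > 0" "\<And>a b. (\<forall>i\<in>I. norm (a i - z i) < d1 \<and> norm (b i - z i) < d1) \<Longrightarrow>
    norm (peval a x - peval b x - pder z (\<lambda>i. a i - b i) x) \<le> \<epsilon>/2 * ?N a b"
    using PAdd.IH(1)[of "\<epsilon>/2"] PAdd.prems by (simp; blast)
  obtain d2 where d2: "d2 > 0" "\<And>a b. (\<forall>i\<in>I. norm (a i - z i) < d2 \<and> norm (b i - z i) < d2) \<Longrightarrow>
    norm (peval a y - peval b y - pder z (\<lambda>i. a i - b i) y) \<le> \<epsilon>/2 * ?N a b"
    using PAdd.IH(2)[of "\<epsilon>/2"] PAdd.prems by (simp; blast)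
  show ?case
  proof (intro exI[of _ "min d1 d2"] conjI allI impI)
    fix a b assume "\<forall>i\<in>I. norm (a i - z i) < min d1 d2 \<and> norm (b i - z i) < min d1 d2"
    then have "norm (peval a x - peval b x - pder z (\<lambda>i. a i - b i) x) \<le> \<epsilon>/2 * ?N a b"
      "norm (peval a y - peval b y - pder z (\<lambda>i. a i - b i) y) \<le> \<epsilon>/2 * ?N a b"
      using d1(2)[of a b] d2(2)[of a b] by auto
    then show "norm (peval a (PAdd x y) - peval b (PAdd x y) - pder z (\<lambda>i. a i - b i) (PAdd x y)) \<le> \<epsilon> * ?N a b"
      using norm_triangle_ineq[of "peval a x - peval b x - pder z (\<lambda>i. a i - b i) x"
          "peval a y - peval b y - pder z (\<lambda>i. a i - b i) y"]
      by (simp add: algebra_simps)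
  qed (use d1(1) d2(1) in auto)
next
  case (PMul x y)
  let ?N = "\<lambda>a b. \<Sum>i\<in>I. norm (a i - b i :: 'k)"
  have vars: "pvars x \<subseteq> I" "pvars y \<subseteq> I" using PMul.prems by auto
  obtain C where C: "C > 0" "\<And>v. norm (pder z v x) \<le> C * (\<Sum>i\<in>I. norm (v i))"
    using pder_bound[OF assms(1) vars(1)] by blast
  obtain D where D: "D > 0" "\<And>v. norm (pder z v y) \<le> D * (\<Sum>i\<in>I. norm (v i))"
    using pder_bound[OF assms(1) vars(2)] by blast
  define L where "L = norm (peval z x) + norm (peval z y) + 1"
  have L: "L > 0" unfolding L_def by (simp add: add_nonneg_pos)
  \<comment> \<open>The error of a product has four terms. Two contain the strict errors of the
    factors and cost \<open>2 * (\<epsilon>' * L)\<close> together, half of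
    \<open>\<epsilon>\<close>; two contain the drift of a factor from its value at \<open>z\<close>
    and cost \<open>\<eta> * (C + D)\<close>, at most a quarter of it.\<close>
  define \<eta> where "\<eta> = min 1 (\<epsilon> / 4 / (C + D))"
  have \<eta>: "\<eta> > 0" using C(1) D(1) PMul.prems(2) unfolding \<eta>_def by auto
  have \<eta>1: "\<eta> \<le> 1" unfolding \<eta>_def by simp
  define \<epsilon>' where "\<epsilon>' = \<epsilon> / (4 * L)"
  have \<epsilon>': "\<epsilon>' > 0" unfolding \<epsilon>'_def using L PMul.prems by auto
  obtain d1 where d1: "d1 > 0" "\<And>a b. (\<forall>i\<in>I. norm (a i - z i) < d1 \<and> norm (b i - z i) < d1) \<Longrightarrow>
    norm (peval a x - peval b x - pder z (\<lambda>i. a i - b i) x) \<le> \<epsilon>' * ?N a b"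
    using PMul.IH(1)[OF vars(1) \<epsilon>'] by blast
  obtain d2 where d2: "d2 > 0" "\<And>a b. (\<forall>i\<in>I. norm (a i - z i) < d2 \<and> norm (b i - z i) < d2) \<Longrightarrow>
    norm (peval a y - peval b y - pder z (\<lambda>i. a i - b i) y) \<le> \<epsilon>' * ?N a b"
    using PMul.IH(2)[OF vars(2) \<epsilon>'] by blast
  obtain d3 where d3: "d3 > 0" "\<And>a. (\<forall>i\<in>I. norm (a i - z i) < d3) \<Longrightarrow> norm (peval a x - peval z x) < \<eta>"
    using peval_continuous[OF \<eta> vars(1)] by blast
  obtain d4 where d4: "d4 > 0" "\<And>a. (\<forall>i\<in>I. norm (a i - z i) < d4) \<Longrightarrow> norm (peval a y - peval z y) < \<eta>"
    using peval_continuous[OF \<eta> vars(2)] by blast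
  let ?d = "min (min d1 d2) (min d3 d4)"
  show ?case
  proof (intro exI[of _ ?d] conjI allI impI)
    fix a b assume ab: "\<forall>i\<in>I. norm (a i - z i) < ?d \<and> norm (b i - z i) < ?d"
    define v where "v i = a i - b i" for i
    define N where "N = ?N a b"
    have N: "N \<ge> 0" unfolding N_def by (intro sum_nonneg) auto
    have Nv: "(\<Sum>i\<in>I. norm (v i)) = N" unfolding N_def v_def by simp
    have x: "norm (peval a x - peval b x - pder z v x) \<le> \<epsilon>' * N"
      and y: "norm (peval a y - peval b y - pder z v y) \<le> \<epsilon>' * N"
      using d1(2)[of a b] d2(2)[of a b] ab unfolding v_def N_def by auto
    have bx: "norm (peval b x - peval z x) < \<eta>" and ay: "norm (peval a y - peval z y) < \<eta>"
      using d3(2)[of b] d4(2)[of a] ab by auto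
    have "norm (peval a y) \<le> norm (peval z y) + \<eta>"
      using norm_triangle_ineq[of "peval a y - peval z y" "peval z y"] ay by simp
    also have "\<dots> \<le> L" using \<eta>1 norm_ge_zero[of "peval z x"] norm_ge_zero[of "peval z y"] unfolding L_def by linarith
    finally have La: "norm (peval a y) \<le> L" .
    have "norm (peval b x) \<le> norm (peval z x) + \<eta>"
      using norm_triangle_ineq[of "peval b x - peval z x" "peval z x"] bx by simp
    also have "\<dots> \<le> L" using \<eta>1 norm_ge_zero[of "peval z x"] norm_ge_zero[of "peval z y"] unfolding L_def by linarith
    finally have Lb: "norm (peval b x) \<le> L" .
    have eq: "peval a (PMul x y) - peval b (PMul x y) - pder z v (PMul x y) =
      (peval a x - peval b x - pder z v x) * peval a y + pder z v x * (peval a y - peval z y) +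
      (peval b x * (peval a y - peval b y - pder z v y) + (peval b x - peval z x) * pder z v y)"
      by (simp add: algebra_simps)
    have "norm (peval a (PMul x y) - peval b (PMul x y) - pder z v (PMul x y)) \<le>
      norm (peval a x - peval b x - pder z v x) * norm (peval a y) + norm (pder z v x) * norm (peval a y - peval z y) +
      (norm (peval b x) * norm (peval a y - peval b y - pder z v y) + norm (peval b x - peval z x) * norm (pder z v y))"
      unfolding eq by (intro norm_triangle_mono) (simp_all add: norm_mult)
    also have "\<dots> \<le> \<epsilon>' * N * L + C * N * \<eta> + (L * (\<epsilon>' * N) + \<eta> * (D * N))"
    proof (intro add_mono)
      show "norm (peval a x - peval b x - pder z v x) * norm (peval a y) \<le> \<epsilon>' * N * L"
        using x La \<epsilon>' N by (intro mult_mono) auto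
      show "norm (pder z v x) * norm (peval a y - peval z y) \<le> C * N * \<eta>"
        using C(1) C(2)[of v] Nv ay N by (intro mult_mono) auto
      show "norm (peval b x) * norm (peval a y - peval b y - pder z v y) \<le> L * (\<epsilon>' * N)"
        using y Lb L by (intro mult_mono) auto
      show "norm (peval b x - peval z x) * norm (pder z v y) \<le> \<eta> * (D * N)"
        using D(2)[of v] Nv bx \<eta> by (intro mult_mono) auto
    qed
    also have "\<dots> = (2 * (\<epsilon>' * L) + \<eta> * (C + D)) * N" by (simp add: algebra_simps)
    also have "\<dots> \<le> \<epsilon> * N"
    proof (rule mult_right_mono[OF _ N])
      have "\<eta> * (C + D) \<le> \<epsilon> / 4 / (C + D) * (C + D)"
        unfolding \<eta>_def using C(1) D(1) by (intro mult_right_mono) auto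
      also have "\<dots> = \<epsilon> / 4" using C(1) D(1) by (intro nonzero_eq_divide_eq[THEN iffD1] refl) simp
      finally have "\<eta> * (C + D) \<le> \<epsilon> / 4" .
      moreover have "\<epsilon>' * L = \<epsilon> / 4" unfolding \<epsilon>'_def using L by simp
      ultimately show "2 * (\<epsilon>' * L) + \<eta> * (C + D) \<le> \<epsilon>" using PMul.prems by simp
    qed
    finally show "norm (peval a (PMul x y) - peval b (PMul x y) - pder z (\<lambda>i. a i - b i) (PMul x y)) \<le> \<epsilon> * ?N a b"
      unfolding v_def N_def .
  qed (use d1(1) d2(1) d3(1) d4(1) in auto)
qed

lemma finite_uniform_delta:
  fixes Q :: "'j \<Rightarrow> real \<Rightarrow> bool"
  assumes "finite J" "\<And>j. j \<in> J \<Longrightarrow> \<exists>\<delta>>0. Q j \<delta>"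
    "\<And>j \<delta> \<delta>'. Q j \<delta> \<Longrightarrow> \<delta>' \<le> \<delta> \<Longrightarrow> Q j \<delta>'"
  shows "\<exists>\<delta>>0. \<forall>j\<in>J. Q j \<delta>"
  using assms(1,2)
proof (induction J rule: finite_induct)
  case empty
  then show ?case by (auto intro!: exI[of _ 1])
next
  case (insert j J)
  then obtain d e where "d > 0" "\<forall>j\<in>J. Q j d" "e > 0" "Q j e" by blast
  then show ?case using assms(3)[of _ _ "min d e"]
    by (intro exI[of _ "min d e"]) auto
qed

text \<open>Newton iteration with the derivative frozen at \<open>z\<close>, as in the proof of the inverse
  function theorem.\<close>
lemma peval_locally_surj:
  fixes g :: "'j \<Rightarrow> 'i pexp" and z :: "'i \<Rightarrow> 'k::{real_normed_field,banach}"
  assumes I: "finite I" and J: "finite J" and g: "\<And>j. j \<in> J \<Longrightarrow> pvars (g j) \<subseteq> I"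
    and surj: "\<And>t. \<exists>v. \<forall>j\<in>J. pder z v (g j) = t j" and \<epsilon>: "\<epsilon> > 0"
  shows "\<exists>\<delta>>0. \<forall>t. (\<forall>j\<in>J. norm (t j - peval z (g j)) < \<delta>) \<longrightarrow>
    (\<exists>a. (\<forall>i\<in>I. norm (a i - z i) < \<epsilon>) \<and> (\<forall>j\<in>J. peval a (g j) = t j))"
proof -
  have "\<forall>k. \<exists>v. \<forall>j\<in>J. pder z v (g j) = (if j = k then 1 else 0)" using surj by (intro allI)
  then obtain B where B: "\<And>k j. j \<in> J \<Longrightarrow> pder z (B k) (g j) = (if j = k then 1 else 0)"
    by metis
  \<comment> \<open>The search is confined to an affine slice through \<open>z\<close> along
    preimages of the unit vectors. In the parameters \<open>y\<close> the derivative at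
    \<open>z\<close> is the identity, so no linear map has to be inverted during the
    iteration.\<close>
  define A where "A y i = z i + (\<Sum>j\<in>J. y j * B j i)" for y i
  define N :: "('j \<Rightarrow> 'k) \<Rightarrow> real" where "N y = (\<Sum>j\<in>J. norm (y j))" for y
  have N0: "N y \<ge> 0" for y unfolding N_def by (intro sum_nonneg) auto
  define h where "h y j = peval (A y) (g j)" for y j
  define K where "K = 1 + (\<Sum>i\<in>I. \<Sum>j\<in>J. norm (B j i))"
  have K: "K > 0" unfolding K_def by (intro add_pos_nonneg sum_nonneg) auto
  have KB: "norm (B j i) \<le> K" if "i \<in> I" "j \<in> J" for i j
  proof -
    have "norm (B j i) \<le> (\<Sum>j\<in>J. norm (B j i))"
      using that J by (intro member_le_sum) auto
    also have "\<dots> \<le> (\<Sum>i\<in>I. \<Sum>j\<in>J. norm (B j i))"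
      using that I by (intro member_le_sum[of i I "\<lambda>i. \<Sum>j\<in>J. norm (B j i)"] sum_nonneg) auto
    finally show ?thesis unfolding K_def by simp
  qed
  have Adiff: "A y i - A y' i = (\<Sum>j\<in>J. (y j - y' j) * B j i)" for y y' i
    unfolding A_def by (simp add: sum_subtractf[symmetric] algebra_simps)
  have A_lip: "norm (A y i - A y' i) \<le> K * N (\<lambda>j. y j - y' j)" if "i \<in> I" for y y' i
  proof -
    have "norm (A y i - A y' i) \<le> (\<Sum>j\<in>J. norm (y j - y' j) * norm (B j i))"
      unfolding Adiff by (rule order_trans[OF norm_sum]) (simp add: norm_mult)
    also have "\<dots> \<le> (\<Sum>j\<in>J. norm (y j - y' j) * K)"
      using KB that by (intro sum_mono mult_left_mono) auto
    finally show ?thesis unfolding N_def by (simp add: sum_distrib_left mult.commute)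
  qed
  have A_der: "pder z (\<lambda>i. A y i - A y' i) (g k) = y k - y' k" if "k \<in> J" for y y' k
  proof -
    have "pder z (\<lambda>i. A y i - A y' i) (g k) = (\<Sum>j\<in>J. (y j - y' j) * (if k = j then 1 else 0))"
      unfolding Adiff pder_sum pder_scale using B[OF that] by simp
    also have "\<dots> = y k - y' k" using that J by (simp add: sum.delta' if_distrib cong: if_cong)
    finally show ?thesis .
  qed
  define K' where "K' = real (card I) * K"
  have K': "K' \<ge> 0" unfolding K'_def using K by simp
  \<comment> \<open>Chosen so that the strict error, after passing through the slice and summing
    over \<open>J\<close>, has Lipschitz constant at most \<open>1/2\<close>.\<close>
  define \<epsilon>0 where "\<epsilon>0 = 1 / (2 * (real (card J) + 1) * (K' + 1))"
  have \<epsilon>0: "\<epsilon>0 > 0" unfolding \<epsilon>0_def using K' by simp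
  have "\<exists>\<delta>>0. \<forall>k\<in>J. \<forall>a b. (\<forall>i\<in>I. norm (a i - z i) < \<delta> \<and> norm (b i - z i) < \<delta>) \<longrightarrow>
    norm (peval a (g k) - peval b (g k) - pder z (\<lambda>i. a i - b i) (g k)) \<le> \<epsilon>0 * (\<Sum>i\<in>I. norm (a i - b i))"
    (is "\<exists>\<delta>>0. \<forall>k\<in>J. ?Q k \<delta>")
  proof (rule finite_uniform_delta[OF J])
    show "\<exists>\<delta>>0. ?Q k \<delta>" if "k \<in> J" for k
      using peval_strict_derivative[OF I g[OF that] \<epsilon>0] .
    show "?Q k \<delta>'" if "?Q k \<delta>" "\<delta>' \<le> \<delta>" for k \<delta> \<delta>'
      using that less_le_trans by blast
  qed
  then obtain d where d: "d > 0" "\<And>k a b. k \<in> J \<Longrightarrow> \<forall>i\<in>I. norm (a i - z i) < d \<and> norm (b i - z i) < d \<Longrightarrow>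
    norm (peval a (g k) - peval b (g k) - pder z (\<lambda>i. a i - b i) (g k)) \<le> \<epsilon>0 * (\<Sum>i\<in>I. norm (a i - b i))"
    by blast
  define \<rho> where "\<rho> = min d \<epsilon> / K"
  have \<rho>: "\<rho> > 0" unfolding \<rho>_def using d \<epsilon> K by simp
  have A0: "A (\<lambda>j. 0) = z" unfolding A_def by simp
  have A_near: "norm (A y i - z i) < min d \<epsilon>" if "i \<in> I" "N y < \<rho>" for y i
  proof -
    have "norm (A y i - z i) \<le> K * N y" using A_lip[OF that(1), of y "\<lambda>j. 0"] A0 by simp
    also have "\<dots> < K * \<rho>" using that K by simp
    finally show ?thesis unfolding \<rho>_def using K by simp
  qed
  have contr: "N (\<lambda>j. h y j - h y' j - (y j - y' j)) \<le> 1/2 * N (\<lambda>j. y j - y' j)"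
    if "N y < \<rho>" "N y' < \<rho>" for y y'
  proof -
    let ?n = "N (\<lambda>j. y j - y' j)"
    have "norm (h y k - h y' k - (y k - y' k)) \<le> \<epsilon>0 * (K' * ?n)" if k: "k \<in> J" for k
    proof -
      have "norm (h y k - h y' k - (y k - y' k)) \<le> \<epsilon>0 * (\<Sum>i\<in>I. norm (A y i - A y' i))"
      proof -
        have "\<forall>i\<in>I. norm (A y i - z i) < d \<and> norm (A y' i - z i) < d"
          using A_near[OF _ \<open>N y < \<rho>\<close>] A_near[OF _ \<open>N y' < \<rho>\<close>] by (meson min_less_iff_conj)
        from d(2)[OF k this] show ?thesis unfolding h_def A_der[OF k] .
      qed
      also have "\<dots> \<le> \<epsilon>0 * (\<Sum>i\<in>I. K * ?n)"
        using \<epsilon>0 A_lip by (intro mult_left_mono sum_mono) auto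
      finally show ?thesis unfolding K'_def by simp
    qed
    then have "N (\<lambda>j. h y j - h y' j - (y j - y' j)) \<le> (\<Sum>k\<in>J. \<epsilon>0 * (K' * ?n))"
      unfolding N_def[of "\<lambda>j. h y j - h y' j - (y j - y' j)"] by (intro sum_mono)
    also have "\<dots> = (real (card J) * \<epsilon>0 * K') * ?n" by simp
    also have "\<dots> \<le> 1/2 * ?n"
    proof (rule mult_right_mono[OF _ N0])
      define X where "X = (real (card J) + 1) * (K' + 1)"
      have "real (card J) * K' \<le> X" unfolding X_def
        using K' by (intro mult_mono) auto
      moreover have "X > 0" unfolding X_def using K' by simp
      moreover have "real (card J) * \<epsilon>0 * K' = (real (card J) * K') / X / 2"
        unfolding \<epsilon>0_def X_def using K' by (simp add: algebra_simps)
      ultimately show "real (card J) * \<epsilon>0 * K' \<le> 1 / 2"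
        by simp
    qed
    finally show ?thesis .
  qed
  \<comment> \<open>Makes the first step at most \<open>\<rho>/4\<close>; steps halve from then on,
    so all iterates stay within \<open>\<rho>/2\<close>, strictly inside the region where the
    contraction estimate holds.\<close>
  define \<delta> where "\<delta> = \<rho> / (4 * (real (card J) + 1))"
  have \<delta>: "\<delta> > 0" unfolding \<delta>_def using \<rho> by simp
  show ?thesis
  proof (intro exI[of _ \<delta>] conjI allI impI)
    fix t assume t: "\<forall>j\<in>J. norm (t j - peval z (g j)) < \<delta>"
    define T where "T y j = y j - (h y j - t j)" for y j
    define y where "y n = (T ^^ n) (\<lambda>j. 0)" for n
    have y0: "y 0 = (\<lambda>j. 0)" and ySuc: "y (Suc n) = T (y n)" for n unfolding y_def by auto
    have T: "N (\<lambda>j. T u j - T w j) \<le> 1/2 * N (\<lambda>j. u j - w j)" if "N u < \<rho>" "N w < \<rho>" for u w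
    proof -
      have "N (\<lambda>j. T u j - T w j) = N (\<lambda>j. h u j - h w j - (u j - w j))"
        unfolding N_def T_def by (intro sum.cong refl) (simp add: norm_minus_commute algebra_simps)
      then show ?thesis using contr[OF that] by simp
    qed
    have first: "N (\<lambda>j. y (Suc 0) j - y 0 j) \<le> \<rho> / 4"
    proof -
      have "N (\<lambda>j. y (Suc 0) j - y 0 j) = (\<Sum>j\<in>J. norm (t j - peval z (g j)))"
        unfolding N_def ySuc y0 T_def h_def A0 by simp
      also have "\<dots> \<le> (\<Sum>j\<in>J. \<delta>)" using t by (intro sum_mono) (auto intro: less_imp_le)
      also have "\<dots> \<le> \<rho> / 4" unfolding \<delta>_def using \<rho> by (simp add: field_simps)
      finally show ?thesis .
    qed
    have N_triangle: "N u \<le> N w + N (\<lambda>j. u j - w j)" for u w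
      unfolding N_def sum.distrib[symmetric]
      by (intro sum_mono) (rule norm_triangle_sub)
    have inv: "N (\<lambda>j. y (Suc n) j - y n j) \<le> (1/2)^n * (\<rho>/4) \<and> N (y n) \<le> \<rho>/2 * (1 - (1/2)^n)" for n
    proof (induction n)
      case 0
      then show ?case using first by (simp add: y0 N_def)
    next
      case (Suc n)
      have b: "N (y (Suc n)) \<le> \<rho>/2 * (1 - (1/2)^Suc n)"
        using N_triangle[of "y (Suc n)" "y n"] Suc by (simp add: algebra_simps)
      have "N (y n) < \<rho>" "N (y (Suc n)) < \<rho>"
      proof -
        have "\<rho>/2 * (1 - (1/2)^m) < \<rho>" for m
        proof -
          have "\<rho>/2 * (1 - (1/2)^m) \<le> \<rho>/2 * 1" using \<rho> by (intro mult_left_mono) auto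
          also have "\<dots> < \<rho>" using \<rho> by simp
          finally show ?thesis .
        qed
        then show "N (y n) < \<rho>" "N (y (Suc n)) < \<rho>"
          using le_less_trans[OF b] le_less_trans[OF conjunct2[OF Suc]] by blast+
      qed
      then have "N (\<lambda>j. y (Suc (Suc n)) j - y (Suc n) j) \<le> 1/2 * N (\<lambda>j. y (Suc n) j - y n j)"
        using T[of "y (Suc n)" "y n"] by (simp only: ySuc)
      then show ?case using Suc b by simp
    qed
    have conv: "\<exists>l. (\<lambda>n. y n k) \<longlonglongrightarrow> l" if k: "k \<in> J" for k
    proof -
      have "norm (y (Suc n) k - y n k) \<le> (1/2)^n * (\<rho>/4)" for n
      proof -
        have "norm (y (Suc n) k - y n k) \<le> N (\<lambda>j. y (Suc n) j - y n j)"
          unfolding N_def using k J by (intro member_le_sum[of k J "\<lambda>j. norm (y (Suc n) j - y n j)"]) auto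
        then show ?thesis using inv[of n] by simp
      qed
      then have le: "norm (y (Suc n) k - y n k) \<le> (1/2)^n * (\<rho>/4)" for n .
      have geom: "summable (\<lambda>n. (1/2::real)^n * (\<rho>/4))"
        by (intro summable_mult2 summable_geometric) simp
      have "summable (\<lambda>n. y (Suc n) k - y n k)"
        using le by (rule summable_comparison_test'[OF geom, of 0])
      then have "(\<lambda>n. \<Sum>i<n. y (Suc i) k - y i k) \<longlonglongrightarrow> (\<Sum>i. y (Suc i) k - y i k)"
        by (rule summable_LIMSEQ)
      moreover have "(\<Sum>i<n. y (Suc i) k - y i k) = y n k" for n
        using sum_lessThan_telescope[of "\<lambda>n. y n k" n] by (simp add: y0)
      ultimately show ?thesis by auto
    qed
    then obtain Y where Y: "\<And>k. k \<in> J \<Longrightarrow> (\<lambda>n. y n k) \<longlonglongrightarrow> Y k" by metis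
    have "(\<lambda>n. N (y n)) \<longlonglongrightarrow> N Y" unfolding N_def by (intro tendsto_sum tendsto_norm Y)
    moreover have "N (y n) \<le> \<rho>/2" for n
    proof -
      have "\<rho>/2 * (1 - (1/2)^n) \<le> \<rho>/2 * 1" using \<rho> by (intro mult_left_mono) auto
      then show ?thesis using inv[of n] by simp
    qed
    ultimately have "N Y \<le> \<rho>/2" by (intro LIMSEQ_le_const2) auto
    then have NY: "N Y < \<rho>" using \<rho> by simp
    have "peval (A Y) (g k) = t k" if k: "k \<in> J" for k
    proof -
      have "(\<lambda>n. h (y n) k) \<longlonglongrightarrow> h Y k" unfolding h_def A_def
        by (intro peval_tendsto tendsto_add tendsto_sum tendsto_mult tendsto_const Y)
      then have "(\<lambda>n. y n k - (h (y n) k - t k)) \<longlonglongrightarrow> Y k - (h Y k - t k)"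
        by (intro tendsto_diff tendsto_const Y k)
      moreover have "(\<lambda>n. y (Suc n) k) \<longlonglongrightarrow> Y k" using Y[OF k] by (rule LIMSEQ_Suc)
      ultimately have "Y k - (h Y k - t k) = Y k" unfolding ySuc T_def by (rule LIMSEQ_unique)
      then show ?thesis unfolding h_def by simp
    qed
    then show "\<exists>a. (\<forall>i\<in>I. norm (a i - z i) < \<epsilon>) \<and> (\<forall>j\<in>J. peval a (g j) = t j)"
      using A_near[OF _ NY] by (intro exI[of _ "A Y"]) auto
  qed (rule \<delta>)
qed

section \<open>Algebraic independence and generic points\<close>

lemma pring_mono: "I \<subseteq> J \<Longrightarrow> pring I z \<subseteq> pring J z"
  unfolding pring_def by blast

lemma pring_cong: "(\<And>i. i \<in> I \<Longrightarrow> z i = w i) \<Longrightarrow> pring I z = pring I w"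
proof -
  assume "\<And>i. i \<in> I \<Longrightarrow> z i = w i"
  then have "peval z e = peval w e" if "pvars e \<subseteq> I" for e
    using that by (intro peval_cong) auto
  then show ?thesis unfolding pring_def by (metis (no_types, lifting))
qed

lemma transcendental_over_mono: "transcendental_over S a \<Longrightarrow> R \<subseteq> S \<Longrightarrow> transcendental_over R a"
  unfolding transcendental_over_def polys_def by blast

text \<open>A list, since expanding products may yield the same monomial several times; like terms
  are collected afterwards.\<close>

lemma pexp_monomials:
  assumes I: "finite I" and "pvars e \<subseteq> I"
  shows "\<exists>xs. (\<forall>(c, m)\<in>set xs. \<forall>i. i \<notin> I \<longrightarrow> m i = 0) \<and>
    (\<forall>z::'i \<Rightarrow> complex. peval z e = (\<Sum>(c, m)\<leftarrow>xs. of_rat c * (\<Prod>i\<in>I. z i ^ m i)))"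
  using assms(2)
proof (induction e)
  case (PConst c)
  then show ?case by (intro exI[of _ "[(c, \<lambda>i. 0)]"]) auto
next
  case (PVar j)
  have "(\<Prod>i\<in>I. z i ^ (if i = j then 1 else 0)) = z j" for z :: "'i \<Rightarrow> complex"
    using PVar I by (simp add: prod.delta if_distrib[of "\<lambda>n. _ ^ n"] cong: if_cong)
  then show ?case using PVar by (intro exI[of _ "[(1, \<lambda>i. if i = j then 1 else 0)]"]) auto
next
  case (PAdd a b)
  then obtain xs ys where "\<forall>(c, m)\<in>set xs. \<forall>i. i \<notin> I \<longrightarrow> m i = 0" "\<forall>(c, m)\<in>set ys. \<forall>i. i \<notin> I \<longrightarrow> m i = 0"
    "\<forall>z::'i \<Rightarrow> complex. peval z a = (\<Sum>(c, m)\<leftarrow>xs. of_rat c * (\<Prod>i\<in>I. z i ^ m i))"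
    "\<forall>z::'i \<Rightarrow> complex. peval z b = (\<Sum>(c, m)\<leftarrow>ys. of_rat c * (\<Prod>i\<in>I. z i ^ m i))"
    by auto
  then show ?case by (intro exI[of _ "xs @ ys"]) auto
next
  case (PMul a b)
  then obtain xs ys where s: "\<forall>(c, m)\<in>set xs. \<forall>i. i \<notin> I \<longrightarrow> m i = 0" "\<forall>(c, m)\<in>set ys. \<forall>i. i \<notin> I \<longrightarrow> m i = 0"
    and p: "\<forall>z::'i \<Rightarrow> complex. peval z a = (\<Sum>(c, m)\<leftarrow>xs. of_rat c * (\<Prod>i\<in>I. z i ^ m i))"
    "\<forall>z::'i \<Rightarrow> complex. peval z b = (\<Sum>(c, m)\<leftarrow>ys. of_rat c * (\<Prod>i\<in>I. z i ^ m i))"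
    by auto
  define mul where "mul xs = concat (map (\<lambda>(c, m). map (\<lambda>(d, n). (c * d, \<lambda>i. m i + n i)) ys) xs)"
    for xs :: "(rat \<times> ('i \<Rightarrow> nat)) list"
  have mul1: "(\<Sum>(d, n)\<leftarrow>map (\<lambda>(d, n). (c * d, \<lambda>i. m i + n i)) ys'. of_rat d * (\<Prod>i\<in>I. z i ^ n i)) =
      of_rat c * (\<Prod>i\<in>I. z i ^ m i) * (\<Sum>(d, n)\<leftarrow>ys'. of_rat d * (\<Prod>i\<in>I. z i ^ n i))"
    for c m ys' and z :: "'i \<Rightarrow> complex"
    by (induction ys') (auto simp: power_add prod.distrib of_rat_mult algebra_simps)
  have "(\<Sum>(d, n)\<leftarrow>mul xs. of_rat d * (\<Prod>i\<in>I. z i ^ n i)) =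
      (\<Sum>(c, m)\<leftarrow>xs. of_rat c * (\<Prod>i\<in>I. z i ^ m i)) * (\<Sum>(d, n)\<leftarrow>ys. of_rat d * (\<Prod>i\<in>I. z i ^ n i))"
    for xs and z :: "'i \<Rightarrow> complex"
    unfolding mul_def by (induction xs) (auto simp: mul1 algebra_simps simp del: map_map)
  moreover have "\<forall>(c, m)\<in>set (mul xs). \<forall>i. i \<notin> I \<longrightarrow> m i = 0"
    using s unfolding mul_def by fastforce
  ultimately show ?case using p by (intro exI[of _ "mul xs"]) auto
qed

text \<open>Once like terms are collected, a relation at \<open>z\<close> has only zero coefficients
  and hence is zero as a function.\<close>

lemma alg_indep_imp_indep:
  assumes "finite I" "alg_indep I z"
  shows "indep I z"
  unfolding indep_def
proof (intro allI impI)
  fix e and w :: "'a \<Rightarrow> complex"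
  assume e: "pvars e \<subseteq> I" "peval z e = 0"
  obtain xs where xs: "\<forall>(c, m)\<in>set xs. \<forall>i. i \<notin> I \<longrightarrow> m i = 0"
    "\<And>z::'a \<Rightarrow> complex. peval z e = (\<Sum>(c, m)\<leftarrow>xs. of_rat c * (\<Prod>i\<in>I. z i ^ m i))"
    using pexp_monomials[OF assms(1) e(1)] by blast
  define M where "M = snd ` set xs"
  define c where "c m = (\<Sum>k\<in>{k\<in>{..<length xs}. snd (xs ! k) = m}. fst (xs ! k))" for m
  have M: "M = (\<lambda>k. snd (xs ! k)) ` {..<length xs}"
    unfolding M_def set_conv_nth by auto
  have ev: "peval z e = (\<Sum>m\<in>M. of_rat (c m) * (\<Prod>i\<in>I. z i ^ m i))" for z :: "'a \<Rightarrow> complex"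
  proof -
    have "peval z e = (\<Sum>k<length xs. of_rat (fst (xs ! k)) * (\<Prod>i\<in>I. z i ^ snd (xs ! k) i))"
      unfolding xs(2) sum_list_sum_nth by (auto simp: case_prod_beta atLeast0LessThan)
    also have "\<dots> = (\<Sum>m\<in>M. \<Sum>k\<in>{k\<in>{..<length xs}. snd (xs ! k) = m}.
        of_rat (fst (xs ! k)) * (\<Prod>i\<in>I. z i ^ snd (xs ! k) i))"
      unfolding M by (rule sum.image_gen) simp
    also have "\<dots> = (\<Sum>m\<in>M. of_rat (c m) * (\<Prod>i\<in>I. z i ^ m i))"
      unfolding c_def of_rat_sum sum_distrib_right by (intro sum.cong refl) auto
    finally show ?thesis .
  qed
  have "finite M" "\<forall>m\<in>M. \<forall>i. i \<notin> I \<longrightarrow> m i = 0" unfolding M_def using xs(1) by auto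
  then have "\<forall>m\<in>M. c m = 0" using assms(2) e(2) unfolding ev alg_indep_def by blast
  then show "peval w e = 0" unfolding ev by simp
qed

text \<open>A relation is read as a polynomial in \<open>z i\<close>. Transcendence kills each of
  its coefficients, and each coefficient is a relation among the remaining variables.\<close>

lemma alg_indep_insert:
  assumes I: "finite I" "i \<notin> I" and z: "alg_indep I z" and tr: "transcendental_over (pring I z) (z i)"
  shows "alg_indep (insert i I) z"
  unfolding alg_indep_def
proof (intro allI impI, elim conjE)
  fix M :: "('a \<Rightarrow> nat) set" and c :: "('a \<Rightarrow> nat) \<Rightarrow> rat"
  assume M: "finite M" "\<forall>m\<in>M. \<forall>j. j \<notin> insert i I \<longrightarrow> m j = 0"
    and sum0: "(\<Sum>m\<in>M. of_rat (c m) * (\<Prod>j\<in>insert i I. z j ^ m j)) = 0"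
  define t where "t m = of_rat (c m) * (\<Prod>j\<in>I. z j ^ m j)" for m
  define P where "P = (\<Sum>m\<in>M. monom (t m) (m i))"
  have R: "subalg (pring I z)" by (rule subalg_pring)
  have t: "t m \<in> pring I z" for m
  proof -
    have "(\<Prod>j\<in>I. z j ^ m j) \<in> pring I z" using I(1)
    proof -
      have "(\<Prod>j\<in>J. z j ^ m j) \<in> pring I z" if "J \<subseteq> I" for J
        using finite_subset[OF that I(1)] that
        by (induction J rule: finite_induct) (auto intro: subalgD[OF R] pring_var)
      then show ?thesis by blast
    qed
    then show ?thesis unfolding t_def by (intro subalgD(5)[OF R]) (simp_all add: subalgD(1)[OF R])
  qed
  have coeffP: "coeff P k = (\<Sum>m\<in>{m\<in>M. m i = k}. t m)" for k
    unfolding P_def coeff_sum by (simp add: sum.If_cases[OF M(1)] Int_def)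
  then have "P \<in> polys (pring I z)"
    unfolding polys_def using t by (auto intro!: subalg_sum[OF R])
  moreover have "poly P (z i) = 0"
    using sum0 I by (simp add: P_def poly_sum poly_monom t_def algebra_simps)
  ultimately have "P = 0" using tr unfolding transcendental_over_def by blast
  show "\<forall>m\<in>M. c m = 0"
  proof
    fix m assume m: "m \<in> M"
    define Mk where "Mk = {m'\<in>M. m' i = m i}"
    \<comment> \<open>\<open>r\<close> erases the exponent of \<open>i\<close>, as the support
      condition for \<open>I\<close> demands. It loses no information on \<open>Mk\<close>, whose
      members all share the exponent \<open>m i\<close>.\<close>
    define r where "r = (\<lambda>m'::'a \<Rightarrow> nat. m'(i := 0))"
    define c' where "c' m' = c (m'(i := m i))" for m'
    have inv: "(r m')(i := m i) = m'" if "m' \<in> Mk" for m'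
      using that unfolding r_def Mk_def by auto
    then have inj: "inj_on r Mk" by (metis inj_onI)
    have "(\<Sum>m'\<in>r ` Mk. of_rat (c' m') * (\<Prod>j\<in>I. z j ^ m' j)) =
        (\<Sum>m'\<in>Mk. of_rat (c m') * (\<Prod>j\<in>I. z j ^ m' j))"
      unfolding sum.reindex[OF inj] o_def c'_def
    proof (intro sum.cong refl)
      fix m' assume "m' \<in> Mk"
      moreover have "(\<Prod>j\<in>I. z j ^ (r m') j) = (\<Prod>j\<in>I. z j ^ m' j)"
        using I(2) unfolding r_def by (intro prod.cong) auto
      ultimately show "of_rat (c ((r m')(i := m i))) * (\<Prod>j\<in>I. z j ^ (r m') j) = of_rat (c m') * (\<Prod>j\<in>I. z j ^ m' j)"
        using inv by simp
    qed
    also have "\<dots> = coeff P (m i)" unfolding coeffP t_def Mk_def ..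
    also have "\<dots> = 0" using \<open>P = 0\<close> by simp
    finally have "(\<Sum>m'\<in>r ` Mk. of_rat (c' m') * (\<Prod>j\<in>I. z j ^ m' j)) = 0" .
    moreover have "finite (r ` Mk)" using M(1) unfolding Mk_def by simp
    moreover have "\<forall>m'\<in>r ` Mk. \<forall>j. j \<notin> I \<longrightarrow> m' j = 0"
      using M(2) unfolding Mk_def r_def by auto
    ultimately have "\<forall>m'\<in>r ` Mk. c' m' = 0"
      using z[unfolded alg_indep_def, rule_format, of "r ` Mk" c'] by blast
    then have "c' (r m) = 0" using m unfolding Mk_def by blast
    then show "c m = 0" using inv[of m] m unfolding c'_def Mk_def by simp
  qed
qed

lemma alg_indep_cong: "(\<And>i. i \<in> I \<Longrightarrow> z i = w i) \<Longrightarrow> alg_indep I z \<longleftrightarrow> alg_indep I w"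
  unfolding alg_indep_def by (simp cong: prod.cong)

lemma alg_indep_dense:
  assumes "finite I" "\<epsilon> > 0"
  shows "\<exists>z. alg_indep I z \<and> (\<forall>i\<in>I. cmod (z i - z0 i) < \<epsilon>)"
  using assms(1)
proof (induction I rule: finite_induct)
  case empty
  \<comment> \<open>Without variables the only monomial is the zero exponent, so the sum is a single
    coefficient.\<close>
  have "c m = 0" if "finite M" "\<forall>m\<in>M. \<forall>i. m i = 0" "(\<Sum>m\<in>M. of_rat (c m) :: complex) = 0" "m \<in> M"
    for M :: "('a \<Rightarrow> nat) set" and c m
  proof -
    have "m' = m" if "m' \<in> M" for m'
      using \<open>\<forall>m\<in>M. \<forall>i. m i = 0\<close> that \<open>m \<in> M\<close> by (metis ext)
    then have "M = {m}" using \<open>m \<in> M\<close> by blast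
    then show ?thesis using that by simp
  qed
  then show ?case unfolding alg_indep_def by auto
next
  case (insert i I)
  then obtain z where z: "alg_indep I z" "\<forall>i\<in>I. cmod (z i - z0 i) < \<epsilon>" by blast
  obtain a where a: "cmod (a - z0 i) < \<epsilon>" "transcendental_over (pring I z) a"
    using exists_transcendental[OF countable_pring[OF insert(1)] assms(2)] by blast
  define w where "w = z(i := a)"
  have w: "\<And>j. j \<in> I \<Longrightarrow> w j = z j" "w i = a" using insert unfolding w_def by auto
  have "alg_indep (insert i I) w"
    using alg_indep_insert[OF insert(1,2), of w] z(1) a(2) w alg_indep_cong[of I w z] pring_cong[of I w z]
    by auto
  then show ?case using z(2) a(1) w by (intro exI[of _ w]) auto
qed

section \<open>Independence by adjoining one variable at a time\<close>

primrec pexp_poly :: "'i \<Rightarrow> ('i \<Rightarrow> complex) \<Rightarrow> 'i pexp \<Rightarrow> complex poly" where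
  "pexp_poly i z (PConst c) = monom (of_rat c) 0"
| "pexp_poly i z (PVar j) = (if j = i then monom 1 1 else monom (z j) 0)"
| "pexp_poly i z (PAdd a b) = pexp_poly i z a + pexp_poly i z b"
| "pexp_poly i z (PMul a b) = pexp_poly i z a * pexp_poly i z b"

lemma poly_pexp_poly: "poly (pexp_poly i z e) t = peval (z(i := t)) e"
  by (induction e) (auto simp: poly_monom)

lemma polyfun_coeff_pexp_poly: "pvars e \<subseteq> insert i I \<Longrightarrow> polyfun I (\<lambda>z. coeff (pexp_poly i z e) k)"
proof (induction e arbitrary: k)
  case (PConst c)
  then show ?case by (cases k) (simp_all add: polyfun_const)
next
  case (PVar j)
  then show ?case by (cases k; cases "j = i"; cases "k = 1") (auto simp: polyfun_const polyfun_var)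
next
  case (PAdd a b)
  then show ?case by (simp add: polyfun_add)
next
  case (PMul a b)
  then show ?case by (simp add: coeff_mult polyfun_sum polyfun_mult)
qed

lemma polyfun_in_pring:
  assumes "polyfun I f"
  shows "f z \<in> pring I z"
proof -
  obtain e where "pvars e \<subseteq> I" "f z = peval z e" using assms polyfunE by metis
  then show ?thesis unfolding pring_def by blast
qed

text \<open>Transcendence makes all coefficients in variable \<open>i\<close> vanish at
  \<open>z\<close>; by independence they then vanish at every \<open>w\<close>.\<close>

lemma indep_insert:
  assumes z: "indep I z" and tr: "transcendental_over (pring I z) (z i)"
  shows "indep (insert i I) z"
  unfolding indep_def
proof (intro allI impI)
  fix e and w :: "'a \<Rightarrow> complex" assume e: "pvars e \<subseteq> insert i I" "peval z e = 0"
  have "pexp_poly i z e \<in> polys (pring I z)"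
    unfolding polys_def using polyfun_in_pring[OF polyfun_coeff_pexp_poly[OF e(1)]] by auto
  moreover have "poly (pexp_poly i z e) (z i) = 0" using e(2) by (simp add: poly_pexp_poly)
  ultimately have 0: "pexp_poly i z e = 0" using tr unfolding transcendental_over_def by blast
  have "coeff (pexp_poly i w e) k = 0" for k
    using indepD[OF z polyfun_coeff_pexp_poly[OF e(1)], of k w] 0 by simp
  then have "pexp_poly i w e = 0" by (simp add: poly_eq_iff)
  then show "peval w e = 0" using poly_pexp_poly[of i w e "w i"] by simp
qed

lemma indep_empty: "indep {} z"
  unfolding indep_def
proof (intro allI impI)
  fix e and w :: "'a \<Rightarrow> complex" assume "pvars e \<subseteq> {}" "peval z e = 0"
  then show "peval w e = 0" using peval_cong[of e w z] by auto
qed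

text \<open>The hypothesis compares each element with all the others, as deleting a single edge
  does. It passes to smaller rings, so the elements can be added one by one.\<close>

lemma indep_of_transcendental:
  assumes "finite J" "\<And>j. j \<in> J \<Longrightarrow> transcendental_over (pring (J - {j}) s) (s j)"
  shows "indep J s"
proof -
  have "indep K s" if "K \<subseteq> J" for K
    using finite_subset[OF that assms(1)] that
  proof (induction K rule: finite_induct)
    case empty
    show ?case by (rule indep_empty)
  next
    case (insert j K)
    have "K \<subseteq> J - {j}" using insert by auto
    then have "transcendental_over (pring K s) (s j)"
      using transcendental_over_mono[OF assms(2) pring_mono] insert.prems by blast
    moreover have "indep K s" using insert by blast
    ultimately show ?case by (rule indep_insert[rotated])
  qed
  then show ?thesis by blast
qed

text \<open>The coefficients are delivered as expressions rather than numbers so that the relation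
  can be evaluated again at other realisations.\<close>

lemma not_transcendental_overE:
  assumes "\<not> transcendental_over (pring J s) a"
  obtains c n where "\<And>k. pvars (c k) \<subseteq> J" "(\<Sum>k\<le>n. peval s (c k) * a ^ k) = 0" "peval s (c n) \<noteq> 0"
proof -
  obtain P where P: "P \<in> polys (pring J s)" "poly P a = 0" "P \<noteq> 0"
    using assms unfolding transcendental_over_def by auto
  have "\<forall>k. \<exists>e. pvars e \<subseteq> J \<and> peval s e = coeff P k"
  proof
    fix k
    have "coeff P k \<in> pring J s" using P(1) by (rule polys_coeff)
    then show "\<exists>e. pvars e \<subseteq> J \<and> peval s e = coeff P k" unfolding pring_def by auto
  qed
  then obtain c where c: "\<And>k. pvars (c k) \<subseteq> J" "\<And>k. peval s (c k) = coeff P k" by metis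
  show ?thesis using P c by (intro that[of c "degree P"]) (auto simp: poly_altdef[symmetric])
qed

section \<open>Edge lengths at generic points\<close>

definition coords :: "('a \<Rightarrow> 'k ^ 'n) \<Rightarrow> 'a \<times> 'n \<Rightarrow> 'k" where
  "coords p = (\<lambda>(v, i). p v $ i)"

definition realization :: "('a \<times> 'n \<Rightarrow> 'k) \<Rightarrow> 'a \<Rightarrow> 'k ^ 'n" where
  "realization z v = (\<chi> i. z (v, i))"

definition cpx :: "('a \<Rightarrow> real ^ 'n) \<Rightarrow> 'a \<Rightarrow> complex ^ 'n" where
  "cpx p v = (\<chi> i. complex_of_real (p v $ i))"

lemma coords_realization [simp]: "coords (realization z) = z"
  unfolding coords_def realization_def by auto

lemma coords_cpx: "coords (cpx p) = (\<lambda>x. complex_of_real (coords p x))"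
  unfolding coords_def cpx_def by auto

lemma generic_r_iff: "generic_r V p \<longleftrightarrow> generic_c V (cpx p)"
proof -
  have "(\<lambda>(v, i). complex_of_real (p v $ i)) = (\<lambda>(v, i). cpx p v $ i)"
    by (auto simp: cpx_def)
  then show ?thesis unfolding generic_r_def generic_c_def by simp
qed

lemma generic_c_indep:
  fixes p :: "'a \<Rightarrow> complex ^ 'n::finite"
  assumes "finite V" "generic_c V p"
  shows "indep (V \<times> UNIV) (coords p)"
  using assms alg_indep_imp_indep[of "V \<times> (UNIV :: 'n set)" "coords p"]
  unfolding generic_c_def coords_def by simp

text \<open>An edge is an unordered pair, so the tree is specified for every way of writing
  \<open>e\<close> as \<open>{u, v}\<close>; such a tree exists because squared differences are
  symmetric.\<close>

definition edge_exp :: "'a set \<Rightarrow> ('a \<times> 'n::finite) pexp" where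
  "edge_exp e = (SOME x. pvars x \<subseteq> e \<times> UNIV \<and> (\<forall>u v. e = {u, v} \<longrightarrow>
     (\<forall>z::_ \<Rightarrow> complex. peval z x = (\<Sum>i\<in>UNIV. (z (u, i) - z (v, i))\<^sup>2))))"

lemma edge_exp:
  fixes u v :: 'a
  shows pvars_edge_exp: "pvars (edge_exp {u, v} :: ('a \<times> 'n::finite) pexp) \<subseteq> {u, v} \<times> UNIV"
    and peval_edge_exp_complex:
      "peval z (edge_exp {u, v} :: ('a \<times> 'n) pexp) = (\<Sum>i\<in>UNIV. (z (u, i) - z (v, i) :: complex)\<^sup>2)"
proof -
  have pf: "polyfun ({u, v} \<times> UNIV) (\<lambda>z. \<Sum>i\<in>(UNIV :: 'n set). (z (u, i) - z (v, i))\<^sup>2)"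
    by (intro polyfun_sum polyfun_power polyfun_diff polyfun_var) auto
  obtain x :: "('a \<times> 'n) pexp" where x: "pvars x \<subseteq> {u, v} \<times> UNIV"
    "\<And>z :: _ \<Rightarrow> complex. peval z x = (\<Sum>i\<in>UNIV. (z (u, i) - z (v, i))\<^sup>2)"
    using pf unfolding polyfun_def by blast
  have "pvars x \<subseteq> {u, v} \<times> UNIV \<and> (\<forall>u' v'. {u, v} = {u', v'} \<longrightarrow>
     (\<forall>z::_ \<Rightarrow> complex. peval z x = (\<Sum>i\<in>UNIV. (z (u', i) - z (v', i))\<^sup>2)))"
    using x by (auto simp: doubleton_eq_iff power2_commute)
  from someI[of "\<lambda>x. pvars x \<subseteq> {u, v} \<times> UNIV \<and> (\<forall>u' v'. {u, v} = {u', v'} \<longrightarrow>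
     (\<forall>z::_ \<Rightarrow> complex. peval z x = (\<Sum>i\<in>UNIV. (z (u', i) - z (v', i))\<^sup>2)))", OF this]
  show "pvars (edge_exp {u, v} :: ('a \<times> 'n) pexp) \<subseteq> {u, v} \<times> UNIV"
    "peval z (edge_exp {u, v} :: ('a \<times> 'n) pexp) = (\<Sum>i\<in>UNIV. (z (u, i) - z (v, i))\<^sup>2)"
    unfolding edge_exp_def by auto
qed

lemma peval_edge_exp_cpx:
  fixes p :: "'a \<Rightarrow> complex ^ 'n::finite"
  shows "peval (coords p) (edge_exp {u, v}) = sqd (p u) (p v)"
  unfolding peval_edge_exp_complex by (simp add: coords_def sqd_def)

lemma sqd_cpx: "sqd (cpx p u) (cpx p v) = complex_of_real (sqd (p u) (p v))"
  unfolding sqd_def cpx_def by simp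

lemma peval_edge_exp_real:
  fixes p :: "'a \<Rightarrow> real ^ 'n::finite"
  shows "peval (coords p) (edge_exp {u, v}) = sqd (p u) (p v)"
  using peval_edge_exp_cpx[of "cpx p" u v] unfolding coords_cpx peval_of_real sqd_cpx by simp

lemma pder_edge_exp:
  fixes q m :: "'a \<Rightarrow> complex ^ 'n::finite"
  shows "pder (coords q) (coords m) (edge_exp {u, v}) =
    2 * (\<Sum>i\<in>UNIV. (q u $ i - q v $ i) * (m u $ i - m v $ i))"
proof (rule pder_eq_of_peval)
  show "peval w (edge_exp {u, v}) = (\<Sum>i\<in>UNIV. (w (u, i) - w (v, i))\<^sup>2)" for w :: "'a \<times> 'n \<Rightarrow> complex"
    by (rule peval_edge_exp_complex)
  show "((\<lambda>s. \<Sum>i\<in>UNIV. ((coords q (u, i) + s * coords m (u, i)) - (coords q (v, i) + s * coords m (v, i)))\<^sup>2)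
    has_field_derivative 2 * (\<Sum>i\<in>UNIV. (q u $ i - q v $ i) * (m u $ i - m v $ i))) (at 0)"
    by (auto intro!: derivative_eq_intros simp: coords_def sum_distrib_left algebra_simps)
qed

lemma graph_edge:
  assumes "graph V E" "e \<in> E"
  obtains u v where "e = {u, v}" "u \<noteq> v" "u \<in> V" "v \<in> V"
  using assms unfolding graph_def by blast

lemma pvars_graph_edge:
  "graph V E \<Longrightarrow> e \<in> E \<Longrightarrow> pvars (edge_exp e :: ('a \<times> 'n::finite) pexp) \<subseteq> V \<times> UNIV"
  using pvars_edge_exp by (elim graph_edge) fastforce+

lemma equivalent_iff_complex:
  fixes p q :: "'a \<Rightarrow> complex ^ 'n::finite"
  assumes "graph V E"
  shows "equivalent E p q \<longleftrightarrow> (\<forall>e\<in>E. peval (coords p) (edge_exp e) = peval (coords q) (edge_exp e))"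
proof
  assume "equivalent E p q"
  then show "\<forall>e\<in>E. peval (coords p) (edge_exp e) = peval (coords q) (edge_exp e)"
    unfolding equivalent_def using assms by (metis graph_edge peval_edge_exp_cpx)
next
  assume "\<forall>e\<in>E. peval (coords p) (edge_exp e) = peval (coords q) (edge_exp e)"
  then show "equivalent E p q" unfolding equivalent_def by (metis peval_edge_exp_cpx)
qed

lemma equivalent_iff_real:
  fixes p q :: "'a \<Rightarrow> real ^ 'n::finite"
  assumes "graph V E"
  shows "equivalent E p q \<longleftrightarrow> (\<forall>e\<in>E. peval (coords p) (edge_exp e) = peval (coords q) (edge_exp e))"
proof
  assume "equivalent E p q"
  then show "\<forall>e\<in>E. peval (coords p) (edge_exp e) = peval (coords q) (edge_exp e)"
    unfolding equivalent_def using assms by (metis graph_edge peval_edge_exp_real)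
next
  assume "\<forall>e\<in>E. peval (coords p) (edge_exp e) = peval (coords q) (edge_exp e)"
  then show "equivalent E p q" unfolding equivalent_def by (metis peval_edge_exp_real)
qed

abbreviation edge_vals :: "('a \<Rightarrow> 'k::field_char_0 ^ 'n::finite) \<Rightarrow> 'a set \<Rightarrow> 'k" where
  "edge_vals p \<equiv> (\<lambda>e. peval (coords p) (edge_exp e))"

lemma polyfun_edge_exp_subst:
  assumes "graph V E" "pvars c \<subseteq> E"
  shows "polyfun (V \<times> (UNIV :: 'n::finite set)) (\<lambda>z. peval (\<lambda>e. peval z (edge_exp e)) c)"
proof -
  have "pvars (psubst edge_exp c :: ('a \<times> 'n) pexp) \<subseteq> V \<times> UNIV"
    using assms pvars_graph_edge[OF assms(1)] by fastforce
  from polyfun_peval[OF this] show ?thesis by simp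
qed

lemma graph_finite_edges: "graph V E \<Longrightarrow> finite E"
  unfolding graph_def by (rule finite_subset[of _ "Pow V"]) auto

text \<open>A relation among the edge values of \<open>q\<close> pulls back to one among its
  coordinates. These are independent, so the relation is an identity and holds at \<open>p\<close>
  too.\<close>

lemma indep_edge_vals_transfer:
  fixes p q :: "'a \<Rightarrow> complex ^ 'n::finite"
  assumes G: "graph V E" and p: "indep E (edge_vals p)" and q: "indep (V \<times> UNIV) (coords q)"
  shows "indep E (edge_vals q)"
  unfolding indep_def
proof (intro allI impI)
  fix c and w :: "'a set \<Rightarrow> complex" assume c: "pvars c \<subseteq> E" "peval (edge_vals q) c = 0"
  then have "peval (edge_vals p) c = 0"
    using indepD[OF q polyfun_edge_exp_subst[OF G c(1)]] by blast
  then show "peval w c = 0" using p c(1) unfolding indep_def by blast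
qed

text \<open>A dependent edge has only finitely many possible lengths once the other edges are fixed,
  so deleting it preserves local rigidity.\<close>
lemma rigid_delete_dependent_edge:
  fixes p :: "'a \<Rightarrow> real ^ 'n::finite"
  assumes G: "graph V E" and gen: "generic_r V p" and rig: "rigid_framework V E p"
    and e: "e \<in> E" and dep: "\<not> transcendental_over (pring (E - {e}) (edge_vals (cpx p))) (edge_vals (cpx p) e)"
  shows "rigid_framework V (E - {e}) p"
proof -
  have finV: "finite V" using G unfolding graph_def by simp
  have G': "graph V (E - {e})" using G unfolding graph_def by auto
  have indV: "indep (V \<times> UNIV) (coords (cpx p))"
    using generic_c_indep[OF finV] gen unfolding generic_r_iff by blast
  obtain c n where c: "\<And>k. pvars (c k) \<subseteq> E - {e}"
    "(\<Sum>k\<le>n. peval (edge_vals (cpx p)) (c k) * edge_vals (cpx p) e ^ k) = 0"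
    "peval (edge_vals (cpx p)) (c n) \<noteq> 0"
    using not_transcendental_overE[OF dep] by blast
  have vals_cpx: "edge_vals (cpx r) = (\<lambda>e. complex_of_real (edge_vals r e))" for r :: "'a \<Rightarrow> real ^ 'n"
    unfolding coords_cpx peval_of_real ..
  \<comment> \<open>Read in the coordinates, the relation at \<open>p\<close> becomes an identity
    and so binds every other framework.\<close>
  define F where "F z = (\<Sum>k\<le>n. peval (\<lambda>e. peval z (edge_exp e)) (c k) * peval z (edge_exp e) ^ k)"
    for z :: "'a \<times> 'n \<Rightarrow> complex"
  have "polyfun (V \<times> UNIV) F" unfolding F_def
    by (intro polyfun_sum polyfun_mult polyfun_power polyfun_edge_exp_subst[OF G'] c polyfun_peval
        pvars_graph_edge[OF G e])
  then have F0: "F z = 0" for z using indepD[OF indV, of F z] c(2) unfolding F_def by simp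
  have rel: "(\<Sum>k\<le>n. peval (edge_vals r) (c k) * edge_vals r e ^ k) = 0" for r :: "'a \<Rightarrow> real ^ 'n"
  proof -
    have "complex_of_real (\<Sum>k\<le>n. peval (edge_vals r) (c k) * edge_vals r e ^ k) = F (coords (cpx r))"
      unfolding F_def by (simp add: coords_cpx peval_of_real)
    then show ?thesis using F0 by (metis of_real_eq_0_iff)
  qed
  \<comment> \<open>The other edge values are frozen at \<open>p\<close>. In any framework sharing
    them, the value of \<open>e\<close> is one of the finitely many roots of \<open>P\<close>, and
    \<open>\<eta>\<close> isolates the root attained at \<open>p\<close>.\<close>
  define P where "P = (\<Sum>k\<le>n. monom (peval (edge_vals p) (c k)) k)"
  have "coeff P n \<noteq> 0"
    using c(3) unfolding P_def vals_cpx peval_of_real by (simp add: coeff_sum)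
  then have "P \<noteq> 0" by auto
  then have "finite {x. poly P x = 0}" by (rule poly_roots_finite)
  then obtain \<eta> where \<eta>: "\<eta> > 0" "\<And>x. poly P x = 0 \<Longrightarrow> x \<noteq> edge_vals p e \<Longrightarrow> \<eta> \<le> dist (edge_vals p e) x"
    using finite_set_avoid[of "{x. poly P x = 0}" "edge_vals p e"] by blast
  obtain \<delta> where \<delta>: "\<delta> > 0"
    "\<And>a. \<forall>i\<in>V \<times> UNIV. norm (a i - coords p i) < \<delta> \<Longrightarrow> norm (peval a (edge_exp e) - edge_vals p e) < \<eta>"
    using peval_continuous[OF \<eta>(1) pvars_graph_edge[OF G e], of "coords p"] by blast
  obtain \<epsilon> where \<epsilon>: "\<epsilon> > 0" "\<And>q. \<forall>v\<in>V. dist (q v) (p v) < \<epsilon> \<Longrightarrow> equivalent E p q \<Longrightarrow> congruent_on V p q"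
    using rig unfolding rigid_framework_def by blast
  show ?thesis unfolding rigid_framework_def
  proof (intro exI[of _ "min \<delta> \<epsilon>"] conjI allI impI, use \<delta>(1) \<epsilon>(1) in simp, elim conjE)
    fix q assume q: "\<forall>v\<in>V. dist (q v) (p v) < min \<delta> \<epsilon>" and eq: "equivalent (E - {e}) p q"
    have same: "edge_vals q f = edge_vals p f" if "f \<in> E - {e}" for f
      using eq that unfolding equivalent_iff_real[OF G'] by simp
    have "norm (coords q i - coords p i) < \<delta>" if "i \<in> V \<times> UNIV" for i
    proof -
      obtain v j where i: "i = (v, j)" "v \<in> V" using \<open>i \<in> V \<times> UNIV\<close> by auto
      have "dist (q v $ j) (p v $ j) \<le> dist (q v) (p v)" by (rule dist_vec_nth_le)
      also have "\<dots> < \<delta>" using q i by auto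
      finally show ?thesis unfolding i coords_def by (simp add: dist_norm)
    qed
    then have near: "norm (edge_vals q e - edge_vals p e) < \<eta>" by (intro \<delta>(2)) blast
    have "peval (edge_vals q) (c k) = peval (edge_vals p) (c k)" for k
      using c(1)[of k] by (intro peval_cong[of "c k"] same) blast
    then have "poly P (edge_vals q e) = 0"
      using rel[of q] unfolding P_def by (simp add: poly_sum poly_monom)
    then have "edge_vals q e = edge_vals p e"
      using \<eta>(2)[of "edge_vals q e"] near by (metis dist_commute dist_norm not_le)
    then have "equivalent E p q"
      using same unfolding equivalent_iff_real[OF G] by (metis Diff_iff empty_iff insert_iff)
    then show "congruent_on V p q" using \<epsilon>(2) q by auto
  qed
qed

lemma min_rigid_indep:
  fixes p :: "'a \<Rightarrow> real ^ 'n::finite"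
  assumes G: "graph V E" and gen: "generic_r V p" and rig: "rigid_framework V E p"
    and min: "\<And>e. e \<in> E \<Longrightarrow> \<not> rigid_framework V (E - {e}) p"
  shows "indep E (edge_vals (cpx p))"
  using rigid_delete_dependent_edge[OF G gen rig] min
  by (intro indep_of_transcendental graph_finite_edges[OF G]) blast

text \<open>Were the invariant \<open>x\<close> independent of the edge lengths, one could vary it near \<open>p\<close>
  with all edge lengths fixed.\<close>
lemma rigid_invariant_algebraic:
  fixes p :: "'a \<Rightarrow> real ^ 'n::finite" and x :: "('a \<times> 'n) pexp"
  assumes G: "graph V E" and gen: "generic_r V p" and rig: "rigid_framework V E p"
    and ind: "indep E (edge_vals (cpx p))"
    and x: "pvars x \<subseteq> V \<times> UNIV"
    and inv: "\<And>q :: 'a \<Rightarrow> real ^ 'n. congruent_on V p q \<Longrightarrow> peval (coords q) x = peval (coords p) x"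
  shows "\<not> transcendental_over (pring E (edge_vals (cpx p))) (peval (coords (cpx p)) x)"
proof
  assume tr: "transcendental_over (pring E (edge_vals (cpx p))) (peval (coords (cpx p)) x)"
  have finV: "finite (V \<times> (UNIV :: 'n set))" using G unfolding graph_def by simp
  have finE: "finite (insert {} E)" using graph_finite_edges[OF G] by simp
  have empty: "{} \<notin> E" using G unfolding graph_def by auto
  \<comment> \<open>The empty set is never an edge and serves as the index of the additional
    coordinate \<open>x\<close>.\<close>
  define g where "g e = (if e = {} then x else edge_exp e)" for e :: "'a set"
  have gE: "g e = edge_exp e" if "e \<in> E" for e using that empty unfolding g_def by metis
  have g0: "g {} = x" unfolding g_def by simp
  have g: "pvars (g e) \<subseteq> V \<times> UNIV" if "e \<in> insert {} E" for e
    using that x pvars_graph_edge[OF G, of e] unfolding g_def by (cases "e = {}") simp_all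
  define s where "s e = peval (coords (cpx p)) (g e)" for e
  have sE: "s e = edge_vals (cpx p) e" if "e \<in> E" for e unfolding s_def using gE[OF that] by simp
  have "indep E s"
    unfolding indep_def
  proof (intro allI impI)
    fix c and w :: "'a set \<Rightarrow> complex" assume c: "pvars c \<subseteq> E" "peval s c = 0"
    have "peval s c = peval (edge_vals (cpx p)) c" using c(1) by (intro peval_cong[of c] sE) blast
    then show "peval w c = 0" using ind c(1,2) unfolding indep_def by metis
  qed
  moreover have "transcendental_over (pring E s) (s {})"
  proof -
    have "pring E s = pring E (edge_vals (cpx p))" by (rule pring_cong) (rule sE)
    moreover have "s {} = peval (coords (cpx p)) x" unfolding s_def g0 ..
    ultimately show ?thesis using tr by simp
  qed
  ultimately have indJ: "indep (insert {} E) s" by (rule indep_insert)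
  have surj: "\<exists>v. \<forall>e\<in>insert {} E. pder (coords p) v (g e) = t e" for t :: "'a set \<Rightarrow> real"
  proof -
    obtain v where v: "\<forall>e\<in>insert {} E. pder (coords (cpx p)) v (g e) = complex_of_real (t e)"
      using indep_jacobian_surj[OF finV g indJ[unfolded s_def], of "\<lambda>e. complex_of_real (t e)"] by blast
    have "pder (coords p) (\<lambda>i. Re (v i)) (g e) = t e" if "e \<in> insert {} E" for e
      using bspec[OF v that] unfolding pder_Re coords_cpx by simp
    then show ?thesis by blast
  qed
  obtain \<epsilon> where \<epsilon>: "\<epsilon> > 0" "\<And>q. \<forall>v\<in>V. dist (q v) (p v) < \<epsilon> \<Longrightarrow> equivalent E p q \<Longrightarrow> congruent_on V p q"
    using rig unfolding rigid_framework_def by blast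
  \<comment> \<open>A Euclidean norm is at most the sum of the \<open>CARD('n)\<close> absolute
    coordinates.\<close>
  have \<epsilon>': "\<epsilon> / real CARD('n) > 0" using \<epsilon>(1) by simp
  obtain \<delta> where \<delta>: "\<delta> > 0"
    "\<And>t. \<forall>e\<in>insert {} E. norm (t e - peval (coords p) (g e)) < \<delta> \<Longrightarrow>
      \<exists>a. (\<forall>i\<in>V \<times> UNIV. norm (a i - coords p i) < \<epsilon> / real CARD('n)) \<and> (\<forall>e\<in>insert {} E. peval a (g e) = t e)"
    using peval_locally_surj[OF finV finE g surj \<epsilon>'] by blast
  \<comment> \<open>All edge values are kept and only the invariant is raised, by an amount that
    local surjectivity admits.\<close>
  obtain a where a: "\<forall>i\<in>V \<times> UNIV. norm (a i - coords p i) < \<epsilon> / real CARD('n)"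
    "\<forall>e\<in>insert {} E. peval a (g e) = peval (coords p) (g e) + (if e = {} then \<delta>/2 else 0)"
  proof -
    have "\<forall>e\<in>insert {} E. norm (peval (coords p) (g e) + (if e = {} then \<delta>/2 else 0) - peval (coords p) (g e)) < \<delta>"
      using \<delta>(1) by simp
    from \<delta>(2)[OF this] show ?thesis using that by blast
  qed
  define q where "q = realization a"
  have q: "coords q = a" unfolding q_def by simp
  have "dist (q v) (p v) < \<epsilon>" if "v \<in> V" for v
  proof -
    have "dist (q v) (p v) \<le> (\<Sum>i\<in>UNIV. \<bar>(q v - p v) $ i\<bar>)"
      unfolding dist_norm by (rule norm_le_l1_cart)
    also have "\<dots> < (\<Sum>i\<in>(UNIV :: 'n set). \<epsilon> / real CARD('n))"
    proof (rule sum_strict_mono)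
      fix i :: 'n
      show "\<bar>(q v - p v) $ i\<bar> < \<epsilon> / real CARD('n)"
        using a(1)[rule_format, of "(v, i)"] that unfolding q[symmetric] coords_def by simp
    qed auto
    also have "\<dots> = \<epsilon>" by simp
    finally show ?thesis .
  qed
  moreover have "equivalent E p q"
    unfolding equivalent_iff_real[OF G]
  proof
    fix e assume e: "e \<in> E"
    then have "e \<noteq> {}" using empty by blast
    then have "peval a (g e) = peval (coords p) (g e)" using a(2) e by simp
    then show "edge_vals p e = edge_vals q e" unfolding q gE[OF e] by simp
  qed
  ultimately have "congruent_on V p q" using \<epsilon>(2) by blast
  then have "peval (coords q) x = peval (coords p) x" by (rule inv)
  moreover have "peval (coords q) x = peval (coords p) x + \<delta>/2" using bspec[OF a(2), of "{}"] g0 q by simp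
  ultimately show False using \<delta>(1) by simp
qed

text \<open>Dividing the algebraic relation for \<open>x\<close> by a power of \<open>x\<close> makes its constant term a
  nonzero polynomial in the edge lengths, so \<open>x\<close> vanishes on no fibre of a generic point.\<close>
lemma algebraic_invariant_nonzero:
  fixes p q q' :: "'a \<Rightarrow> complex ^ 'n::finite" and x :: "('a \<times> 'n) pexp"
  assumes G: "graph V E" and p: "indep (V \<times> UNIV) (coords p)" and q: "indep (V \<times> UNIV) (coords q)"
    and x: "pvars x \<subseteq> V \<times> UNIV" "peval w x \<noteq> (0 :: complex)"
    and alg: "\<not> transcendental_over (pring E (edge_vals p)) (peval (coords p) x)"
    and eq: "equivalent E q q'"
  shows "peval (coords q') x \<noteq> 0"
proof
  assume zero: "peval (coords q') x = 0"
  obtain c n where c: "\<And>k. pvars (c k) \<subseteq> E"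
    "(\<Sum>k\<le>n. peval (edge_vals p) (c k) * peval (coords p) x ^ k) = 0"
    "peval (edge_vals p) (c n) \<noteq> 0"
    using not_transcendental_overE[OF alg] by blast
  \<comment> \<open>The relation is divided by the power of \<open>x\<close> belonging to its lowest
    nonvanishing coefficient; this is legitimate at \<open>p\<close>, where \<open>x\<close> is
    nonzero.\<close>
  define l where "l = (LEAST k. peval (edge_vals p) (c k) \<noteq> 0)"
  have l: "peval (edge_vals p) (c l) \<noteq> 0" unfolding l_def using c(3) by (rule LeastI)
  have below: "peval (edge_vals p) (c k) = 0" if "k < l" for k
    using not_less_Least[of k "\<lambda>k. peval (edge_vals p) (c k) \<noteq> 0"] that unfolding l_def by auto
  have ln: "l \<le> n" unfolding l_def using c(3) by (rule Least_le)
  define F where "F z = (\<Sum>k\<in>{l..n}. peval (\<lambda>e. peval z (edge_exp e)) (c k) * peval z x ^ (k - l))"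
    for z :: "'a \<times> 'n \<Rightarrow> complex"
  have polyF: "polyfun (V \<times> UNIV) F" unfolding F_def
    by (intro polyfun_sum polyfun_mult polyfun_power polyfun_edge_exp_subst[OF G] c polyfun_peval x)
  have xp: "peval (coords p) x \<noteq> 0" using p x unfolding indep_def by blast
  have "peval (coords p) x ^ l * F (coords p) = (\<Sum>k\<in>{l..n}. peval (edge_vals p) (c k) * peval (coords p) x ^ k)"
    unfolding F_def sum_distrib_left
    by (intro sum.cong refl) (simp add: power_add[symmetric] mult.left_commute)
  also have "\<dots> = (\<Sum>k\<le>n. peval (edge_vals p) (c k) * peval (coords p) x ^ k)"
    using below by (intro sum.mono_neutral_left) auto
  finally have "F (coords p) = 0" using c(2) xp by simp
  then have "F (coords q') = 0" by (rule indepD[OF p polyF])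
  moreover have "F (coords q') = peval (edge_vals q') (c l)"
  proof -
    \<comment> \<open>With \<open>x\<close> zero at \<open>q'\<close>, the factor
      \<open>0 ^ (k - l)\<close> is \<open>1\<close> for \<open>k = l\<close> and \<open>0\<close>
      for larger \<open>k\<close>.\<close>
    have "F (coords q') = (\<Sum>k\<in>{l}. peval (edge_vals q') (c k) * peval (coords q') x ^ (k - l))"
      unfolding F_def using ln zero by (intro sum.mono_neutral_right) auto
    then show ?thesis by simp
  qed
  moreover have "peval (edge_vals q') (c l) = peval (edge_vals q) (c l)"
    using c(1)[of l] eq unfolding equivalent_iff_complex[OF G] by (intro peval_cong[of "c l"]) auto
  ultimately have "peval (edge_vals q) (c l) = 0" by simp
  then have "peval (edge_vals p) (c l) = 0"
    by (rule indepD[OF q polyfun_edge_exp_subst[OF G c(1)]])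
  then show False using l by simp
qed

section \<open>Congruence and the spoke determinant\<close>

definition spokes :: "('n \<Rightarrow> 'a) \<Rightarrow> 'a \<Rightarrow> ('a \<Rightarrow> 'k::comm_ring_1 ^ 'n) \<Rightarrow> 'k ^ 'n ^ 'n" where
  "spokes w x p = (\<chi> i. p (w i) - p x)"

text \<open>Squaring removes the sign by which an orientation-reversing isometry changes the
  determinant.\<close>

lemma det_spokes_congruent:
  fixes p q :: "'a \<Rightarrow> real ^ 'n::finite"
  assumes "congruent_on V p q" "x \<in> V" "range w \<subseteq> V"
  shows "(det (spokes w x q))\<^sup>2 = (det (spokes w x p))\<^sup>2"
proof -
  obtain A b where A: "orthogonal_matrix A" "\<And>v. v \<in> V \<Longrightarrow> q v = A *v p v + b"
    using assms(1) unfolding congruent_on_def by blast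
  have "spokes w x q = spokes w x p ** transpose A"
  proof (simp only: vec_eq_iff, intro allI)
    fix i j
    have "q (w i) - q x = A *v (p (w i) - p x)"
      using A(2) assms by (simp add: matrix_vector_mult_diff_distrib image_subset_iff)
    then show "spokes w x q $ i $ j = (spokes w x p ** transpose A) $ i $ j"
      by (simp add: spokes_def matrix_matrix_mult_def matrix_vector_mult_def transpose_def mult.commute)
  qed
  moreover have "(det A)\<^sup>2 = 1" using det_orthogonal_matrix[OF A(1)] by auto
  ultimately show ?thesis by (simp add: det_mul det_transpose power_mult_distrib)
qed

lemma inner_from_sqd:
  fixes a b c :: "complex ^ 'n::finite"
  shows "2 * (\<Sum>i\<in>UNIV. (a $ i - c $ i) * (b $ i - c $ i)) = sqd a c + sqd b c - sqd a b"
  unfolding sqd_def sum_distrib_left sum.distrib[symmetric] sum_subtractf[symmetric]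
  by (intro sum.cong refl) (simp add: power2_eq_square algebra_simps)

text \<open>Distances determine the products of difference vectors at \<open>x\<close>. Both sets of
  spokes are bases with the same Gram matrix, so the change of basis is orthogonal; every other
  point follows because its products with a basis determine it. Without a basis isotropic vectors
  would defeat the argument.\<close>

lemma congruent_of_sqd_eq:
  fixes p q :: "'a \<Rightarrow> complex ^ 'n::finite"
  assumes x: "x \<in> V" and w: "range w \<subseteq> V"
    and det: "det (spokes w x p) \<noteq> 0" "det (spokes w x q) \<noteq> 0"
    and eq: "\<And>u v. u \<in> V \<Longrightarrow> v \<in> V \<Longrightarrow> sqd (p u) (p v) = sqd (q u) (q v)"
  shows "congruent_on V p q"
proof -
  let ?M = "spokes w x p" and ?N = "spokes w x q"
  have inner: "(\<Sum>i\<in>UNIV. (p u $ i - p x $ i) * (p v $ i - p x $ i)) =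
      (\<Sum>i\<in>UNIV. (q u $ i - q x $ i) * (q v $ i - q x $ i))" if "u \<in> V" "v \<in> V" for u v
  proof -
    have "2 * (\<Sum>i\<in>UNIV. (p u $ i - p x $ i) * (p v $ i - p x $ i)) =
        2 * (\<Sum>i\<in>UNIV. (q u $ i - q x $ i) * (q v $ i - q x $ i))"
      unfolding inner_from_sqd using eq that x by simp
    then show ?thesis by simp
  qed
  obtain M' where M': "M' ** ?M = mat 1" "?M ** M' = mat 1"
    using det(1) unfolding invertible_det_nz[symmetric] invertible_def by blast
  define B where "B = M' ** ?N"
  have MB: "?M ** B = ?N" unfolding B_def by (simp add: matrix_mul_assoc M')
  have gram: "?M ** transpose ?M = ?N ** transpose ?N"
    using inner w by (simp add: vec_eq_iff matrix_matrix_mult_def transpose_def spokes_def image_subset_iff)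
  \<comment> \<open>Cancelling the invertible spoke matrix on both sides of this Gram identity
    leaves the orthogonality of \<open>B\<close>.\<close>
  have "?M ** (B ** transpose B) ** transpose ?M = ?N ** transpose ?N"
    unfolding MB[symmetric] matrix_transpose_mul by (simp add: matrix_mul_assoc)
  then have "M' ** (?M ** (B ** transpose B) ** transpose ?M) ** transpose M' =
      M' ** (?M ** transpose ?M) ** transpose M'"
    unfolding gram by simp
  moreover have "transpose ?M ** transpose M' = mat 1"
    using M'(1) by (metis matrix_transpose_mul transpose_mat)
  ultimately have BB: "B ** transpose B = mat 1"
    by (metis M'(1) matrix_mul_assoc matrix_mul_lid matrix_mul_rid)
  then have BB': "transpose B ** B = mat 1" by (simp add: matrix_left_right_inverse)
  define A where "A = transpose B"
  have "orthogonal_matrix A" unfolding orthogonal_matrix_def A_def using BB BB' by simp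
  moreover have "q v = A *v p v + (q x - A *v p x)" if v: "v \<in> V" for v
  proof -
    have "?M *v (p v - p x) = ?N *v (q v - q x)"
      using inner w v by (simp add: vec_eq_iff matrix_vector_mult_def spokes_def image_subset_iff)
    then have "M' *v (?M *v (p v - p x)) = M' *v (?N *v (q v - q x))" by simp
    then have "p v - p x = B *v (q v - q x)"
      unfolding matrix_vector_mul_assoc M' B_def by simp
    then have "A *v (p v - p x) = q v - q x"
      unfolding A_def by (simp add: matrix_vector_mul_assoc BB')
    then show ?thesis by (simp add: matrix_vector_mult_diff_distrib algebra_simps)
  qed
  ultimately show ?thesis unfolding congruent_on_def by blast
qed

lemma sqd_congruent:
  fixes p q :: "'a \<Rightarrow> complex ^ 'n::finite"
  assumes "congruent_on V p q" "u \<in> V" "v \<in> V"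
  shows "sqd (q u) (q v) = sqd (p u) (p v)"
proof -
  obtain A b where A: "orthogonal_matrix A" "\<And>v. v \<in> V \<Longrightarrow> q v = A *v p v + b"
    using assms(1) unfolding congruent_on_def by blast
  define a where "a = p u - p v"
  have d: "q u - q v = A *v a" using A(2) assms unfolding a_def by (simp add: matrix_vector_mult_diff_distrib)
  have sq: "sqd y z = (\<Sum>i\<in>UNIV. (y - z) $ i * (y - z) $ i)" for y z :: "complex ^ 'n"
    unfolding sqd_def by (simp add: power2_eq_square)
  have row: "(\<Sum>i\<in>UNIV. A $ i $ j * A $ i $ k) = (if j = k then 1 else 0)" for j k
    using A(1) unfolding orthogonal_matrix_def
    by (simp add: vec_eq_iff matrix_matrix_mult_def transpose_def mat_def)
  have "sqd (q u) (q v) = (\<Sum>i\<in>UNIV. (\<Sum>j\<in>UNIV. A $ i $ j * a $ j) * (\<Sum>k\<in>UNIV. A $ i $ k * a $ k))"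
    unfolding sq d by (simp add: matrix_vector_mult_def)
  also have "\<dots> = (\<Sum>i\<in>UNIV. \<Sum>j\<in>UNIV. \<Sum>k\<in>UNIV. (A $ i $ j * A $ i $ k) * (a $ j * a $ k))"
    by (simp add: sum_product algebra_simps)
  also have "\<dots> = (\<Sum>j\<in>UNIV. \<Sum>k\<in>UNIV. \<Sum>i\<in>UNIV. (A $ i $ j * A $ i $ k) * (a $ j * a $ k))"
    by (subst sum.swap) (intro sum.cong refl sum.swap)
  also have "\<dots> = (\<Sum>j\<in>UNIV. \<Sum>k\<in>UNIV. (if j = k then 1 else 0) * (a $ j * a $ k))"
    unfolding sum_distrib_right[symmetric] row ..
  also have "\<dots> = (\<Sum>j\<in>UNIV. a $ j * a $ j)"
    by (simp add: if_distrib[of "\<lambda>x. x * _"] cong: if_cong)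
  finally show ?thesis unfolding sq a_def .
qed

lemma congruent_on_refl: "congruent_on V p p"
  unfolding congruent_on_def
  by (intro exI[of _ "mat 1"] exI[of _ 0]) (simp add: orthogonal_matrix_def)

lemma congruent_on_sym:
  assumes "congruent_on V p q"
  shows "congruent_on V q p"
proof -
  obtain A b where A: "orthogonal_matrix A" "\<And>v. v \<in> V \<Longrightarrow> q v = A *v p v + b"
    using assms unfolding congruent_on_def by blast
  have "p v = transpose A *v q v + (- (transpose A *v b))" if "v \<in> V" for v
    using A(1) unfolding orthogonal_matrix_def A(2)[OF that]
    by (simp add: matrix_vector_right_distrib matrix_vector_mul_assoc)
  moreover have "orthogonal_matrix (transpose A)" using A(1) unfolding orthogonal_matrix_def by simp
  ultimately show ?thesis unfolding congruent_on_def by blast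
qed

lemma congruent_on_trans:
  assumes "congruent_on V p q" "congruent_on V q r"
  shows "congruent_on V p r"
proof -
  obtain A b where A: "orthogonal_matrix A" "\<And>v. v \<in> V \<Longrightarrow> q v = A *v p v + b"
    using assms(1) unfolding congruent_on_def by blast
  obtain B c where B: "orthogonal_matrix B" "\<And>v. v \<in> V \<Longrightarrow> r v = B *v q v + c"
    using assms(2) unfolding congruent_on_def by blast
  have "transpose (B ** A) ** (B ** A) = transpose A ** (transpose B ** B) ** A"
    "(B ** A) ** transpose (B ** A) = B ** (A ** transpose A) ** transpose B"
    by (simp_all add: matrix_transpose_mul matrix_mul_assoc)
  then have "orthogonal_matrix (B ** A)" using A(1) B(1) unfolding orthogonal_matrix_def by simp
  moreover have "r v = (B ** A) *v p v + (B *v b + c)" if "v \<in> V" for v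
    by (simp add: A(2) B(2) that matrix_vector_right_distrib matrix_vector_mul_assoc)
  ultimately show ?thesis unfolding congruent_on_def by blast
qed

lemma polyfun_det_spokes:
  assumes "x \<in> V" "range w \<subseteq> V"
  shows "polyfun (V \<times> (UNIV :: 'n::finite set)) (\<lambda>z. (det (spokes w x (realization z) :: complex ^ 'n ^ 'n))\<^sup>2)"
  unfolding det_def spokes_def realization_def using assms
  by (intro polyfun_power polyfun_sum polyfun_mult polyfun_prod polyfun_const)
    (auto intro!: polyfun_diff polyfun_var)

lemma realization_coords [simp]: "realization (coords p) = p"
  unfolding realization_def coords_def by (simp add: fun_eq_iff vec_eq_iff)

lemma det_spokes_cpx: "det (spokes w x (cpx p)) = complex_of_real (det (spokes w x p))"
  unfolding det_def spokes_def cpx_def by simp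

text \<open>Rigidity is given at the real \<open>p\<close> and yields the algebraic relation there;
  the relation then reaches the fibre over any generic complex \<open>q\<close>.\<close>

lemma det_spokes_nonzero:
  fixes p :: "'a \<Rightarrow> real ^ 'n::finite" and q q' :: "'a \<Rightarrow> complex ^ 'n"
  assumes G: "graph V E" and gen: "generic_r V p" and rig: "rigid_framework V E p"
    and ind: "indep E (edge_vals (cpx p))" and q: "generic_c V q" and eq: "equivalent E q q'"
    and x: "x \<in> V" "x \<notin> range w" and w: "range w \<subseteq> V" "inj w"
  shows "det (spokes w x q') \<noteq> 0"
proof -
  have finV: "finite V" using G unfolding graph_def by simp
  obtain d :: "('a \<times> 'n) pexp" where d: "pvars d \<subseteq> V \<times> UNIV"
    "\<And>z :: 'a \<times> 'n \<Rightarrow> complex. peval z d = (det (spokes w x (realization z)))\<^sup>2"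
    using polyfunE[OF polyfun_det_spokes[OF x(1) w(1)]] by metis
  have dr: "peval (coords r) d = (det (spokes w x r))\<^sup>2" for r :: "'a \<Rightarrow> real ^ 'n"
  proof -
    have "complex_of_real (peval (coords r) d) = peval (coords (cpx r)) d"
      unfolding coords_cpx peval_of_real ..
    also have "\<dots> = complex_of_real ((det (spokes w x r))\<^sup>2)"
      unfolding d(2) by (simp add: det_spokes_cpx)
    finally show ?thesis by (simp only: of_real_eq_iff)
  qed
  have "\<not> transcendental_over (pring E (edge_vals (cpx p))) (peval (coords (cpx p)) d)"
    using det_spokes_congruent[OF _ x(1) w(1)] unfolding dr[symmetric]
    by (intro rigid_invariant_algebraic[OF G gen rig ind d(1)]) blast
  \<comment> \<open>A witness that the squared determinant is not the zero polynomial: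
    \<open>x\<close> sits at the origin and each \<open>w j\<close> at the unit vector of index
    \<open>j\<close>.\<close>
  moreover have "peval (coords (\<lambda>v. \<chi> j. if v = w j then 1 else (0::complex))) d \<noteq> 0"
  proof -
    have "spokes w x (\<lambda>v. \<chi> j. if v = w j then 1 else (0::complex)) = mat 1"
      using x(2) injD[OF w(2)] by (auto simp: spokes_def mat_def vec_eq_iff)
    then show ?thesis unfolding d(2) by simp
  qed
  ultimately have "peval (coords q') d \<noteq> 0"
    using algebraic_invariant_nonzero[OF G _ _ d(1) _ _ eq] generic_c_indep[OF finV] gen q
    unfolding generic_r_iff by blast
  then show ?thesis unfolding d(2) by simp
qed

section \<open>Moving points of a fibre to another generic fibre\<close>

lemma generic_c_exists: "finite V \<Longrightarrow> \<exists>p :: 'a \<Rightarrow> complex ^ 'n::finite. generic_c V p"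
proof -
  assume "finite V"
  then have "finite (V \<times> (UNIV :: 'n set))" by simp
  then obtain z where z: "alg_indep (V \<times> (UNIV :: 'n set)) z"
    using alg_indep_dense[OF _ zero_less_one] by blast
  then have "generic_c V (realization z)"
    unfolding generic_c_def using coords_realization[of z] unfolding coords_def by simp
  then show ?thesis by blast
qed

lemma embedding_on_inj:
  assumes "subalg S" "embedding_on S \<psi>" "u \<in> S" "v \<in> S" "\<psi> u = \<psi> v"
  shows "u = v"
proof -
  have "\<psi> ((u - v) + v) = \<psi> (u - v) + \<psi> v"
    using assms by (intro embedding_onD(4) subalgD(6))
  then have "\<psi> (u - v) = 0" using assms(5) by simp
  then show ?thesis using embedding_onD(6)[OF assms(2) subalgD(6)[OF assms(1,3,4)]] by simp
qed

text \<open>An embedding preserves equations and, being injective, inequations. The separating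
  expressions \<open>h C D\<close> therefore still tell the transported points apart.\<close>

lemma transfer_family:
  fixes z z' :: "'i \<Rightarrow> complex" and a :: "'f \<Rightarrow> 'i \<Rightarrow> complex"
  assumes I: "finite I" and z: "indep I z" "indep I z'" and F: "finite F"
    and g: "\<And>e. e \<in> E \<Longrightarrow> pvars (g e) \<subseteq> I" and h: "\<And>C D. C \<in> F \<Longrightarrow> D \<in> F \<Longrightarrow> pvars (h C D) \<subseteq> I"
    and eq: "\<And>C e. C \<in> F \<Longrightarrow> e \<in> E \<Longrightarrow> peval (a C) (g e) = peval z (g e)"
    and sep: "\<And>C D. C \<in> F \<Longrightarrow> D \<in> F \<Longrightarrow> C \<noteq> D \<Longrightarrow> peval (a C) (h C D) \<noteq> peval (a D) (h C D)"
  shows "\<exists>b. (\<forall>C\<in>F. \<forall>e\<in>E. peval (b C) (g e) = peval z' (g e)) \<and>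
    (\<forall>C\<in>F. \<forall>D\<in>F. C \<noteq> D \<longrightarrow> peval (b C) (h C D) \<noteq> peval (b D) (h C D))"
proof -
  have "finite (\<Union>C\<in>F. a C ` I)" using F I by simp
  from indep_embedding[OF I z this] obtain S \<psi> where S: "subalg S" "z ` I \<subseteq> S"
    "(\<Union>C\<in>F. a C ` I) \<subseteq> S" "embedding_on S \<psi>" "\<forall>i\<in>I. \<psi> (z i) = z' i" by blast
  define b where "b C i = \<psi> (a C i)" for C i
  have ev: "\<psi> (peval (a C) e) = peval (b C) e" "peval (a C) e \<in> S" if "C \<in> F" "pvars e \<subseteq> I" for C e
  proof -
    have sub: "a C ` pvars e \<subseteq> S" using S(3) that by blast
    show "\<psi> (peval (a C) e) = peval (b C) e"
      unfolding b_def by (rule embedding_on_peval[OF S(1,4) sub])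
    show "peval (a C) e \<in> S" by (rule peval_in_subalg[OF S(1) sub])
  qed
  show ?thesis
  proof (intro exI[of _ b] conjI ballI impI)
    fix C e assume C: "C \<in> F" and e: "e \<in> E"
    have "peval (b C) (g e) = \<psi> (peval z (g e))" using ev(1)[OF C g[OF e]] eq[OF C e] by simp
    also have "\<dots> = peval (\<lambda>i. \<psi> (z i)) (g e)"
      using S(2) g[OF e] by (intro embedding_on_peval[OF S(1,4)]) blast
    also have "\<dots> = peval z' (g e)" using S(5) g[OF e] by (intro peval_cong) blast
    finally show "peval (b C) (g e) = peval z' (g e)" .
  next
    fix C D assume CD: "C \<in> F" "D \<in> F" "C \<noteq> D"
    show "peval (b C) (h C D) \<noteq> peval (b D) (h C D)"
      using sep[OF CD] embedding_on_inj[OF S(1,4) ev(2)[OF CD(1)] ev(2)[OF CD(2)]] h[OF CD(1,2)]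
        ev(1)[OF CD(1)] ev(1)[OF CD(2)] by metis
  qed
qed

text \<open>The point \<open>z\<close> may be special: perturb it to a nearby generic point first, then transfer
  from there to \<open>z'\<close> by a field embedding.\<close>
lemma regular_fibre_points_persist:
  fixes z z' :: "'i \<Rightarrow> complex" and r :: "'f \<Rightarrow> 'i \<Rightarrow> complex"
  assumes I: "finite I" and z': "indep I z'" and F: "finite F" and E: "finite E"
    and g: "\<And>e. e \<in> E \<Longrightarrow> pvars (g e) \<subseteq> I" and h: "\<And>C D. C \<in> F \<Longrightarrow> D \<in> F \<Longrightarrow> pvars (h C D) \<subseteq> I"
    and eq: "\<And>C e. C \<in> F \<Longrightarrow> e \<in> E \<Longrightarrow> peval (r C) (g e) = peval z (g e)"
    and sep: "\<And>C D. C \<in> F \<Longrightarrow> D \<in> F \<Longrightarrow> C \<noteq> D \<Longrightarrow> peval (r C) (h C D) \<noteq> peval (r D) (h C D)"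
    and reg: "\<And>C t. C \<in> F \<Longrightarrow> \<exists>v. \<forall>e\<in>E. pder (r C) v (g e) = t e"
  shows "\<exists>b. (\<forall>C\<in>F. \<forall>e\<in>E. peval (b C) (g e) = peval z' (g e)) \<and>
    (\<forall>C\<in>F. \<forall>D\<in>F. C \<noteq> D \<longrightarrow> peval (b C) (h C D) \<noteq> peval (b D) (h C D))"
proof -
  define near where "near \<epsilon> a c \<longleftrightarrow> (\<forall>i\<in>I. norm (a i - c i) < \<epsilon>)" for \<epsilon> and a c :: "'i \<Rightarrow> complex"
  have near_mono: "near \<epsilon> a c \<Longrightarrow> \<epsilon> \<le> \<epsilon>' \<Longrightarrow> near \<epsilon>' a c" for \<epsilon> \<epsilon>' a c
    unfolding near_def by force
  have "\<exists>\<epsilon>>0. \<forall>X\<in>F \<times> F. fst X \<noteq> snd X \<longrightarrow> (\<forall>a c. near \<epsilon> a (r (fst X)) \<longrightarrow> near \<epsilon> c (r (snd X)) \<longrightarrow>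
      peval a (h (fst X) (snd X)) \<noteq> peval c (h (fst X) (snd X)))"
    (is "\<exists>\<epsilon>>0. \<forall>X\<in>F \<times> F. ?Q X \<epsilon>")
  proof (rule finite_uniform_delta)
    show "finite (F \<times> F)" using F by simp
    show "?Q X \<epsilon>'" if "?Q X \<epsilon>" "\<epsilon>' \<le> \<epsilon>" for X \<epsilon> \<epsilon>' using that near_mono by blast
    fix X assume "X \<in> F \<times> F"
    then obtain C D where X: "X = (C, D)" "C \<in> F" "D \<in> F" by auto
    show "\<exists>\<epsilon>>0. ?Q X \<epsilon>"
    proof (cases "C = D")
      case True
      then show ?thesis using X by (intro exI[of _ 1]) auto
    next
      case False
      \<comment> \<open>Half the gap: two values that each move by less than this cannot
        meet.\<close>
      let ?d = "norm (peval (r C) (h C D) - peval (r D) (h C D)) / 2"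
      have d: "?d > 0" using sep[OF X(2,3) False] by simp
      obtain \<epsilon>1 where \<epsilon>1: "\<epsilon>1 > 0" "\<And>a. near \<epsilon>1 a (r C) \<Longrightarrow> norm (peval a (h C D) - peval (r C) (h C D)) < ?d"
        using peval_continuous[OF d h[OF X(2,3)], of "r C"] unfolding near_def by blast
      obtain \<epsilon>2 where \<epsilon>2: "\<epsilon>2 > 0" "\<And>a. near \<epsilon>2 a (r D) \<Longrightarrow> norm (peval a (h C D) - peval (r D) (h C D)) < ?d"
        using peval_continuous[OF d h[OF X(2,3)], of "r D"] unfolding near_def by blast
      have "peval a (h C D) \<noteq> peval c (h C D)"
        if "near (min \<epsilon>1 \<epsilon>2) a (r C)" "near (min \<epsilon>1 \<epsilon>2) c (r D)" for a c
      proof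
        assume "peval a (h C D) = peval c (h C D)"
        then have "peval (r C) (h C D) - peval (r D) (h C D) =
            (peval c (h C D) - peval (r D) (h C D)) - (peval a (h C D) - peval (r C) (h C D))" by simp
        then have "norm (peval (r C) (h C D) - peval (r D) (h C D)) \<le>
            norm (peval c (h C D) - peval (r D) (h C D)) + norm (peval a (h C D) - peval (r C) (h C D))"
          by (simp only: norm_triangle_ineq4)
        moreover have "norm (peval a (h C D) - peval (r C) (h C D)) < ?d"
          by (intro \<epsilon>1(2) near_mono[OF that(1)] min.cobounded1)
        moreover have "norm (peval c (h C D) - peval (r D) (h C D)) < ?d"
          by (intro \<epsilon>2(2) near_mono[OF that(2)] min.cobounded2)
        ultimately show False by linarith
      qed
      then have "?Q X (min \<epsilon>1 \<epsilon>2)" unfolding X(1) fst_conv snd_conv by blast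
      moreover have "min \<epsilon>1 \<epsilon>2 > 0" using \<epsilon>1(1) \<epsilon>2(1) by simp
      ultimately show ?thesis by blast
    qed
  qed
  then obtain \<epsilon> where \<epsilon>0: "\<epsilon> > 0" "\<forall>X\<in>F \<times> F. ?Q X \<epsilon>" by blast
  have \<epsilon>: "\<epsilon> > 0" "\<And>C D a c. C \<in> F \<Longrightarrow> D \<in> F \<Longrightarrow> C \<noteq> D \<Longrightarrow> near \<epsilon> a (r C) \<Longrightarrow> near \<epsilon> c (r D) \<Longrightarrow>
      peval a (h C D) \<noteq> peval c (h C D)"
  proof -
    show "\<epsilon> > 0" by (rule \<epsilon>0(1))
    fix C D a c assume "C \<in> F" "D \<in> F" "C \<noteq> D" "near \<epsilon> a (r C)" "near \<epsilon> c (r D)"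
    then show "peval a (h C D) \<noteq> peval c (h C D)" using bspec[OF \<epsilon>0(2), of "(C, D)"] by simp
  qed
  have "\<exists>\<delta>>0. \<forall>C\<in>F. \<forall>t. (\<forall>e\<in>E. norm (t e - peval (r C) (g e)) < \<delta>) \<longrightarrow>
      (\<exists>a. near \<epsilon> a (r C) \<and> (\<forall>e\<in>E. peval a (g e) = t e))"
    (is "\<exists>\<delta>>0. \<forall>C\<in>F. ?Q C \<delta>")
  proof (rule finite_uniform_delta[OF F])
    show "?Q C \<delta>'" if "?Q C \<delta>" "\<delta>' \<le> \<delta>" for C \<delta> \<delta>' using that less_le_trans by blast
    show "\<exists>\<delta>>0. ?Q C \<delta>" if "C \<in> F" for C
      using peval_locally_surj[OF I E g reg[OF that] \<epsilon>(1)] unfolding near_def by blast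
  qed
  then obtain \<delta> where \<delta>: "\<delta> > 0" "\<And>C t. C \<in> F \<Longrightarrow> \<forall>e\<in>E. norm (t e - peval (r C) (g e)) < \<delta> \<Longrightarrow>
      \<exists>a. near \<epsilon> a (r C) \<and> (\<forall>e\<in>E. peval a (g e) = t e)" by blast
  have "\<exists>\<gamma>>0. \<forall>e\<in>E. \<forall>a. near \<gamma> a z \<longrightarrow> norm (peval a (g e) - peval z (g e)) < \<delta>"
    (is "\<exists>\<gamma>>0. \<forall>e\<in>E. ?Q e \<gamma>")
  proof (rule finite_uniform_delta[OF E])
    show "?Q e \<gamma>'" if "?Q e \<gamma>" "\<gamma>' \<le> \<gamma>" for e \<gamma> \<gamma>' using that near_mono by blast
    show "\<exists>\<gamma>>0. ?Q e \<gamma>" if "e \<in> E" for e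
      using peval_continuous[OF \<delta>(1) g[OF that]] unfolding near_def by blast
  qed
  then obtain \<gamma> where \<gamma>: "\<gamma> > 0" "\<And>e a. e \<in> E \<Longrightarrow> near \<gamma> a z \<Longrightarrow> norm (peval a (g e) - peval z (g e)) < \<delta>"
    by blast
  \<comment> \<open>A generic \<open>y\<close> so close to \<open>z\<close> that its values of
    \<open>g\<close> lie within \<open>\<delta>\<close> of those shared by all the
    \<open>r C\<close>; hence every \<open>r C\<close> deforms to a point over this one
    \<open>y\<close>.\<close>
  obtain y where y: "alg_indep I y" "near \<gamma> y z"
    using alg_indep_dense[OF I \<gamma>(1), of z] unfolding near_def by blast
  have "\<exists>a. near \<epsilon> a (r C) \<and> (\<forall>e\<in>E. peval a (g e) = peval y (g e))" if "C \<in> F" for C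
    using \<gamma>(2)[OF _ y(2)] eq[OF that] by (intro \<delta>(2)[OF that]) simp
  then have "\<forall>C\<in>F. \<exists>a. near \<epsilon> a (r C) \<and> (\<forall>e\<in>E. peval a (g e) = peval y (g e))" by blast
  from bchoice[OF this] obtain a where a: "\<And>C. C \<in> F \<Longrightarrow> near \<epsilon> (a C) (r C)"
    "\<And>C e. C \<in> F \<Longrightarrow> e \<in> E \<Longrightarrow> peval (a C) (g e) = peval y (g e)" by blast
  have sepa: "peval (a C) (h C D) \<noteq> peval (a D) (h C D)" if "C \<in> F" "D \<in> F" "C \<noteq> D" for C D
    using that by (intro \<epsilon>(2) a(1))
  show ?thesis
  proof (rule transfer_family[where z = y and a = a])
    show "indep I y" by (rule alg_indep_imp_indep[OF I y(1)])
  qed (fact I z' F | rule g h a(2) sepa; assumption)+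
qed

section \<open>Spider-splits\<close>

text \<open>Contracting both copies back to \<open>x\<close> is a graph homomorphism from
  \<open>G'\<close> to \<open>G\<close>; composing with it turns realisations of \<open>G\<close>
  into realisations of \<open>G'\<close> in which the copies coincide.\<close>

definition merge_to :: "'a \<Rightarrow> 'a \<Rightarrow> 'a \<Rightarrow> 'a \<Rightarrow> 'a" where
  "merge_to x x1 x2 v = (if v = x1 \<or> v = x2 then x else v)"

lemma spider_splitD:
  assumes "spider_split d V E x N1 N2 W x1 x2 V' E'"
  shows "x \<in> V" "N1 \<inter> N2 = {}" "N1 \<inter> W = {}" "N2 \<inter> W = {}" "N1 \<union> N2 \<union> W = nbhd E x"
    "card W = d" "x1 \<noteq> x2" "x1 \<notin> V - {x}" "x2 \<notin> V - {x}" "V' = (V - {x}) \<union> {x1, x2}"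
    "E' = {e \<in> E. x \<notin> e} \<union> {{x1, y} | y. y \<in> N1} \<union> {{x2, y} | y. y \<in> N2}
      \<union> {{x1, w} | w. w \<in> W} \<union> {{x2, w} | w. w \<in> W}"
  using assms unfolding spider_split_def by - (elim conjE, assumption)+

lemma spider_split_spokes:
  assumes G: "graph V E" and S: "spider_split d V E x N1 N2 W x1 x2 V' E'" and y: "y \<in> N1 \<union> N2 \<union> W"
  shows "{x, y} \<in> E" "y \<in> V" "y \<noteq> x" "y \<noteq> x1" "y \<noteq> x2"
proof -
  show xy: "{x, y} \<in> E" using y unfolding spider_splitD(5)[OF S] nbhd_def by simp
  obtain u v where "{x, y} = {u, v}" "u \<noteq> v" "u \<in> V" "v \<in> V" by (rule graph_edge[OF G xy])
  then show yV: "y \<in> V" "y \<noteq> x" by (auto simp: doubleton_eq_iff)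
  then show "y \<noteq> x1" "y \<noteq> x2" using spider_splitD(8,9)[OF S] by auto
qed

text \<open>A new vertex may reuse the name \<open>x\<close>, so it is avoiding \<open>x\<close>,
  not freshness of the names, that keeps an old edge away from both copies.\<close>

lemma spider_split_old_edge:
  assumes G: "graph V E" and S: "spider_split d V E x N1 N2 W x1 x2 V' E'" and e: "e \<in> E" "x \<notin> e"
  obtains u v where "e = {u, v}" "u \<noteq> v" "u \<in> V'" "v \<in> V'" "u \<noteq> x1" "u \<noteq> x2" "v \<noteq> x1" "v \<noteq> x2"
proof -
  obtain u v where uv: "e = {u, v}" "u \<noteq> v" "u \<in> V" "v \<in> V" by (rule graph_edge[OF G e(1)])
  then have "u \<in> V - {x}" "v \<in> V - {x}" using e(2) by auto
  moreover from this have "u \<noteq> x1" "u \<noteq> x2" "v \<noteq> x1" "v \<noteq> x2"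
    using spider_splitD(8,9)[OF S] by auto
  ultimately show ?thesis using uv(1,2) spider_splitD(10)[OF S] by (intro that[of u v]) auto
qed

lemma spider_split_cases:
  assumes S: "spider_split d V E x N1 N2 W x1 x2 V' E'" and e: "e \<in> E'"
  obtains "e \<in> E" "x \<notin> e"
    | y where "e = {x1, y}" "y \<in> N1" | y where "e = {x1, y}" "y \<in> W"
    | y where "e = {x2, y}" "y \<in> N2" | y where "e = {x2, y}" "y \<in> W"
  using e unfolding spider_splitD(11)[OF S] by (elim UnE CollectE conjE exE)

lemma graph_spider_split:
  assumes G: "graph V E" and S: "spider_split d V E x N1 N2 W x1 x2 V' E'"
  shows "graph V' E'"
proof -
  note V' = spider_splitD(10)[OF S]
  have new: "y \<in> V'" "y \<noteq> x1" "y \<noteq> x2" if "y \<in> N1 \<union> N2 \<union> W" for y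
    using spider_split_spokes[OF G S that] unfolding V' by auto
  have "\<exists>u v. e = {u, v} \<and> u \<noteq> v \<and> u \<in> V' \<and> v \<in> V'" if "e \<in> E'" for e
    using S that
  proof (cases rule: spider_split_cases)
    case 1
    then show ?thesis by (rule spider_split_old_edge[OF G S]) blast
  next
    case (2 y)
    then show ?thesis using new[of y] V' by (intro exI[of _ x1] exI[of _ y]) auto
  next
    case (3 y)
    then show ?thesis using new[of y] V' by (intro exI[of _ x1] exI[of _ y]) auto
  next
    case (4 y)
    then show ?thesis using new[of y] V' by (intro exI[of _ x2] exI[of _ y]) auto
  next
    case (5 y)
    then show ?thesis using new[of y] V' by (intro exI[of _ x2] exI[of _ y]) auto
  qed
  then show ?thesis using G V' unfolding graph_def by simp
qed

lemma merge_to_edge: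
  assumes G: "graph V E" and S: "spider_split d V E x N1 N2 W x1 x2 V' E'" and e: "{u, v} \<in> E'"
  shows "{merge_to x x1 x2 u, merge_to x x1 x2 v} \<in> E"
proof -
  have spoke: "merge_to x x1 x2 ` {x1, y} \<in> E" "merge_to x x1 x2 ` {x2, y} \<in> E"
    if "y \<in> N1 \<union> N2 \<union> W" for y
    using spider_split_spokes[OF G S that] by (simp_all add: merge_to_def insert_commute)
  have "merge_to x x1 x2 ` {u, v} \<in> E"
    using S e
  proof (cases rule: spider_split_cases)
    case 1
    then obtain a b where "{u, v} = {a, b}" "a \<noteq> x1" "a \<noteq> x2" "b \<noteq> x1" "b \<noteq> x2"
      by (rule spider_split_old_edge[OF G S])
    then have "merge_to x x1 x2 ` {u, v} = {u, v}" by (simp add: merge_to_def)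
    then show ?thesis using 1 by simp
  next
    case (2 y)
    then show ?thesis unfolding 2(1) by (intro spoke) simp
  next
    case (3 y)
    then show ?thesis unfolding 3(1) by (intro spoke) simp
  next
    case (4 y)
    then show ?thesis unfolding 4(1) by (intro spoke) simp
  next
    case (5 y)
    then show ?thesis unfolding 5(1) by (intro spoke) simp
  qed
  then show ?thesis by simp
qed

lemma equivalent_merge:
  assumes "graph V E" "spider_split d V E x N1 N2 W x1 x2 V' E'" "equivalent E p q"
  shows "equivalent E' (p \<circ> merge_to x x1 x2) (q \<circ> merge_to x x1 x2)"
  using merge_to_edge[OF assms(1,2)] assms(3) unfolding equivalent_def by simp

text \<open>When \<open>x1\<close> and \<open>x2\<close> sit at the same point, a motion of the original framework together with
  separate corrections of the two copies of \<open>x\<close>, chosen to fix the doubled spokes, realises any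
  prescribed edge velocities.\<close>
lemma spider_split_regular:
  fixes q :: "'a \<Rightarrow> complex ^ 'n::finite"
  assumes G: "graph V E" and S: "spider_split CARD('n) V E x N1 N2 W x1 x2 V' E'"
    and w: "bij_betw w (UNIV :: 'n set) W" and det: "det (spokes w x q) \<noteq> 0"
    and reg: "\<And>t. \<exists>v. \<forall>e\<in>E. pder (coords q) v (edge_exp e) = t e"
  shows "\<exists>v. \<forall>e\<in>E'. pder (coords (q \<circ> merge_to x x1 x2)) v (edge_exp e) = t e"
proof -
  let ?q = "q \<circ> merge_to x x1 x2"
  define dot where "dot a b = 2 * (\<Sum>i\<in>UNIV. a $ i * b $ i)" for a b :: "complex ^ 'n"
  have dot_add: "dot a (b + c) = dot a b + dot a c" for a b c
    unfolding dot_def by (simp add: sum.distrib algebra_simps)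
  have der: "pder (coords r) (coords m) (edge_exp {u, v}) = dot (r u - r v) (m u - m v)"
    for r m :: "'a \<Rightarrow> complex ^ 'n" and u v
    unfolding pder_edge_exp dot_def by simp
  obtain M' where M': "spokes w x q ** M' = mat 1"
    using det unfolding invertible_det_nz[symmetric] invertible_def by blast
  have "\<exists>b. \<forall>y\<in>W. dot (q x - q y) b = s y" for s :: "'a \<Rightarrow> complex"
  proof -
    \<comment> \<open>The factor \<open>-1/2\<close> compensates for the \<open>2\<close> inside
      \<open>dot\<close> and for the spokes pointing away from \<open>x\<close>.\<close>
    define b where "b = M' *v (\<chi> k. - s (w k) / 2)"
    have "spokes w x q *v b = (\<chi> k. - s (w k) / 2)"
      unfolding b_def by (simp add: matrix_vector_mul_assoc M')
    then have b: "(\<Sum>i\<in>UNIV. (q (w k) - q x) $ i * b $ i) = - s (w k) / 2" for k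
      by (simp add: vec_eq_iff matrix_vector_mult_def spokes_def)
    have "dot (q x - q (w k)) b = s (w k)" for k
    proof -
      have "dot (q x - q (w k)) b = - 2 * (\<Sum>i\<in>UNIV. (q (w k) - q x) $ i * b $ i)"
        unfolding dot_def by (simp add: sum_negf[symmetric] algebra_simps sum_subtractf)
      then show ?thesis unfolding b by simp
    qed
    then show ?thesis using w by (intro exI[of _ b]) (metis bij_betw_iff_bijections)
  qed
  then obtain b where b: "\<And>s y. y \<in> W \<Longrightarrow> dot (q x - q y) (b s) = s y" by metis
  define b1 where "b1 = b (\<lambda>y. t {x1, y})"
  define b2 where "b2 = b (\<lambda>y. t {x2, y})"
  \<comment> \<open>The velocities to be produced by the motion \<open>m\<close> of the old
    framework. On \<open>W\<close> they are zero, because the corrections \<open>b1\<close> and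
    \<open>b2\<close> already supply the prescribed values there; on \<open>N1\<close> and
    \<open>N2\<close> they offset what the correction of the respective copy adds.\<close>
  define s where "s y = (if y \<in> N1 then t {x1, y} - dot (q x - q y) b1 else
    if y \<in> N2 then t {x2, y} - dot (q x - q y) b2 else 0)" for y
  define t0 where "t0 e = (if x \<in> e then s (THE y. e = {x, y}) else t e)" for e
  have t0: "t0 {x, y} = s y" for y
  proof -
    have "(THE z. {x, y} = {x, z}) = y" by (rule the_equality) (auto simp: doubleton_eq_iff)
    then show ?thesis unfolding t0_def by simp
  qed
  obtain v where v: "\<And>e. e \<in> E \<Longrightarrow> pder (coords q) v (edge_exp e) = t0 e" using reg by metis
  define m where "m = realization v"
  have m: "dot (q a - q c) (m a - m c) = t0 {a, c}" if "{a, c} \<in> E" for a c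
    using v[OF that] der[of q m a c] unfolding m_def by simp
  define m' where "m' a = (if a = x1 then m x + b1 else if a = x2 then m x + b2 else m a)" for a
  note x12 = spider_splitD(7)[OF S] and disj = spider_splitD(2-4)[OF S]
  have m'1: "dot (q x - q y) (m' x1 - m' y) = s y + dot (q x - q y) b1"
    and m'2: "dot (q x - q y) (m' x2 - m' y) = s y + dot (q x - q y) b2" if "y \<in> N1 \<union> N2 \<union> W" for y
  proof -
    have y: "{x, y} \<in> E" "y \<noteq> x1" "y \<noteq> x2" using spider_split_spokes[OF G S that] by auto
    have "m' x1 - m' y = (m x - m y) + b1" "m' x2 - m' y = (m x - m y) + b2"
      unfolding m'_def using y x12 by auto
    then show "dot (q x - q y) (m' x1 - m' y) = s y + dot (q x - q y) b1"
      "dot (q x - q y) (m' x2 - m' y) = s y + dot (q x - q y) b2"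
      using m[OF y(1)] by (simp_all add: dot_add t0)
  qed
  have q': "?q x1 = q x" "?q x2 = q x" "\<And>a. a \<noteq> x1 \<Longrightarrow> a \<noteq> x2 \<Longrightarrow> ?q a = q a"
    unfolding merge_to_def by auto
  have "pder (coords ?q) (coords m') (edge_exp e) = t e" if "e \<in> E'" for e
    using S that
  proof (cases rule: spider_split_cases)
    case 1
    then obtain a c where ac: "e = {a, c}" "a \<noteq> x1" "a \<noteq> x2" "c \<noteq> x1" "c \<noteq> x2"
      by (rule spider_split_old_edge[OF G S])
    have "pder (coords ?q) (coords m') (edge_exp e) = dot (q a - q c) (m a - m c)"
      unfolding ac(1) der q'(3)[OF ac(2,3)] q'(3)[OF ac(4,5)] using ac by (simp add: m'_def)
    also have "\<dots> = t0 e" using m[of a c] 1(1) unfolding ac(1) .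
    also have "\<dots> = t e" unfolding t0_def using 1(2) by simp
    finally show ?thesis .
  next
    case (2 y)
    then have y: "y \<in> N1 \<union> N2 \<union> W" by simp
    show ?thesis using 2 m'1[OF y] spider_split_spokes[OF G S y] unfolding 2(1) der
      by (simp add: merge_to_def s_def)
  next
    case (3 y)
    then have y: "y \<in> N1 \<union> N2 \<union> W" by simp
    have "s y = 0" using 3 disj unfolding s_def by auto
    then show ?thesis using 3 m'1[OF y] spider_split_spokes[OF G S y] b[OF 3(2)] unfolding 3(1) der
      by (simp add: merge_to_def b1_def)
  next
    case (4 y)
    then have y: "y \<in> N1 \<union> N2 \<union> W" by simp
    have "s y = t {x2, y} - dot (q x - q y) b2" using 4 disj unfolding s_def by auto
    then show ?thesis using 4 m'2[OF y] spider_split_spokes[OF G S y] unfolding 4(1) der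
      by (simp add: merge_to_def)
  next
    case (5 y)
    then have y: "y \<in> N1 \<union> N2 \<union> W" by simp
    have "s y = 0" using 5 disj unfolding s_def by auto
    then show ?thesis using 5 m'2[OF y] spider_split_spokes[OF G S y] b[OF 5(2)] unfolding 5(1) der
      by (simp add: merge_to_def b2_def)
  qed
  then show ?thesis by blast
qed

section \<open>Comparing numbers of congruence classes\<close>

text \<open>The count may be infinite, and the deformation argument has uniform bounds only for
  finitely many points; hence the comparison through finite families, with a lifting
  \<open>b\<close> that may depend on the family.\<close>

lemma num_classes_mono:
  fixes p p' :: "'a \<Rightarrow> complex ^ 'n::finite"
  assumes lift: "\<And>R. finite R \<Longrightarrow> (\<And>q. q \<in> R \<Longrightarrow> equivalent E p q) \<Longrightarrow>
    (\<And>q r. q \<in> R \<Longrightarrow> r \<in> R \<Longrightarrow> q \<noteq> r \<Longrightarrow> \<not> congruent_on V q r) \<Longrightarrow>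
    \<exists>b. \<forall>q\<in>R. equivalent E' p' (b q) \<and> (\<forall>r\<in>R. q \<noteq> r \<longrightarrow> \<not> congruent_on V' (b q) (b r))"
  shows "num_classes V E p \<le> num_classes V' E' p'"
proof -
  define cls where "cls q = {q'. equivalent E p q' \<and> congruent_on V q q'}" for q
  define cls' where "cls' q = {q'. equivalent E' p' q' \<and> congruent_on V' q q'}" for q
  define S where "S = cls ` {q. equivalent E p q}"
  define S' where "S' = cls' ` {q. equivalent E' p' q}"
  have key: "card F \<le> card S'" if F: "finite F" "F \<subseteq> S" and "finite S'" for F
  proof -
    have "\<forall>C\<in>F. \<exists>q. equivalent E p q \<and> cls q = C" using F(2) unfolding S_def by auto
    from bchoice[OF this] obtain r where r: "\<And>C. C \<in> F \<Longrightarrow> equivalent E p (r C) \<and> cls (r C) = C" by blast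
    have inj: "inj_on r F" using r by (metis inj_onI)
    have "\<not> congruent_on V a c" if "a \<in> r ` F" "c \<in> r ` F" "a \<noteq> c" for a c
    proof
      assume "congruent_on V a c"
      then have "cls a = cls c"
        unfolding cls_def using congruent_on_trans congruent_on_sym by blast
      then show False using that r by auto
    qed
    from lift[OF finite_imageI[OF F(1)] _ this] r obtain b where
      b: "\<forall>q\<in>r ` F. equivalent E' p' (b q) \<and> (\<forall>s\<in>r ` F. q \<noteq> s \<longrightarrow> \<not> congruent_on V' (b q) (b s))"
      by blast
    have "inj_on (cls' \<circ> b) (r ` F)"
    proof (rule inj_onI, rule ccontr)
      fix a c assume ac: "a \<in> r ` F" "c \<in> r ` F" "(cls' \<circ> b) a = (cls' \<circ> b) c" "a \<noteq> c"
      have "b c \<in> cls' (b c)" unfolding cls'_def using b ac(2) congruent_on_refl by blast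
      then have "congruent_on V' (b a) (b c)" using ac(3) unfolding cls'_def by auto
      then show False using b ac by blast
    qed
    then have "inj_on (cls' \<circ> b \<circ> r) F" using inj by (simp add: comp_inj_on)
    moreover have "(cls' \<circ> b \<circ> r) ` F \<subseteq> S'" unfolding S'_def using b by auto
    ultimately show ?thesis using \<open>finite S'\<close> by (rule card_inj_on_le)
  qed
  have "finite S \<and> card S \<le> card S'" if fin: "finite S'"
  proof -
    have "finite S"
    proof (rule ccontr)
      \<comment> \<open>An infinite set of classes would contain a finite family with one member too
        many.\<close>
      assume "infinite S"
      then obtain F where "finite F" "card F = Suc (card S')" "F \<subseteq> S"
        using infinite_arbitrarily_large by blast
      then show False using key[of F] fin by simp
    qed
    then show ?thesis using key[of S] fin by simp
  qed
  moreover have "num_classes V E p = (if finite S then enat (card S) else \<infinity>)"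
    unfolding num_classes_def S_def cls_def Let_def image_Collect by (simp add: Setcompr_eq_image)
  moreover have "num_classes V' E' p' = (if finite S' then enat (card S') else \<infinity>)"
    unfolding num_classes_def S'_def cls'_def Let_def image_Collect by (simp add: Setcompr_eq_image)
  ultimately show ?thesis by auto
qed

theorem theorem4p11:
  fixes V V' :: "'a set" and E E' :: "'a set set" and x x1 x2 :: 'a and N1 N2 W :: "'a set"
  assumes "graph V E"
    and "min_d_rigid V E TYPE('n::finite)"
    and "card V \<ge> CARD('n) + 1"
    and "spider_split CARD('n) V E x N1 N2 W x1 x2 V' E'"
  shows "c_d V' E' TYPE('n) \<ge> c_d V E TYPE('n)"
proof -
  note G = assms(1) and S = assms(4)
  let ?\<pi> = "merge_to x x1 x2"
  have G': "graph V' E'" by (rule graph_spider_split[OF G S])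
  have finV: "finite V" "finite V'" using G G' unfolding graph_def by auto
  obtain p0 :: "'a \<Rightarrow> real ^ 'n" where p0: "generic_r V p0" "rigid_framework V E p0"
    using assms(2) unfolding min_d_rigid_def d_rigid_def by blast
  \<comment> \<open>If \<open>E - {e}\<close> is not \<open>d_rigid\<close>, no generic framework of
    it is rigid, in particular not the one given by the fixed \<open>p0\<close>.\<close>
  have ind0: "indep E (edge_vals (cpx p0))"
    using assms(2) p0(1) unfolding min_d_rigid_def d_rigid_def by (intro min_rigid_indep[OF G p0]) blast
  define p where "p = (SOME p :: 'a \<Rightarrow> complex ^ 'n. generic_c V p)"
  define p' where "p' = (SOME p :: 'a \<Rightarrow> complex ^ 'n. generic_c V' p)"
  have p: "generic_c V p" unfolding p_def by (rule someI_ex[OF generic_c_exists[OF finV(1)]])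
  have p': "generic_c V' p'" unfolding p'_def by (rule someI_ex[OF generic_c_exists[OF finV(2)]])
  have indp: "indep E (edge_vals p)"
    by (rule indep_edge_vals_transfer[OF G ind0 generic_c_indep[OF finV(1) p]])
  note W = spider_splitD(6,1)[OF S]
  have WV: "W \<subseteq> V - {x}" using spider_split_spokes(2,3)[OF G S] by blast
  have "finite W" using WV finV(1) by (meson finite_Diff finite_subset)
  then obtain w where w: "bij_betw w (UNIV :: 'n set) W"
    using W(1) finite_same_card_bij[of "UNIV :: 'n set" W] by auto
  have wV: "range w \<subseteq> V" "inj w" "x \<notin> range w" using w WV unfolding bij_betw_def by blast+
  have det: "det (spokes w x q) \<noteq> 0" if "equivalent E p q" for q
    using det_spokes_nonzero[OF G p0 ind0 p that W(2) wV(3,1,2)] .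
  have reg: "\<exists>v. \<forall>e\<in>E. pder (coords q) v (edge_exp e) = t e" if "equivalent E p q" for q t
  proof (rule indep_jacobian_surj)
    show "finite (V \<times> (UNIV :: 'n set))" using finV by simp
    show "pvars (edge_exp e :: ('a \<times> 'n) pexp) \<subseteq> V \<times> UNIV" if "e \<in> E" for e
      by (rule pvars_graph_edge[OF G that])
    \<comment> \<open>\<open>q\<close> need not be generic; what counts is that it has the same edge
      values as \<open>p\<close>.\<close>
    show "indep E (edge_vals q)" unfolding indep_def
    proof (intro allI impI)
      fix c and z :: "'a set \<Rightarrow> complex" assume c: "pvars c \<subseteq> E" "peval (edge_vals q) c = 0"
      have "peval (edge_vals p) c = peval (edge_vals q) c"
        using that c(1) unfolding equivalent_iff_complex[OF G] by (intro peval_cong[of c]) blast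
      then show "peval z c = 0" using indp c unfolding indep_def by metis
    qed
  qed
  have "num_classes V E p \<le> num_classes V' E' p'"
  proof (rule num_classes_mono)
    fix R assume R: "finite R" "\<And>q. q \<in> R \<Longrightarrow> equivalent E p q"
      "\<And>q r. q \<in> R \<Longrightarrow> r \<in> R \<Longrightarrow> q \<noteq> r \<Longrightarrow> \<not> congruent_on V q r"
    \<comment> \<open>A pair of vertices of \<open>G'\<close> whose images in \<open>G\<close> are
      at different squared distances in \<open>q\<close> and \<open>r\<close>. Such a pair exists
      for incongruent \<open>q\<close> and \<open>r\<close>, since both have independent
      spokes.\<close>
    define sep where "sep q r ac \<longleftrightarrow> fst ac \<in> V' \<and> snd ac \<in> V' \<and>
        sqd (q (?\<pi> (fst ac))) (q (?\<pi> (snd ac))) \<noteq> sqd (r (?\<pi> (fst ac))) (r (?\<pi> (snd ac)))"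
      for q r :: "'a \<Rightarrow> complex ^ 'n" and ac
    define uv where "uv q r = (SOME ac. sep q r ac)" for q r
    have uv: "sep q r (uv q r)" if qr: "q \<in> R" "r \<in> R" "q \<noteq> r" for q r
      unfolding uv_def
    proof (rule someI_ex)
      obtain u v where uv: "u \<in> V" "v \<in> V" "sqd (q u) (q v) \<noteq> sqd (r u) (r v)"
        using congruent_of_sqd_eq[OF W(2) wV(1) det[OF R(2)[OF qr(1)]] det[OF R(2)[OF qr(2)]]] R(3)[OF qr]
        by blast
      have lift: "\<exists>a\<in>V'. ?\<pi> a = u" if "u \<in> V" for u
        using spider_splitD(7-10)[OF S] that unfolding merge_to_def
        by (intro bexI[of _ "if u = x then x1 else u"]) auto
      obtain a where a: "a \<in> V'" "?\<pi> a = u" using lift[OF uv(1)] by blast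
      obtain c where c: "c \<in> V'" "?\<pi> c = v" using lift[OF uv(2)] by blast
      show "\<exists>ac. sep q r ac"
        by (rule exI[of _ "(a, c)"]) (simp add: sep_def a c uv(3))
    qed
    \<comment> \<open>On the diagonal nothing is separated and \<open>uv\<close> is unspecified; a
      constant there keeps the bound on the variables valid for all pairs.\<close>
    define h :: "('a \<Rightarrow> complex ^ 'n) \<Rightarrow> ('a \<Rightarrow> complex ^ 'n) \<Rightarrow> ('a \<times> 'n) pexp" where
      "h q r = (if q = r then PConst 0 else edge_exp {fst (uv q r), snd (uv q r)})" for q r
    have "\<exists>b. (\<forall>q\<in>R. \<forall>e\<in>E'. peval (b q) (edge_exp e) = peval (coords p') (edge_exp e)) \<and>
      (\<forall>q\<in>R. \<forall>r\<in>R. q \<noteq> r \<longrightarrow> peval (b q) (h q r) \<noteq> peval (b r) (h q r))"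
    \<comment> \<open>The base point is the special realisation with both copies at
      \<open>p x\<close>, and each \<open>q\<close> contributes its own merged realisation over
      it.\<close>
    proof (rule regular_fibre_points_persist[where z = "coords (p \<circ> ?\<pi>)" and r = "\<lambda>q. coords (q \<circ> ?\<pi>)"])
      show "finite (V' \<times> (UNIV :: 'n set))" using finV by simp
      show "indep (V' \<times> UNIV) (coords p')" by (rule generic_c_indep[OF finV(2) p'])
      show "finite R" by (rule R(1))
      show "finite E'" by (rule graph_finite_edges[OF G'])
      show "pvars (edge_exp e :: ('a \<times> 'n) pexp) \<subseteq> V' \<times> UNIV" if "e \<in> E'" for e
        by (rule pvars_graph_edge[OF G' that])
      show "pvars (h q r) \<subseteq> V' \<times> UNIV" if "q \<in> R" "r \<in> R" for q r
      proof (cases "q = r")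
        case False
        then have "{fst (uv q r), snd (uv q r)} \<times> UNIV \<subseteq> V' \<times> UNIV" using uv[OF that] unfolding sep_def by blast
        then show ?thesis unfolding h_def using False order_trans[OF pvars_edge_exp] by simp
      qed (simp add: h_def)
      show "edge_vals (q \<circ> ?\<pi>) e = edge_vals (p \<circ> ?\<pi>) e" if "q \<in> R" "e \<in> E'" for q e
        using equivalent_merge[OF G S R(2)[OF that(1)]] that(2) unfolding equivalent_iff_complex[OF G'] by simp
      show "peval (coords (q \<circ> ?\<pi>)) (h q r) \<noteq> peval (coords (r \<circ> ?\<pi>)) (h q r)"
        if "q \<in> R" "r \<in> R" "q \<noteq> r" for q r
        using uv[OF that] that(3) unfolding h_def sep_def by (simp add: peval_edge_exp_cpx)
      show "\<exists>v. \<forall>e\<in>E'. pder (coords (q \<circ> ?\<pi>)) v (edge_exp e) = t e" if "q \<in> R" for q t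
        using spider_split_regular[OF G S w det[OF R(2)[OF that]] reg[OF R(2)[OF that]]] .
    qed
    then obtain b where b: "\<forall>q\<in>R. \<forall>e\<in>E'. peval (b q) (edge_exp e) = edge_vals p' e"
      "\<forall>q\<in>R. \<forall>r\<in>R. q \<noteq> r \<longrightarrow> peval (b q) (h q r) \<noteq> peval (b r) (h q r)"
      by (elim exE conjE)
    have "equivalent E' p' (realization (b q))" if "q \<in> R" for q
      using bspec[OF b(1) that] unfolding equivalent_iff_complex[OF G'] by simp
    moreover have "\<not> congruent_on V' (realization (b q)) (realization (b r))"
      if qr: "q \<in> R" "r \<in> R" "q \<noteq> r" for q r
    proof
      assume c: "congruent_on V' (realization (b q)) (realization (b r))"
      let ?e = "edge_exp {fst (uv q r), snd (uv q r)} :: ('a \<times> 'n) pexp"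
      have "fst (uv q r) \<in> V'" "snd (uv q r) \<in> V'" using uv[OF qr] unfolding sep_def by blast+
      from sqd_congruent[OF c this] have "peval (b r) ?e = peval (b q) ?e"
        unfolding peval_edge_exp_cpx[symmetric] coords_realization .
      then show False using bspec[OF bspec[OF b(2) qr(1)] qr(2)] qr(3) unfolding h_def by simp
    qed
    ultimately show "\<exists>b. \<forall>q\<in>R. equivalent E' p' (b q) \<and> (\<forall>r\<in>R. q \<noteq> r \<longrightarrow> \<not> congruent_on V' (b q) (b r))"
      by (intro exI[of _ "\<lambda>q. realization (b q)"] ballI conjI impI)
  qed
  then show ?thesis unfolding c_d_def p_def p'_def .
qed

end
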